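(* Let $\alpha\in\Lambda$, let $Tx=x+\alpha$ be the rotation by $\alpha$ on $\mathbb{T}=[0,1)$ with Lebesgue measure, and let $f:\mathbb{T}\to\mathbb{R}$ be a strictly positive piecewise absolutely continuous function whose sum of jumps satisfies $S(f)\neq0$. Then the special flow $T^f$ is non-reversible; in fact, $T^f$ is not isomorphic to its inverse.
   Context: For irrational $\alpha$, $(q_n)$ denotes the sequence of denominators of the convergents of the continued fraction expansion of $\alpha$, and $\|t\|$ is the distance of $t$ to the nearest integer. $\Lambda\subset[0,1)$ is the set of irrational $\alpha$ such that for each $\varepsilon>0$ there exist $0<\delta<\varepsilon$ and a subsequence $(n_k)$ with $q_{n_k}\|q_{n_k}\alpha\|\to\delta$. $f:\mathbb{T}\to\mathbb{R}$ is piecewise absolutely continuous if there are $\beta_1,\ldots,\beta_K\in\mathbb{T}$ (cyclically ordered, $\beta_{K+1}=\beta_1$) such that $f|_{(\beta_j,\beta_{j+1})}$ is absolutely continuous for $j=1,\ldots,K$. With $d_j=f_-(\beta_j)-f_+(\beta_j)$, $f_\pm(\beta)=\lim_{y\to\beta^\pm}f(y)$, the sum of jumps is $S(f)=\sum_{j=1}^Kd_j=\int_{\mathbb{T}}f'(x)\,dx$. Special flow: for $f^{(k)}(x)=f(x)+\dots+f(T^{k-1}x)$ ($k>0$), $f^{(0)}=0$, $f^{(k)}(x)=-(f(T^kx)+\dots+f(T^{-1}x))$ ($k<0$), $T^f=(T^f_t)_{t\in\mathbb{R}}$ acts on $X^f=\{(x,s):x\in\mathbb{T},\,0\le s<f(x)\}$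 (with the restriction of the product of Lebesgue measures, normalized) by $T^f_t(x,r)=(T^nx,r+t-f^{(n)}(x))$, where $n\in\mathbb{Z}$ is unique with $f^{(n)}(x)\le r+t<f^{(n+1)}(x)$. A flow $(T_t)$ is isomorphic to its inverse if there is an invertible measure-preserving $S$ with $T_t\circ S=S\circ T_{-t}$ for all $t$; it is reversible if moreover $S$ can be chosen with $S^2=\mathrm{Id}$. *)

theory Defs
  imports "HOL-Analysis.Analysis"
begin

text \<open>
  For irrational \<open>x = [a\<^sub>0; a\<^sub>1, a\<^sub>2, \<dots>]\<close>, \<open>cf_rem x n\<close> is the complete quotient
  \<open>[a\<^sub>n; a\<^sub>n\<^sub>+\<^sub>1, \<dots>]\<close>.
\<close>

primrec cf_rem :: "real \<Rightarrow> nat \<Rightarrow> real" where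
  "cf_rem x 0 = x"
| "cf_rem x (Suc n) = 1 / frac (cf_rem x n)"

definition cf_nth :: "real \<Rightarrow> nat \<Rightarrow> int" where
  "cf_nth x n = \<lfloor>cf_rem x n\<rfloor>"

fun conv_denom :: "real \<Rightarrow> nat \<Rightarrow> int" where
  "conv_denom x 0 = 1"
| "conv_denom x (Suc 0) = cf_nth x 1"
| "conv_denom x (Suc (Suc n)) =
     cf_nth x (Suc (Suc n)) * conv_denom x (Suc n) + conv_denom x n"

definition int_dist :: "real \<Rightarrow> real" where
  "int_dist t = \<bar>t - of_int (round t)\<bar>"

definition Lambda_set :: "real set" where
  "Lambda_set = {\<alpha> \<in> {0..<1}. \<alpha> \<notin> \<rat> \<and>
     (\<forall>\<epsilon>>0. \<exists>\<delta>. 0 < \<delta> \<and> \<delta> < \<epsilon> \<and>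
        (\<exists>n :: nat \<Rightarrow> nat. strict_mono n \<and>
           (\<lambda>k. of_int (conv_denom \<alpha> (n k)) * int_dist (of_int (conv_denom \<alpha> (n k)) * \<alpha>))
             \<longlonglongrightarrow> \<delta>))}"

text \<open>
  The circle is \<open>{0..<1}\<close>; a function on it is given by a function on the reals of which only the
  values on \<open>{0..<1}\<close> matter, and \<open>\<lambda>x. f (frac x)\<close> is its 1-periodic lift.
\<close>

text \<open>
  The usual \<open>\<epsilon>\<close>-\<open>\<delta>\<close> definition: \<open>D\<close> ranges over the finite families of non-overlapping compact
  intervals \<open>k = [Inf k, Sup k]\<close> inside \<open>I\<close>.
\<close>

definition abs_continuous_on :: "real set \<Rightarrow> (real \<Rightarrow> real) \<Rightarrow> bool" where
  "abs_continuous_on I f \<longleftrightarrow>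
     (\<forall>\<epsilon>>0. \<exists>\<delta>>0. \<forall>D. D division_of \<Union>D \<and> \<Union>D \<subseteq> I \<and> (\<Sum>k\<in>D. Sup k - Inf k) < \<delta>
        \<longrightarrow> (\<Sum>k\<in>D. \<bar>f (Sup k) - f (Inf k)\<bar>) < \<epsilon>)"

text \<open>
  The break points are \<open>\<beta> 0, \<dots>, \<beta> (K - 1)\<close>, listed in their cyclic order starting from the least
  one. The value \<open>\<beta> K = \<beta> 0 + 1\<close> is the lift of the first break point with which the last
  arc ends; for \<open>K = 1\<close> the only arc is the circle without one point.
\<close>

definition piecewise_abs_continuous :: "nat \<Rightarrow> (nat \<Rightarrow> real) \<Rightarrow> (real \<Rightarrow> real) \<Rightarrow> bool" where
  "piecewise_abs_continuous K \<beta> f \<longleftrightarrow>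
     0 < K \<and> \<beta> ` {..<K} \<subseteq> {0..<1} \<and> strict_mono_on {..<K} \<beta> \<and> \<beta> K = \<beta> 0 + 1 \<and>
     (\<forall>j<K. abs_continuous_on {\<beta> j<..<\<beta> (Suc j)} (\<lambda>x. f (frac x)))"

definition sum_of_jumps :: "nat \<Rightarrow> (nat \<Rightarrow> real) \<Rightarrow> (real \<Rightarrow> real) \<Rightarrow> real" where
  "sum_of_jumps K \<beta> f =
     (\<Sum>j<K. Lim (at_left (\<beta> j)) (\<lambda>y. f (frac y)) - Lim (at_right (\<beta> j)) (\<lambda>y. f (frac y)))"

definition int_iterate :: "'a set \<Rightarrow> ('a \<Rightarrow> 'a) \<Rightarrow> int \<Rightarrow> 'a \<Rightarrow> 'a" where
  "int_iterate X T k = (if 0 \<le> k then T ^^ nat k else inv_into X T ^^ nat (- k))"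

definition birkhoff_cocycle :: "'a set \<Rightarrow> ('a \<Rightarrow> 'a) \<Rightarrow> ('a \<Rightarrow> real) \<Rightarrow> int \<Rightarrow> 'a \<Rightarrow> real" where
  "birkhoff_cocycle X T f k x =
     (if 0 \<le> k then \<Sum>i\<in>{0..<k}. f (int_iterate X T i x)
      else - (\<Sum>i\<in>{k..<0}. f (int_iterate X T i x)))"

definition special_flow ::
  "'a set \<Rightarrow> ('a \<Rightarrow> 'a) \<Rightarrow> ('a \<Rightarrow> real) \<Rightarrow> real \<Rightarrow> 'a \<times> real \<Rightarrow> 'a \<times> real" where
  "special_flow X T f t = (\<lambda>(x, r).
     let n = (THE n. birkhoff_cocycle X T f n x \<le> r + t \<and> r + t < birkhoff_cocycle X T f (n + 1) x)
     in (int_iterate X T n x, r + t - birkhoff_cocycle X T f n x))"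

definition under_graph :: "'a set \<Rightarrow> ('a \<Rightarrow> real) \<Rightarrow> ('a \<times> real) set" where
  "under_graph X f = {(x, s). x \<in> X \<and> 0 \<le> s \<and> s < f x}"

definition special_flow_measure :: "'a measure \<Rightarrow> ('a \<Rightarrow> real) \<Rightarrow> ('a \<times> real) measure" where
  "special_flow_measure \<mu> f =
     (let Xf = under_graph (space \<mu>) f
      in uniform_measure (restrict_space (\<mu> \<Otimes>\<^sub>M lborel) Xf) Xf)"

text \<open>
  As usual in ergodic theory, all identities between maps are understood almost everywhere; the
  null set in the intertwining relation may depend on \<open>t\<close>. Since every Lebesgue measurable map
  agrees almost everywhere with a Borel map, it makes no difference that Borel sets rather than
  their completion are used below.
\<close>

definition measure_preserving_map :: "'a measure \<Rightarrow> ('a \<Rightarrow> 'a) \<Rightarrow> bool" where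
  "measure_preserving_map M S \<longleftrightarrow> S \<in> M \<rightarrow>\<^sub>M M \<and> distr M M S = M"

definition invertible_measure_preserving :: "'a measure \<Rightarrow> ('a \<Rightarrow> 'a) \<Rightarrow> bool" where
  "invertible_measure_preserving M S \<longleftrightarrow>
     measure_preserving_map M S \<and>
     (\<exists>R. measure_preserving_map M R \<and> (AE x in M. R (S x) = x) \<and> (AE x in M. S (R x) = x))"

definition intertwines_inverse ::
  "'a measure \<Rightarrow> (real \<Rightarrow> 'a \<Rightarrow> 'a) \<Rightarrow> ('a \<Rightarrow> 'a) \<Rightarrow> bool" where
  "intertwines_inverse M \<phi> S \<longleftrightarrow> (\<forall>t. AE x in M. \<phi> t (S x) = S (\<phi> (- t) x))"

definition isomorphic_to_inverse :: "'a measure \<Rightarrow> (real \<Rightarrow> 'a \<Rightarrow> 'a) \<Rightarrow> bool" where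
  "isomorphic_to_inverse M \<phi> \<longleftrightarrow>
     (\<exists>S. invertible_measure_preserving M S \<and> intertwines_inverse M \<phi> S)"

definition reversible_flow :: "'a measure \<Rightarrow> (real \<Rightarrow> 'a \<Rightarrow> 'a) \<Rightarrow> bool" where
  "reversible_flow M \<phi> \<longleftrightarrow>
     (\<exists>S. invertible_measure_preserving M S \<and> intertwines_inverse M \<phi> S \<and>
          (AE x in M. S (S x) = x))"

definition circle_measure :: "real measure" where
  "circle_measure = restrict_space lborel {0..<1}"

definition rotation :: "real \<Rightarrow> real \<Rightarrow> real" where
  "rotation \<alpha> x = frac (x + \<alpha>)"

end

theory Submission
  imports Defs
begin

text \<open>
  Let \<open>q\<close> be a denominator with \<open>q \<parallel>q \<alpha>\<parallel> \<approx> \<delta>\<close>, \<open>c\<close> the integral of \<open>f\<close> and \<open>F\<close> the centred Birkhoff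
  sum \<open>f\<^sup>(\<^sup>q\<^sup>) - q c\<close>, which is bounded by the Denjoy--Koksma inequality. As \<open>T\<^sup>q\<close> is close to the
  identity, the flow at time \<open>q c\<close> moves most points \<open>(x, r)\<close> by about the bounded time \<open>-F x\<close>, and
  at time \<open>2 q c\<close> by about \<open>-(F x + F (x + q \<alpha>))\<close>. If \<open>S\<close> conjugates the flow to its inverse and
  \<open>S (x, r) = (x', r')\<close>, then comparing both descriptions of the flow at \<open>S (x, r)\<close> gives
  \<open>F (x - q \<alpha>) \<approx> F x'\<close> and \<open>F (x - 2 q \<alpha>) \<approx> F (x' + q \<alpha>)\<close> for most points. But \<open>f\<close> grows with
  average slope \<open>S(f)\<close> between its jumps, so that, away from a set of measure \<open>O(\<delta>)\<close>, the increment
  \<open>F (y + q \<alpha>) - F y\<close> is close to one and the same constant \<open>a\<close> with \<open>\<bar>a\<bar> \<approx> \<delta> \<bar>S(f)\<bar>\<close>. Hence \<open>a \<approx> -a\<close>,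
  which is absurd for small \<open>\<delta>\<close>.
\<close>

section \<open>Total variation of absolutely continuous functions\<close>

text \<open>The jumps spoil the increment estimate on a set whose measure is only bounded by a
  multiple of \<delta>, and this bound does not improve along the subsequence. So \<delta> is fixed
  at the start, small enough to leave room for good points; \<Lambda> is what supplies arbitrarily
  small but positive \<delta>. All other errors (in the mean ergodic theorem, in the continuity of
  \<open>S\<close>, and \<parallel>q \<alpha>\<parallel> itself) vanish as q grows with \<delta>
  fixed, so they become small against \<open>a\<close>, and a single large q suffices. Two times are
  needed because time q c alone relates values of F but no increments; the second time supplies
  these, and the reversal of time under \<open>S\<close> changes their sign. As \<open>S\<close> is
  merely measurable, it is used only on a Lusin set. Exceptional sets therefore have to be small in
  measure only, and convergence in L1 of the averages of f' is enough. It needs f' as an integrable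
  density, which is why total variation and the Radon-Nikodym theorem appear.\<close>

lemma division_member:
  fixes k :: "real set"
  assumes "D division_of i" "k \<in> D"
  shows "k = {Inf k..Sup k}" "Inf k \<le> Sup k" "interior k = {Inf k<..<Sup k}"
proof -
  obtain a b where "k = {a..b}" "a \<le> b"
    using division_ofD(3,4)[OF assms] by fastforce
  then show "k = {Inf k..Sup k}" "Inf k \<le> Sup k" "interior k = {Inf k<..<Sup k}" by auto
qed

text \<open>Absolute continuity is stated for sets of intervals, so an indexed family must be turned
  into a set. Dropping the degenerate intervals makes the indexing injective, and they contribute
  nothing to either sum.\<close>

lemma sum_abs_increments_less:
  fixes f :: "real \<Rightarrow> real"
  assumes H: "\<And>D. D division_of \<Union>D \<Longrightarrow> \<Union>D \<subseteq> A \<Longrightarrow> (\<Sum>k\<in>D. Sup k - Inf k) < \<delta>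
      \<Longrightarrow> (\<Sum>k\<in>D. \<bar>f (Sup k) - f (Inf k)\<bar>) < \<epsilon>"
    and fin: "finite I"
    and lu: "\<And>i. i \<in> I \<Longrightarrow> l i \<le> u i" "\<And>i. i \<in> I \<Longrightarrow> {l i..u i} \<subseteq> A"
    and disj: "\<And>i j. i \<in> I \<Longrightarrow> j \<in> I \<Longrightarrow> i \<noteq> j \<Longrightarrow> {l i<..<u i} \<inter> {l j<..<u j} = {}"
    and len: "(\<Sum>i\<in>I. u i - l i) < \<delta>"
  shows "(\<Sum>i\<in>I. \<bar>f (u i) - f (l i)\<bar>) < \<epsilon>"
proof -
  define J where "J = {i\<in>I. l i < u i}"
  define D where "D = (\<lambda>i. {l i..u i}) ` J"
  have J: "J \<subseteq> I" "finite J" using fin by (auto simp: J_def)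
  have inj: "inj_on (\<lambda>i. {l i..u i}) J"
  proof (rule inj_onI)
    fix i j assume ij: "i \<in> J" "j \<in> J" and eq: "{l i..u i} = {l j..u j}"
    then have "l i = l j" "u i = u j"
      using lu(1) J by (auto simp: J_def Icc_eq_Icc)
    moreover have "{l i<..<u i} \<noteq> {}" using ij by (auto simp: J_def)
    ultimately show "i = j" using disj[of i j] ij J by auto
  qed
  have "D division_of \<Union>D"
  proof (rule division_ofI)
    show "finite D" using J by (simp add: D_def)
    show "\<And>K. K \<in> D \<Longrightarrow> \<exists>a b. K = cbox a b" by (auto simp: D_def)
    show "\<And>K. K \<in> D \<Longrightarrow> K \<noteq> {}" by (auto simp: D_def J_def)
    show "interior K1 \<inter> interior K2 = {}" if "K1 \<in> D" "K2 \<in> D" "K1 \<noteq> K2" for K1 K2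
    proof -
      obtain i j where "i \<in> J" "j \<in> J" "K1 = {l i..u i}" "K2 = {l j..u j}"
        using \<open>K1 \<in> D\<close> \<open>K2 \<in> D\<close> by (auto simp: D_def)
      with disj[of i j] J \<open>K1 \<noteq> K2\<close> show ?thesis by auto
    qed
  qed auto
  moreover have "\<Union>D \<subseteq> A" using lu(2) J by (auto simp: D_def subset_iff)
  moreover have "(\<Sum>k\<in>D. Sup k - Inf k) = (\<Sum>i\<in>J. u i - l i)"
    unfolding D_def by (subst sum.reindex[OF inj]) (auto simp: J_def intro!: sum.cong)
  moreover have "(\<Sum>i\<in>J. u i - l i) \<le> (\<Sum>i\<in>I. u i - l i)"
    using lu(1) J fin by (intro sum_mono2) auto
  ultimately have "(\<Sum>k\<in>D. \<bar>f (Sup k) - f (Inf k)\<bar>) < \<epsilon>"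
    using len by (intro H) auto
  also have "(\<Sum>k\<in>D. \<bar>f (Sup k) - f (Inf k)\<bar>) = (\<Sum>i\<in>J. \<bar>f (u i) - f (l i)\<bar>)"
    unfolding D_def by (subst sum.reindex[OF inj]) (auto simp: J_def intro!: sum.cong)
  also have "\<dots> = (\<Sum>i\<in>I. \<bar>f (u i) - f (l i)\<bar>)"
  proof (rule sum.mono_neutral_left)
    show "\<forall>i\<in>I - J. \<bar>f (u i) - f (l i)\<bar> = 0"
    proof
      fix i assume "i \<in> I - J"
      then have "l i = u i" using lu(1)[of i] by (auto simp: J_def)
      then show "\<bar>f (u i) - f (l i)\<bar> = 0" by simp
    qed
  qed (use fin J in auto)
  finally show ?thesis .
qed

text \<open>The variation sums of \<open>f\<close> over partitions in \<open>A\<close>. A chain is a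
  weakly monotone infinite sequence with all terms in \<open>A\<close>, of which only the first
  \<open>n\<close> steps count; clamping or continuing it gives a chain again, without bookkeeping
  of lengths.\<close>

definition chain_sums :: "(real \<Rightarrow> real) \<Rightarrow> real set \<Rightarrow> real set" where
  "chain_sums f A = {t. \<exists>s n. mono s \<and> range s \<subseteq> A \<and> t = (\<Sum>i<n::nat. \<bar>f (s (Suc i)) - f (s i)\<bar>)}"

lemma chain_sumsI:
  "mono s \<Longrightarrow> range s \<subseteq> A \<Longrightarrow> (\<Sum>i<n::nat. \<bar>f (s (Suc i)) - f (s i)\<bar>) \<in> chain_sums f A"
  unfolding chain_sums_def by blast

lemma chain_sumsE:
  assumes "t \<in> chain_sums f A"
  obtains s n where "mono s" "range s \<subseteq> A" "t = (\<Sum>i<n::nat. \<bar>f (s (Suc i)) - f (s i)\<bar>)"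
  using assms unfolding chain_sums_def by blast

lemma zero_in_chain_sums: "x \<in> A \<Longrightarrow> 0 \<in> chain_sums f A"
  using chain_sumsI[of "\<lambda>_. x" A f 0] by (auto simp: mono_def)

lemma chain_sums_mono: "A \<subseteq> B \<Longrightarrow> chain_sums f A \<subseteq> chain_sums f B"
  unfolding chain_sums_def by blast

lemma chain_sums_const: "(\<And>x. x \<in> A \<Longrightarrow> f x = c) \<Longrightarrow> t \<in> chain_sums f A \<Longrightarrow> t = 0"
  by (erule chain_sumsE) (simp add: range_subsetD)

text \<open>Clamping the chain by \<open>min\<close> and \<open>max\<close> at \<open>x\<close>
  gives the two pieces. A step across \<open>x\<close> is split there, so by the triangle inequality
  the pieces together have at least the sum \<open>t\<close>.\<close>

lemma chain_sums_split:
  assumes "t \<in> chain_sums f {..y}" "x \<le> y"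
  obtains t1 t2 where "t1 \<in> chain_sums f {..x}" "t2 \<in> chain_sums f {x..y}" "t \<le> t1 + t2"
proof -
  obtain s n where s: "mono s" "range s \<subseteq> {..y}" "t = (\<Sum>i<n::nat. \<bar>f (s (Suc i)) - f (s i)\<bar>)"
    using assms(1) by (rule chain_sumsE)
  define a where "a i = min (s i) x" for i
  define b where "b i = max (s i) x" for i
  have mono: "mono a" "mono b"
    unfolding a_def b_def using s(1) by (auto intro!: monoI min.mono max.mono dest: monoD)
  have "t \<le> (\<Sum>i<n. \<bar>f (a (Suc i)) - f (a i)\<bar>) + (\<Sum>i<n. \<bar>f (b (Suc i)) - f (b i)\<bar>)"
    unfolding s(3) sum.distrib[symmetric]
  proof (rule sum_mono)
    fix i
    have "s i \<le> s (Suc i)" using s(1) by (simp add: mono_def)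
    then show "\<bar>f (s (Suc i)) - f (s i)\<bar> \<le> \<bar>f (a (Suc i)) - f (a i)\<bar> + \<bar>f (b (Suc i)) - f (b i)\<bar>"
      unfolding a_def b_def by (cases "s i \<le> x"; cases "s (Suc i) \<le> x") (auto simp: min_def max_def)
  qed
  moreover have "range a \<subseteq> {..x}" "range b \<subseteq> {x..y}" using s(2) assms(2)
    by (auto simp: a_def b_def)
  ultimately show ?thesis 
    by (intro that[OF chain_sumsI[OF mono(1)] chain_sumsI[OF mono(2)]])
qed

lemma chain_sums_snoc:
  assumes "t \<in> chain_sums f {..x}" "x \<le> y"
  shows "\<exists>t'\<in>chain_sums f {..y}. t + \<bar>f y - f x\<bar> \<le> t'"
proof -
  obtain s n where s: "mono s" "range s \<subseteq> {..x}" "t = (\<Sum>i<n::nat. \<bar>f (s (Suc i)) - f (s i)\<bar>)"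
    using assms(1) by (rule chain_sumsE)
  \<comment> \<open>Both \<open>x\<close> and \<open>y\<close> are appended. The step from
    \<open>s n\<close> to \<open>x\<close> adds a nonnegative term, the step from \<open>x\<close>
    to \<open>y\<close> the required one.\<close>
  define s' where "s' i = (if i \<le> n then s i else if i = Suc n then x else y)" for i
  have sx: "s i \<le> x" for i using s(2) by auto
  have "mono s'" unfolding mono_iff_le_Suc s'_def
    using s(1) sx assms(2) by (auto simp: mono_iff_le_Suc intro: order.trans)
  moreover have "range s' \<subseteq> {..y}" using sx assms(2) by (auto simp: s'_def intro: order.trans)
  ultimately have "(\<Sum>i<Suc (Suc n). \<bar>f (s' (Suc i)) - f (s' i)\<bar>) \<in> chain_sums f {..y}"
    by (rule chain_sumsI)
  moreover have "(\<Sum>i<n. \<bar>f (s' (Suc i)) - f (s' i)\<bar>) = t"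
    unfolding s(3) by (intro sum.cong) (auto simp: s'_def)
  ultimately show ?thesis by (intro bexI) (auto simp: s'_def)
qed

text \<open>Chains inside the members of \<open>D\<close> refine \<open>D\<close>: their steps form
  one family of non-overlapping intervals, of total length at most that of \<open>D\<close> because
  each chain telescopes. So the \<open>\<delta>\<close> of \<open>f\<close> serves for the variation
  sums as well.\<close>

lemma sum_chain_sums_less:
  fixes f :: "real \<Rightarrow> real"
  assumes H: "\<And>D. D division_of \<Union>D \<Longrightarrow> (\<Sum>k\<in>D. Sup k - Inf k) < \<delta>
      \<Longrightarrow> (\<Sum>k\<in>D. \<bar>f (Sup k) - f (Inf k)\<bar>) < \<epsilon>"
    and D: "D division_of \<Union>D" "(\<Sum>k\<in>D. Sup k - Inf k) < \<delta>"
    and c: "\<And>k. k \<in> D \<Longrightarrow> c k \<in> chain_sums f k"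
  shows "(\<Sum>k\<in>D. c k) < \<epsilon>"
proof -
  have "\<forall>k\<in>D. \<exists>s n. mono s \<and> range s \<subseteq> k \<and> c k = (\<Sum>i<n::nat. \<bar>f (s (Suc i)) - f (s i)\<bar>)"
    using c unfolding chain_sums_def by blast
  then obtain s n where s: "\<And>k. k \<in> D \<Longrightarrow> mono (s k)" "\<And>k. k \<in> D \<Longrightarrow> range (s k) \<subseteq> k"
    "\<And>k. k \<in> D \<Longrightarrow> c k = (\<Sum>i<n k::nat. \<bar>f (s k (Suc i)) - f (s k i)\<bar>)"
    by metis
  have fin: "finite D" using D(1) by auto
  have sk: "s k i \<in> {Inf k..Sup k}" if "k \<in> D" for k i
    using s(2)[OF that] division_member(1)[OF D(1) that] by blast
  define I where "I = (SIGMA k:D. {..<n k})"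
  have sumI: "(\<Sum>p\<in>I. G (fst p) (snd p)) = (\<Sum>k\<in>D. \<Sum>i<n k. G k i)" for G :: "real set \<Rightarrow> nat \<Rightarrow> real"
    unfolding I_def sum.Sigma[OF fin ballI[OF finite_lessThan]] by (intro sum.cong refl) auto
  define l where "l p = s (fst p) (snd p)" for p
  define u where "u p = s (fst p) (Suc (snd p))" for p
  have "(\<Sum>p\<in>I. \<bar>f (u p) - f (l p)\<bar>) < \<epsilon>"
  proof (rule sum_abs_increments_less[where A = UNIV and \<delta> = \<delta> and l = l and u = u])
    show "finite I" using fin by (auto simp: I_def)
    show "l p \<le> u p" if "p \<in> I" for p
      using that s(1) by (auto simp: I_def mono_def l_def u_def)
    have "(\<Sum>p\<in>I. u p - l p)
        = (\<Sum>k\<in>D. \<Sum>i<n k. s k (Suc i) - s k i)"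
      unfolding l_def u_def by (rule sumI[of "\<lambda>k i. s k (Suc i) - s k i"])
    also have "\<dots> \<le> (\<Sum>k\<in>D. Sup k - Inf k)"
    proof (rule sum_mono)
      fix k assume k: "k \<in> D"
      show "(\<Sum>i<n k. s k (Suc i) - s k i) \<le> Sup k - Inf k"
        unfolding sum_lessThan_telescope using sk[OF k, of "n k"] sk[OF k, of 0] by auto
    qed
    finally show "(\<Sum>p\<in>I. u p - l p) < \<delta>" using D by simp
    show "{l p<..<u p} \<inter>
        {l q<..<u q} = {}" if pq: "p \<in> I" "q \<in> I" "p \<noteq> q" for p q
    proof (cases "fst p = fst q")
      case True
      have m: "mono (s (fst p))" using pq s(1) by (auto simp: I_def)
      have "snd p \<noteq> snd q" using True pq by (auto simp: prod_eq_iff)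
      then have "Suc (snd p) \<le> snd q \<or> Suc (snd q) \<le> snd p" by linarith
      then show ?thesis using monoD[OF m, of "Suc (snd p)" "snd q"] monoD[OF m, of "Suc (snd q)" "snd p"]
        by (auto simp: True l_def u_def)
    next
      case False
      have kD: "fst p \<in> D" "fst q \<in> D" using pq by (auto simp: I_def)
      have "interior (fst p) \<inter> interior (fst q) = {}"
        using division_ofD(5)[OF D(1) kD False] .
      moreover have "{l p<..<u p} \<subseteq> interior (fst p)" if "p \<in> I" for p
      proof -
        have k: "fst p \<in> D" using that by (auto simp: I_def)
        show ?thesis unfolding division_member(3)[OF D(1) k]
          using sk[OF k, of "snd p"] sk[OF k, of "Suc (snd p)"] by (auto simp: l_def u_def)
      qed
      ultimately show ?thesis using pq by blast
    qed
    show "(\<Sum>k\<in>D. \<bar>f (Sup k) - f (Inf k)\<bar>) < \<epsilon>"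
      if "D division_of \<Union>D" "(\<Sum>k\<in>D. Sup k - Inf k) < \<delta>" for D
      using that by (rule H)
  qed auto
  also have "(\<Sum>p\<in>I. \<bar>f (u p) - f (l p)\<bar>) = (\<Sum>k\<in>D. \<Sum>i<n k. \<bar>f (s k (Suc i)) - f (s k i)\<bar>)"
    unfolding l_def u_def by (rule sumI[of "\<lambda>k i. \<bar>f (s k (Suc i)) - f (s k i)\<bar>"])
  also have "\<dots> = (\<Sum>k\<in>D. c k)"
    by (intro sum.cong refl) (simp only: s(3))
  finally show ?thesis .
qed

context
  fixes f :: "real \<Rightarrow> real" and a b :: real
  assumes ac: "abs_continuous_on UNIV f"
    and const: "\<forall>x\<le>a. f x = f a" "\<forall>x\<ge>b. f x = f b"
begin

lemma chain_sums_short: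
  assumes "0 < \<epsilon>"
  shows "\<exists>\<delta>>0. \<forall>D c. D division_of \<Union>D \<longrightarrow> (\<Sum>k\<in>D. Sup k - Inf k) < \<delta> \<longrightarrow>
    (\<forall>k\<in>D. c k \<in> chain_sums f k) \<longrightarrow> (\<Sum>k\<in>D. c k) < \<epsilon>"
proof -
  obtain \<delta> where \<delta>: "\<delta> > 0" "\<forall>D. D division_of \<Union>D \<and> \<Union>D \<subseteq> UNIV \<and> (\<Sum>k\<in>D. Sup k - Inf k) < \<delta>
        \<longrightarrow> (\<Sum>k\<in>D. \<bar>f (Sup k) - f (Inf k)\<bar>) < \<epsilon>"
    using ac[unfolded abs_continuous_on_def, rule_format, OF assms] by blast
  have "(\<Sum>k\<in>D. c k) < \<epsilon>" if D: "D division_of \<Union>D" "(\<Sum>k\<in>D. Sup k - Inf k) < \<delta>"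
      and c: "\<forall>k\<in>D. c k \<in> chain_sums f k" for D c
    by (rule sum_chain_sums_less[where f = f, OF _ D]) (use \<delta>(2) c in blast)+
  with \<delta>(1) show ?thesis by blast
qed

lemma chain_sums_short_interval:
  assumes "0 < \<epsilon>"
  shows "\<exists>\<delta>>0. \<forall>x y t. x \<le> y \<longrightarrow> y - x < \<delta> \<longrightarrow> t \<in> chain_sums f {x..y} \<longrightarrow> t < \<epsilon>"
proof -
  obtain \<delta> where \<delta>: "0 < \<delta>" "\<forall>D c. D division_of \<Union>D \<longrightarrow> (\<Sum>k\<in>D. Sup k - Inf k) < \<delta> \<longrightarrow>
    (\<forall>k\<in>D. c k \<in> chain_sums f k) \<longrightarrow> (\<Sum>k\<in>D. c k) < \<epsilon>"
    using chain_sums_short[OF assms] by blast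
  have "t < \<epsilon>" if "x \<le> y" "y - x < \<delta>" "t \<in> chain_sums f {x..y}" for x y t
  proof -
    have "{{x..y}} division_of \<Union>{{x..y}}"
      using division_of_self[of x y] that(1) by simp
    from \<delta>(2)[rule_format, OF this, of "\<lambda>_. t"] that show ?thesis by simp
  qed
  with \<delta>(1) show ?thesis by blast
qed

text \<open>The line is cut into pieces of length \<open>\<delta>/2\<close>, starting at
  \<open>a\<close>. A chain has variation 0 to the left of \<open>a\<close>, less than 1 on each
  piece, and 0 to the right of \<open>b\<close>, so the number of pieces needed to reach
  \<open>b\<close> is a bound.\<close>

lemma bdd_chain_sums: "\<exists>B. \<forall>x. \<forall>t\<in>chain_sums f {..x}. t \<le> B"
proof -
  obtain \<delta> where \<delta>: "0 < \<delta>" "\<And>x y t. \<lbrakk>x \<le> y; y - x < \<delta>; t \<in> chain_sums f {x..y}\<rbrakk> \<Longrightarrow> t < 1"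
    using chain_sums_short_interval[of 1] by auto
  have *: "\<forall>t\<in>chain_sums f {..a + real n * (\<delta>/2)}. t \<le> real n" for n
  proof (induction n)
    case 0
    have "t = 0" if "t \<in> chain_sums f {..a}" for t
      by (rule chain_sums_const[OF _ that, of "f a"]) (use const(1) in blast)
    then show ?case by auto
  next
    case (Suc n)
    show ?case
    proof
      fix t assume t: "t \<in> chain_sums f {..a + real (Suc n) * (\<delta>/2)}"
      have le: "a + real n * (\<delta>/2) \<le> a + real (Suc n) * (\<delta>/2)" using \<delta>(1) by (simp add: field_simps)
      obtain t1 t2 where "t1 \<in> chain_sums f {..a + real n * (\<delta>/2)}"
        "t2 \<in> chain_sums f {a + real n * (\<delta>/2)..a + real (Suc n) * (\<delta>/2)}" "t \<le> t1 + t2"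
        using chain_sums_split[OF t le] by blast
      moreover from this have "t2 < 1" using \<delta> le by (intro \<delta>(2)) (auto simp: field_simps)
      ultimately show "t \<le> real (Suc n)" using Suc by force
    qed
  qed
  obtain n :: nat where "(b - a) / (\<delta>/2) \<le> n" using real_arch_simple by blast
  then have n: "b \<le> a + real n * (\<delta>/2)" using \<delta>(1) by (simp add: field_simps)
  have "t \<le> real n" if t: "t \<in> chain_sums f {..x}" for x t
  proof (cases "x \<le> a + real n * (\<delta>/2)")
    case True
    then show ?thesis using * chain_sums_mono[of "{..x}" "{..a + real n * (\<delta>/2)}" f] t by auto
  next
    case False
    then have le: "a + real n * (\<delta>/2) \<le> x" by simp
    obtain t1 t2 where 1: "t1 \<in> chain_sums f {..a + real n * (\<delta>/2)}"
        "t2 \<in> chain_sums f {a + real n * (\<delta>/2)..x}" "t \<le> t1 + t2"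
      using chain_sums_split[OF t le] by blast
    have "f y = f b" if "a + real n * (\<delta>/2) \<le> y" for y using const(2)[rule_format, of y] that n by linarith
    then have "t2 = 0" using 1(2) by (intro chain_sums_const[of _ f "f b"]) auto
    then show ?thesis using 1 * by force
  qed
  then show ?thesis by blast
qed

definition total_variation :: "real \<Rightarrow> real" where
  "total_variation x = Sup (chain_sums f {..x})"

lemma total_variation_upper: "t \<in> chain_sums f {..x} \<Longrightarrow> t \<le> total_variation x"
  unfolding total_variation_def using bdd_chain_sums by (intro cSup_upper) (auto simp: bdd_above_def)

lemma total_variation_approx: "0 < \<eta> \<Longrightarrow> \<exists>t\<in>chain_sums f {..x}. total_variation x - \<eta> < t"
  unfolding total_variation_def using zero_in_chain_sums[of x "{..x}" f]
  by (intro less_cSupD) auto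

lemma total_variation_diff:
  assumes "x \<le> y"
  shows "\<bar>f y - f x\<bar> \<le> total_variation y - total_variation x"
proof (rule field_le_epsilon)
  fix e :: real assume "0 < e"
  then obtain t where t: "t \<in> chain_sums f {..x}" "total_variation x - e < t"
    using total_variation_approx[of e x] by blast
  obtain t' where "t' \<in> chain_sums f {..y}" "t + \<bar>f y - f x\<bar> \<le> t'"
    using chain_sums_snoc[OF t(1) assms] by blast
  then show "\<bar>f y - f x\<bar> \<le> total_variation y - total_variation x + e"
    using total_variation_upper t by force
qed

lemma total_variation_mono: "x \<le> y \<Longrightarrow> total_variation x \<le> total_variation y"
  using total_variation_diff[of x y] by linarith

lemma total_variation_bounds:
  obtains B where "\<And>x. 0 \<le> total_variation x" "\<And>x. total_variation x \<le> B"
proof -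
  obtain B where B: "\<forall>x. \<forall>t\<in>chain_sums f {..x}. t \<le> B" using bdd_chain_sums by blast
  have "total_variation x \<le> B" for x
    unfolding total_variation_def using zero_in_chain_sums[of x "{..x}" f] B by (intro cSup_least) auto
  moreover have "0 \<le> total_variation x" for x
    using total_variation_upper zero_in_chain_sums[of x "{..x}" f] by auto
  ultimately show ?thesis using that by blast
qed

text \<open>A nearly optimal chain up to \<open>y\<close> is split at \<open>x\<close>; its left
  piece cannot exceed the variation up to \<open>x\<close>.\<close>

lemma total_variation_diff_approx:
  assumes "x \<le> y" "0 < \<eta>"
  shows "\<exists>t\<in>chain_sums f {x..y}. total_variation y - total_variation x \<le> t + \<eta>"
proof -
  obtain t where t: "t \<in> chain_sums f {..y}" "total_variation y - \<eta> < t"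
    using total_variation_approx[of \<eta> y] assms by blast
  obtain t1 t2 where "t1 \<in> chain_sums f {..x}" "t2 \<in> chain_sums f {x..y}" "t \<le> t1 + t2"
    using chain_sums_split[OF t(1) assms(1)] by blast
  then show ?thesis using t total_variation_upper[of t1 x] by (intro bexI[of _ t2]) auto
qed

lemma total_variation_ac: "abs_continuous_on UNIV total_variation"
  unfolding abs_continuous_on_def
proof (intro allI impI)
  fix e :: real assume "0 < e"
  then have e: "0 < e / 3" by simp
  obtain \<delta> where \<delta>: "0 < \<delta>" "\<forall>D c. D division_of \<Union>D \<longrightarrow> (\<Sum>k\<in>D. Sup k - Inf k) < \<delta> \<longrightarrow>
    (\<forall>k\<in>D. c k \<in> chain_sums f k) \<longrightarrow> (\<Sum>k\<in>D. c k) < e / 3"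
    using chain_sums_short[OF e] by blast
  have "(\<Sum>k\<in>D. \<bar>total_variation (Sup k) - total_variation (Inf k)\<bar>) < e"
    if D: "D division_of \<Union>D" "(\<Sum>k\<in>D. Sup k - Inf k) < \<delta>" for D
  proof -
    \<comment> \<open>The supremum is approximated within \<open>\<eta>\<close> on every member of
      \<open>D\<close>, which costs at most \<open>e / 3\<close> in total; the added 1 covers an
      empty \<open>D\<close>.\<close>
    define \<eta> where "\<eta> = e / 3 / (real (card D) + 1)"
    have \<eta>: "0 < \<eta>" using e by (simp add: \<eta>_def)
    have "\<exists>t\<in>chain_sums f k. \<bar>total_variation (Sup k) - total_variation (Inf k)\<bar> \<le> t + \<eta>" if k: "k \<in> D" for k
      using total_variation_diff_approx[of "Inf k" "Sup k" \<eta>] total_variation_mono[of "Inf k" "Sup k"]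
        division_member[OF D(1) k] \<eta> by auto
    then obtain t where t: "\<And>k. k \<in> D \<Longrightarrow> t k \<in> chain_sums f k"
      "\<And>k. k \<in> D \<Longrightarrow> \<bar>total_variation (Sup k) - total_variation (Inf k)\<bar> \<le> t k + \<eta>" by metis
    have "(\<Sum>k\<in>D. \<bar>total_variation (Sup k) - total_variation (Inf k)\<bar>) \<le> (\<Sum>k\<in>D. t k + \<eta>)"
      by (intro sum_mono t)
    also have "\<dots> = (\<Sum>k\<in>D. t k) + card D * \<eta>" by (simp add: sum.distrib)
    also have "card D * \<eta> \<le> e / 3" using e by (simp add: \<eta>_def field_simps)
    finally show ?thesis using \<delta>(2)[rule_format, OF D t(1)] e by linarith
  qed
  with \<delta>(1) show "\<exists>\<delta>>0. \<forall>D. D division_of \<Union>D \<and> \<Union>D \<subseteq> UNIV \<and> (\<Sum>k\<in>D. Sup k - Inf k) < \<delta>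
      \<longrightarrow> (\<Sum>k\<in>D. \<bar>total_variation (Sup k) - total_variation (Inf k)\<bar>) < e" by blast
qed

end

section \<open>Densities of absolutely continuous functions\<close>

lemma abs_continuous_on_increment:
  assumes "abs_continuous_on A f" "0 < \<epsilon>"
  shows "\<exists>\<delta>>0. \<forall>x y. x \<le> y \<longrightarrow> {x..y} \<subseteq> A \<longrightarrow> y - x < \<delta> \<longrightarrow> \<bar>f y - f x\<bar> < \<epsilon>"
proof -
  obtain \<delta> where \<delta>: "\<delta> > 0" "\<forall>D. D division_of \<Union>D \<and> \<Union>D \<subseteq> A \<and> (\<Sum>k\<in>D. Sup k - Inf k) < \<delta>
        \<longrightarrow> (\<Sum>k\<in>D. \<bar>f (Sup k) - f (Inf k)\<bar>) < \<epsilon>"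
    using assms(1)[unfolded abs_continuous_on_def, rule_format, OF assms(2)] by blast
  have "\<bar>f y - f x\<bar> < \<epsilon>" if xy: "x \<le> y" "{x..y} \<subseteq> A" "y - x < \<delta>" for x y
  proof -
    have "{{x..y}} division_of \<Union>{{x..y}}" using division_of_self[of x y] xy(1) by simp
    with \<delta>(2)[rule_format, of "{{x..y}}"] xy show ?thesis by simp
  qed
  with \<delta>(1) show ?thesis by blast
qed

lemma abs_continuous_isCont:
  assumes "abs_continuous_on UNIV F"
  shows "isCont F x"
  unfolding isCont_def LIM_def
proof (intro allI impI)
  fix e :: real assume e: "0 < e"
  obtain \<delta> where \<delta>: "0 < \<delta>" "\<forall>x y. x \<le> y \<longrightarrow> {x..y} \<subseteq> UNIV \<longrightarrow> y - x < \<delta> \<longrightarrow> \<bar>F y - F x\<bar> < e"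
    using abs_continuous_on_increment[OF assms e] by blast
  have "dist (F y) (F x) < e" if "dist y x < \<delta>" for y
    using \<delta>(2)[rule_format, of x y] \<delta>(2)[rule_format, of y x] that
    by (cases "x \<le> y") (auto simp: dist_real_def abs_minus_commute)
  with \<delta>(1) show "\<exists>s>0. \<forall>xa. xa \<noteq> x \<and> dist xa x < s \<longrightarrow> dist (F xa) (F x) < e" by blast
qed

lemma abs_continuous_on_diff:
  assumes "abs_continuous_on A F" "abs_continuous_on A H"
  shows "abs_continuous_on A (\<lambda>x. F x - H x)"
  unfolding abs_continuous_on_def
proof (intro allI impI)
  fix e :: real assume "0 < e"
  then have e: "0 < e / 2" by simp
  obtain d1 where d1: "0 < d1" "\<forall>D. D division_of \<Union>D \<and> \<Union>D \<subseteq> A \<and> (\<Sum>k\<in>D. Sup k - Inf k) < d1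
      \<longrightarrow> (\<Sum>k\<in>D. \<bar>F (Sup k) - F (Inf k)\<bar>) < e / 2"
    using assms(1)[unfolded abs_continuous_on_def, rule_format, OF e] by blast
  obtain d2 where d2: "0 < d2" "\<forall>D. D division_of \<Union>D \<and> \<Union>D \<subseteq> A \<and> (\<Sum>k\<in>D. Sup k - Inf k) < d2
      \<longrightarrow> (\<Sum>k\<in>D. \<bar>H (Sup k) - H (Inf k)\<bar>) < e / 2"
    using assms(2)[unfolded abs_continuous_on_def, rule_format, OF e] by blast
  have "(\<Sum>k\<in>D. \<bar>(F (Sup k) - H (Sup k)) - (F (Inf k) - H (Inf k))\<bar>) < e"
    if "D division_of \<Union>D" "\<Union>D \<subseteq> A" "(\<Sum>k\<in>D. Sup k - Inf k) < min d1 d2" for D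
  proof -
    have "(\<Sum>k\<in>D. \<bar>(F (Sup k) - H (Sup k)) - (F (Inf k) - H (Inf k))\<bar>)
        \<le> (\<Sum>k\<in>D. \<bar>F (Sup k) - F (Inf k)\<bar> + \<bar>H (Sup k) - H (Inf k)\<bar>)"
      by (intro sum_mono) linarith
    then show ?thesis
      using d1(2)[rule_format, of D] d2(2)[rule_format, of D] that by (simp add: sum.distrib)
  qed
  with d1(1) d2(1) show "\<exists>\<delta>>0. \<forall>D. D division_of \<Union>D \<and> \<Union>D \<subseteq> A \<and> (\<Sum>k\<in>D. Sup k - Inf k) < \<delta>
      \<longrightarrow> (\<Sum>k\<in>D. \<bar>(F (Sup k) - H (Sup k)) - (F (Inf k) - H (Inf k))\<bar>) < e"
    by (intro exI[of _ "min d1 d2"]) auto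
qed

text \<open>A compact Lebesgue null set is covered by finitely many intervals inside an open set of
  small measure, and absolute continuity makes the increments of \<open>F\<close> over them small.
  Inner regularity of the finite Stieltjes measure carries this from compact null sets to all null
  sets.\<close>

lemma interval_measure_null:
  fixes F :: "real \<Rightarrow> real"
  assumes mono: "\<And>x y. x \<le> y \<Longrightarrow> F x \<le> F y"
    and bounds: "\<And>x. A \<le> F x" "\<And>x. F x \<le> B"
    and ac: "abs_continuous_on UNIV F"
  shows "finite_measure (interval_measure F)"
    and "absolutely_continuous lborel (interval_measure F)"
proof -
  let ?M = "interval_measure F"
  have cont: "continuous (at_right x) F" for x
    using abs_continuous_isCont[OF ac] by (rule continuous_at_imp_continuous_at_within)
  have Ioc: "emeasure ?M {x<..y} = F y - F x" if "x \<le> y" for x y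
    by (rule emeasure_interval_measure_Ioc[OF that mono cont])
  show fin: "finite_measure ?M"
  proof
    have "(\<lambda>n. emeasure ?M {-real n<..real n}) \<longlonglongrightarrow> emeasure ?M (\<Union>n. {-real n<..real n})"
      by (rule Lim_emeasure_incseq) (auto simp: incseq_def)
    moreover have "(\<Union>n. {-real n<..real n}) = (UNIV :: real set)"
    proof (intro set_eqI iffI UNIV_I)
      fix x :: real
      obtain n where "\<bar>x\<bar> < real n" using reals_Archimedean2 by blast
      then show "x \<in> (\<Union>n. {-real n<..real n})" by (intro UN_I[of n]) auto
    qed
    ultimately have "(\<lambda>n. emeasure ?M {-real n<..real n}) \<longlonglongrightarrow> emeasure ?M UNIV" by simp
    moreover have "emeasure ?M {-real n<..real n} \<le> ennreal (B - A)" for n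
      using bounds(1)[of "- real n"] bounds(2)[of "real n"] by (subst Ioc) (auto intro!: ennreal_leI)
    ultimately have "emeasure ?M UNIV \<le> ennreal (B - A)"
      by (intro LIMSEQ_le_const2) auto
    then show "emeasure ?M (space ?M) \<noteq> \<infinity>"
      by (auto simp: top_unique)
  qed
  then interpret M: finite_measure ?M .
  have cpt: "emeasure ?M C = 0" if C: "compact C" "emeasure lborel C = 0" for C
  proof -
    have "emeasure ?M C \<le> 0 + ennreal \<epsilon>" if e: "0 < \<epsilon>" for \<epsilon>
    proof -
      obtain \<delta> where \<delta>: "0 < \<delta>" "\<forall>D. D division_of \<Union>D \<and> \<Union>D \<subseteq> UNIV \<and> (\<Sum>k\<in>D. Sup k - Inf k) < \<delta>
          \<longrightarrow> (\<Sum>k\<in>D. \<bar>F (Sup k) - F (Inf k)\<bar>) < \<epsilon>"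
        using ac[unfolded abs_continuous_on_def, rule_format, OF e] by blast
      have Cb: "C \<in> sets borel" using C(1) by (simp add: borel_compact)
      obtain U where U: "open U" "C \<subseteq> U" "emeasure lborel (U - C) < ennreal \<delta>"
        using outer_regular_lborel[OF Cb \<delta>(1)] by blast
      have Ub[measurable]: "U \<in> sets borel" using U by simp
      have "emeasure lborel U = emeasure lborel (U - C)"
        using C(2) Cb by (subst emeasure_Diff_null_set) (auto simp: null_sets_def)
      with U have Ulen: "emeasure lborel U < ennreal \<delta>" by simp
      have "\<exists>a b. x \<in> {a<..<b} \<and> {a..b} \<subseteq> U" if "x \<in> C" for x
      proof -
        have "x \<in> U" using U(2) that by (rule subsetD)
        then obtain e where "0 < e" "cball x e \<subseteq> U"
          using open_contains_cball[THEN iffD1, OF U(1)] by blast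
        then show ?thesis by (intro exI[of _ "x - e"] exI[of _ "x + e"]) (simp add: cball_eq_atLeastAtMost)
      qed
      then obtain a b where ab: "\<And>x. x \<in> C \<Longrightarrow> x \<in> {a x<..<b x}" "\<And>x. x \<in> C \<Longrightarrow> {a x..b x} \<subseteq> U"
        by metis
      have cover: "C \<subseteq> (\<Union>x\<in>C. {a x<..<b x})" using ab(1) by blast
      obtain T where T: "T \<subseteq> C" "finite T" "C \<subseteq> (\<Union>x\<in>T. {a x<..<b x})"
        by (rule compactE_image[OF C(1) _ cover]) auto
      let ?F = "(\<lambda>x. {a x..b x}) ` T"
      \<comment> \<open>The covering intervals may overlap; cutting their union into a division
        restores the shape that absolute continuity asks for.\<close>
      obtain D where D: "D division_of \<Union>?F"
        using elementary_unions_intervals[of ?F] T(2) by auto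
      have DU: "\<Union>D = \<Union>?F" by (rule division_ofD(6)[OF D])
      have finD: "finite D" using D by auto
      note k = division_member[OF D]
      have disj: "disjoint_family_on interior D"
        using division_ofD(5)[OF D] by (auto simp: disjoint_family_on_def)
      have "ennreal (\<Sum>k\<in>D. Sup k - Inf k) = (\<Sum>k\<in>D. ennreal (Sup k - Inf k))"
        using k(2) by (subst sum_ennreal) auto
      also have "\<dots> = (\<Sum>k\<in>D. emeasure lborel (interior k))"
        using k(2,3) by (intro sum.cong refl) (simp add: ennreal_minus)
      also have "\<dots> = emeasure lborel (\<Union>k\<in>D. interior k)"
        by (rule sum_emeasure) (use disj finD in auto)
      also have "\<dots> \<le> emeasure lborel U"
      proof (rule emeasure_mono)
        have "interior k \<subseteq> U" if "k \<in> D" for k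
        proof -
          have "k \<subseteq> \<Union>?F" using DU that by blast
          also have "\<dots> \<subseteq> U" using ab(2) T(1) by blast
          finally show ?thesis using interior_subset by blast
        qed
        then show "(\<Union>k\<in>D. interior k) \<subseteq> U" by blast
      qed simp
      finally have "ennreal (\<Sum>k\<in>D. Sup k - Inf k) < ennreal \<delta>" using Ulen by order
      then have "(\<Sum>k\<in>D. Sup k - Inf k) < \<delta>"
        using k(2) \<delta>(1) by (subst (asm) ennreal_less_iff) (auto intro!: sum_nonneg)
      then have "(\<Sum>k\<in>D. \<bar>F (Sup k) - F (Inf k)\<bar>) < \<epsilon>" using \<delta>(2) D DU by auto
      moreover have "(\<Sum>k\<in>D. F (Sup k) - F (Inf k)) \<le> (\<Sum>k\<in>D. \<bar>F (Sup k) - F (Inf k)\<bar>)"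
        by (intro sum_mono) simp
      ultimately have incr: "(\<Sum>k\<in>D. F (Sup k) - F (Inf k)) \<le> \<epsilon>" by linarith
      have kb: "k \<in> sets ?M" if "k \<in> D" for k
        by (subst k(1)[OF that]) simp
      have "C \<subseteq> \<Union>?F"
      proof (rule subset_trans[OF T(3)], rule UN_mono)
        show "{a x<..<b x} \<subseteq> {a x..b x}" for x by (rule greaterThanLessThan_subseteq_atLeastAtMost_iff[THEN iffD2]) simp
      qed simp
      then have "emeasure ?M C \<le> emeasure ?M (\<Union>k\<in>D. k)"
        using DU finD kb by (intro emeasure_mono sets.finite_UN) simp_all
      also have "\<dots> \<le> (\<Sum>k\<in>D. emeasure ?M k)"
        using finD kb by (intro emeasure_subadditive_finite) auto
      also have "\<dots> = (\<Sum>k\<in>D. ennreal (F (Sup k) - F (Inf k)))"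
      proof (intro sum.cong refl)
        fix k' assume kD: "k' \<in> D"
        define x y where "x = Inf k'" "y = Sup k'"
        have xy: "k' = {x..y}" "x \<le> y" using k[OF kD] by (auto simp: x_y_def)
        have "emeasure ?M {x..y} = F y - F x"
          using xy(2) mono abs_continuous_isCont[OF ac]
          by (intro emeasure_interval_measure_Icc) (auto simp: continuous_on_eq_continuous_at)
        then show "emeasure ?M k' = ennreal (F (Sup k') - F (Inf k'))"
          using xy by simp
      qed
      also have "\<dots> = ennreal (\<Sum>k\<in>D. F (Sup k) - F (Inf k))"
        using k(2) mono by (subst sum_ennreal) auto
      also have "\<dots> \<le> ennreal \<epsilon>" using incr by (intro ennreal_leI)
      finally show ?thesis by simp
    qed
    then show ?thesis by (metis ennreal_le_epsilon le_zero_eq zero_le)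
  qed
  show "absolutely_continuous lborel ?M"
    unfolding absolutely_continuous_def
  proof
    fix N :: "real set" assume N: "N \<in> null_sets lborel"
    then have Nb: "N \<in> sets borel" "emeasure lborel N = 0" by auto
    have "emeasure ?M N = (SUP K \<in> {K. K \<subseteq> N \<and> compact K}. emeasure ?M K)"
      using Nb M.emeasure_finite by (intro inner_regular) auto
    also have "\<dots> \<le> 0"
    proof (rule SUP_least)
      fix K assume "K \<in> {K. K \<subseteq> N \<and> compact K}"
      then have K: "K \<subseteq> N" "compact K" by auto
      have "emeasure lborel K \<le> emeasure lborel N" using K Nb by (intro emeasure_mono) auto
      then show "emeasure ?M K \<le> 0" using cpt[OF K(2)] Nb by auto
    qed
    finally show "N \<in> null_sets ?M" using Nb by (auto simp: null_sets_def)
  qed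
qed

text \<open>By \<open>interval_measure_null\<close> the Radon-Nikodym theorem applies to the
  Stieltjes measure of \<open>F\<close>, and its derivative is the density.\<close>

lemma mono_ac_density:
  fixes F :: "real \<Rightarrow> real"
  assumes mono: "\<And>x y. x \<le> y \<Longrightarrow> F x \<le> F y"
    and bounds: "\<And>x. A \<le> F x" "\<And>x. F x \<le> B"
    and ac: "abs_continuous_on UNIV F"
  shows "\<exists>h. integrable lborel h \<and> (\<forall>x y. x \<le> y \<longrightarrow> F y - F x = (LINT t:{x<..y}|lborel. h t))"
proof -
  let ?M = "interval_measure F"
  have cont: "continuous (at_right x) F" for x
    using abs_continuous_isCont[OF ac] by (rule continuous_at_imp_continuous_at_within)
  have M: "finite_measure ?M" "absolutely_continuous lborel ?M"
    by (rule interval_measure_null[where A = A and B = B]; fact)+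
  interpret M: finite_measure ?M by (rule M(1))
  obtain h :: "real \<Rightarrow> real" where h: "h \<in> borel_measurable lborel"
      "AE x in lborel. RN_deriv lborel ?M x = ennreal (h x)" "\<And>x. 0 \<le> h x"
    by (rule sigma_finite_measure.real_RN_deriv[OF sigma_finite_lborel M]) auto
  have "density lborel (RN_deriv lborel ?M) = ?M"
    by (rule sigma_finite_measure.density_RN_deriv[OF sigma_finite_lborel M(2)]) (simp add: sets_interval_measure)
  moreover have "density lborel (RN_deriv lborel ?M) = density lborel (\<lambda>x. ennreal (h x))"
    using h by (intro density_cong) auto
  ultimately have eq: "density lborel (\<lambda>x. ennreal (h x)) = ?M" by simp
  have em: "(\<integral>\<^sup>+t. ennreal (h t) * indicator S t \<partial>lborel) = emeasure ?M S" if "S \<in> sets borel" for S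
    using that h(1) by (subst eq[symmetric], subst emeasure_density) auto
  have "integrable lborel h"
  proof (rule integrableI_nonneg)
    have "(\<integral>\<^sup>+t. ennreal (h t) \<partial>lborel) = emeasure ?M UNIV" using em[of UNIV] by simp
    then show "(\<integral>\<^sup>+t. ennreal (h t) \<partial>lborel) < \<infinity>" using M.emeasure_finite[of UNIV] by (simp add: less_top[symmetric])
  qed (use h in auto)
  moreover have "F y - F x = (LINT t:{x<..y}|lborel. h t)" if xy: "x \<le> y" for x y
  proof -
    have "(LINT t:{x<..y}|lborel. h t) = enn2real (\<integral>\<^sup>+t. ennreal (indicator {x<..y} t *\<^sub>R h t) \<partial>lborel)"
      unfolding set_lebesgue_integral_def using h by (intro integral_eq_nn_integral) auto
    also have "(\<integral>\<^sup>+t. ennreal (indicator {x<..y} t *\<^sub>R h t) \<partial>lborel) = (\<integral>\<^sup>+t. ennreal (h t) * indicator {x<..y} t \<partial>lborel)"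
      by (intro nn_integral_cong) (auto simp: indicator_def)
    also have "\<dots> = F y - F x"
      using em[of "{x<..y}"] emeasure_interval_measure_Ioc[OF xy mono cont] by simp
    finally show ?thesis using mono[OF xy] by simp
  qed
  ultimately show ?thesis by blast
qed

text \<open>Jordan decomposition: \<open>f\<close> is the difference of its variation function v and
  of v - f. Both are bounded, monotone and absolutely continuous, so each has a density.\<close>

lemma abs_continuous_density:
  fixes f :: "real \<Rightarrow> real"
  assumes ac: "abs_continuous_on UNIV f"
    and const: "\<forall>x\<le>a. f x = f a" "\<forall>x\<ge>b. f x = f b"
  shows "\<exists>g. integrable lborel g \<and> (\<forall>x y. x \<le> y \<longrightarrow> f y - f x = (LINT t:{x<..y}|lborel. g t))"
proof -
  let ?v = "total_variation f"
  let ?w = "\<lambda>x. ?v x - f x"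
  note tv = total_variation_mono[OF assms] and tv_ac = total_variation_ac[OF assms]
  obtain B where B: "\<And>x. 0 \<le> ?v x" "\<And>x. ?v x \<le> B" using total_variation_bounds[OF assms] by blast
  have df: "\<bar>f y - f x\<bar> \<le> ?v y - ?v x" if "x \<le> y" for x y
    using total_variation_diff[OF assms that] .
  have fb: "\<bar>f x - f 0\<bar> \<le> B" for x
    using df[of x 0] df[of 0 x] B(1)[of x] B(1)[of 0] B(2)[of x] B(2)[of 0] by (cases "x \<le> 0") auto
  obtain h where h: "integrable lborel h" "\<And>x y. x \<le> y \<Longrightarrow> ?v y - ?v x = (LINT t:{x<..y}|lborel. h t)"
    using mono_ac_density[where F = ?v, OF tv B tv_ac] by blast
  have wmono: "?w x \<le> ?w y" if "x \<le> y" for x y using df[OF that] by linarith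
  have wb: "- (B + \<bar>f 0\<bar>) \<le> ?w x" "?w x \<le> 2 * B + \<bar>f 0\<bar>" for x
    using fb[of x] B(1)[of x] B(2)[of x] by linarith+
  obtain h' where h': "integrable lborel h'" "\<And>x y. x \<le> y \<Longrightarrow> ?w y - ?w x = (LINT t:{x<..y}|lborel. h' t)"
    using mono_ac_density[where F = ?w, OF wmono wb abs_continuous_on_diff[OF tv_ac ac]] by blast
  have "f y - f x = (LINT t:{x<..y}|lborel. h t - h' t)" if "x \<le> y" for x y
  proof -
    have "set_integrable lborel {x<..y} h" "set_integrable lborel {x<..y} h'"
      unfolding set_integrable_def by (rule integrable_mult_indicator; simp add: h(1) h'(1))+
    then have "(LINT t:{x<..y}|lborel. h t - h' t) = (?v y - ?v x) - (?w y - ?w x)"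
      using h(2) h'(2) that by (subst set_integral_diff) auto
    then show ?thesis by simp
  qed
  with h(1) h'(1) show ?thesis by (intro exI[of _ "\<lambda>t. h t - h' t"]) auto
qed

text \<open>One-sided limits at \<open>a\<close> and \<open>b\<close> exist by uniform continuity.
  Taking \<open>F x\<close> as the limit of \<open>f\<close> at the clamped points
  \<open>cl n x\<close> treats inner, end and outer points at once. Clamping does not lengthen
  intervals, so one \<open>\<delta>\<close> serves for all \<open>n\<close> and hence in the
  limit.\<close>

lemma abs_continuous_on_extension:
  fixes f :: "real \<Rightarrow> real"
  assumes ab: "a < b" and ac: "abs_continuous_on {a<..<b} f"
  shows "\<exists>F. abs_continuous_on UNIV F \<and> (\<forall>x\<le>a. F x = F a) \<and> (\<forall>x\<ge>b. F x = F b)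
    \<and> (\<forall>x\<in>{a<..<b}. F x = f x)"
proof -
  \<comment> \<open>With \<open>real n + 2\<close> both points lie strictly inside the interval and
    \<open>c n \<le> d n\<close> holds already for \<open>n = 0\<close>, where they meet in the
    midpoint.\<close>
  define c where "c n = a + (b - a) / (real n + 2)" for n
  define d where "d n = b - (b - a) / (real n + 2)" for n
  define cl where "cl n x = max (c n) (min (d n) x)" for n x
  have cd: "c n \<le> d n" "a < c n" "d n < b" for n
  proof -
    have "0 < (b - a) / (real n + 2)" "2 * ((b - a) / (real n + 2)) \<le> b - a"
      using ab mult_right_mono[of 2 "real n + 2" "b - a"] by (auto simp: divide_simps mult.commute)
    then show "c n \<le> d n" "a < c n" "d n < b" by (auto simp: c_def d_def)
  qed
  have cl_arc: "cl n x \<in> {a<..<b}" for n x using cd[of n] by (auto simp: cl_def)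
  have cl_mono: "cl n x \<le> cl n y" "cl n y - cl n x \<le> y - x" if "x \<le> y" for n x y
    using that cd(1)[of n] by (auto simp: cl_def)
  have lim0: "(\<lambda>n. (b - a) / (real n + 2)) \<longlonglongrightarrow> 0"
    using LIMSEQ_ignore_initial_segment[OF lim_const_over_n[of "b - a"], of 2] by (simp add: add.commute)
  have clim: "c \<longlonglongrightarrow> a" "d \<longlonglongrightarrow> b"
    unfolding c_def d_def using tendsto_add[OF tendsto_const lim0, of a] tendsto_diff[OF tendsto_const lim0, of b] by simp_all
  have cl_lim: "(\<lambda>n. cl n x) \<longlonglongrightarrow> max a (min b x)" for x
    unfolding cl_def by (intro tendsto_max tendsto_min clim tendsto_const)
  have conv: "convergent (\<lambda>n. f (cl n x))" for x
  proof (rule Cauchy_convergent, rule CauchyI)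
    fix e :: real assume e: "0 < e"
    obtain \<delta> where \<delta>: "0 < \<delta>" "\<forall>x y. x \<le> y \<longrightarrow> {x..y} \<subseteq> {a<..<b} \<longrightarrow> y - x < \<delta> \<longrightarrow> \<bar>f y - f x\<bar> < e"
      using abs_continuous_on_increment[OF ac e] by blast
    have "Cauchy (\<lambda>n. cl n x)" using cl_lim by (rule LIMSEQ_imp_Cauchy)
    then obtain M where M: "\<forall>m\<ge>M. \<forall>n\<ge>M. norm (cl m x - cl n x) < \<delta>"
      using CauchyD \<delta>(1) by blast
    have "norm (f (cl m x) - f (cl n x)) < e" if "m \<ge> M" "n \<ge> M" for m n
    proof -
      have s: "{cl m x..cl n x} \<subseteq> {a<..<b}" "{cl n x..cl m x} \<subseteq> {a<..<b}"
        using cl_arc[of m x] cl_arc[of n x] by auto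
      have "\<bar>cl m x - cl n x\<bar> < \<delta>" using M that by simp
      then show ?thesis
        using \<delta>(2)[rule_format, of "cl m x" "cl n x"] \<delta>(2)[rule_format, of "cl n x" "cl m x"] s
        by (cases "cl m x \<le> cl n x") (auto simp: abs_minus_commute)
    qed
    then show "\<exists>M. \<forall>m\<ge>M. \<forall>n\<ge>M. norm (f (cl m x) - f (cl n x)) < e" by blast
  qed
  define F where "F x = lim (\<lambda>n. f (cl n x))" for x
  have F: "(\<lambda>n. f (cl n x)) \<longlonglongrightarrow> F x" for x
    using conv[of x] unfolding F_def convergent_LIMSEQ_iff .
  have Flow: "F x = F a" if "x \<le> a" for x
  proof -
    have "cl n x = cl n a" for n using that cd[of n] ab by (auto simp: cl_def)
    then show ?thesis by (simp add: F_def)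
  qed
  have Fhigh: "F x = F b" if "b \<le> x" for x
  proof -
    have "cl n x = cl n b" for n using that cd[of n] ab by (auto simp: cl_def)
    then show ?thesis by (simp add: F_def)
  qed
  have Feq: "F x = f x" if x: "x \<in> {a<..<b}" for x
  proof -
    have "\<forall>\<^sub>F n in sequentially. c n < x" "\<forall>\<^sub>F n in sequentially. x < d n"
      using clim x by (auto simp: order_tendsto_iff)
    then have "\<forall>\<^sub>F n in sequentially. f (cl n x) = f x"
      by eventually_elim (auto simp: cl_def)
    then have "(\<lambda>n. f (cl n x)) \<longlonglongrightarrow> f x" by (rule tendsto_eventually)
    with F show ?thesis by (rule LIMSEQ_unique)
  qed
  have "abs_continuous_on UNIV F"
    unfolding abs_continuous_on_def
  proof (intro allI impI)
    fix e :: real assume "0 < e"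
    \<comment> \<open>Half of \<open>e\<close>, because strict inequalities become weak in the
      limit.\<close>
    then have e: "0 < e/2" by simp
    obtain \<delta> where \<delta>: "\<delta> > 0" "\<forall>D. D division_of \<Union>D \<and> \<Union>D \<subseteq> {a<..<b} \<and> (\<Sum>k\<in>D. Sup k - Inf k) < \<delta>
        \<longrightarrow> (\<Sum>k\<in>D. \<bar>f (Sup k) - f (Inf k)\<bar>) < e/2"
      using ac[unfolded abs_continuous_on_def, rule_format, OF e] by blast
    have "(\<Sum>k\<in>D. \<bar>F (Sup k) - F (Inf k)\<bar>) < e"
      if D: "D division_of \<Union>D" "(\<Sum>k\<in>D. Sup k - Inf k) < \<delta>" for D
    proof -
      note k = division_member[OF D(1)]
      have "(\<Sum>k\<in>D. \<bar>f (cl n (Sup k)) - f (cl n (Inf k))\<bar>) < e/2" for n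
      proof (rule sum_abs_increments_less[where A = "{a<..<b}" and \<delta> = \<delta> and l = "\<lambda>k. cl n (Inf k)" and u = "\<lambda>k. cl n (Sup k)"])
        show "finite D" using D(1) by auto
        show "cl n (Inf i) \<le> cl n (Sup i)" if "i \<in> D" for i
          using cl_mono(1) k(2)[OF that] .
        show "{cl n (Inf i)..cl n (Sup i)} \<subseteq> {a<..<b}" if "i \<in> D" for i
          using cl_arc[of n "Inf i"] cl_arc[of n "Sup i"] by auto
        have "(\<Sum>i\<in>D. cl n (Sup i) - cl n (Inf i)) \<le> (\<Sum>k\<in>D. Sup k - Inf k)"
          by (rule sum_mono) (rule cl_mono(2), rule k(2))
        then show "(\<Sum>i\<in>D. cl n (Sup i) - cl n (Inf i)) < \<delta>" using D(2) by linarith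
        show "{cl n (Inf i)<..<cl n (Sup i)} \<inter> {cl n (Inf j)<..<cl n (Sup j)} = {}"
          if ij: "i \<in> D" "j \<in> D" "i \<noteq> j" for i j
        proof -
          have "{Inf i<..<Sup i} \<inter> {Inf j<..<Sup j} = {}"
            using division_ofD(5)[OF D(1) ij] k(3) ij by simp
          then have "Sup i \<le> Inf j \<or> Sup j \<le> Inf i \<or> Inf i = Sup i \<or> Inf j = Sup j"
            using k(2)[OF ij(1)] k(2)[OF ij(2)] by (auto simp: max_def min_def split: if_splits)
          then show ?thesis using cl_mono(1)[of "Sup i" "Inf j" n] cl_mono(1)[of "Sup j" "Inf i" n] by fastforce
        qed
      qed (use \<delta>(2) in blast)
      then have "(\<Sum>k\<in>D. \<bar>F (Sup k) - F (Inf k)\<bar>) \<le> e/2"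
        by (intro LIMSEQ_le_const2[of "\<lambda>n. \<Sum>k\<in>D. \<bar>f (cl n (Sup k)) - f (cl n (Inf k))\<bar>"]
            tendsto_sum tendsto_rabs tendsto_diff F) (auto intro: less_imp_le)
      with e show ?thesis by linarith
    qed
    with \<delta>(1) show "\<exists>\<delta>>0. \<forall>D. D division_of \<Union>D \<and> \<Union>D \<subseteq> UNIV \<and> (\<Sum>k\<in>D. Sup k - Inf k) < \<delta>
        \<longrightarrow> (\<Sum>k\<in>D. \<bar>F (Sup k) - F (Inf k)\<bar>) < e" by blast
  qed
  with Flow Fhigh Feq show ?thesis by blast
qed

text \<open>\<open>g\<close> is the density of the extension, cut off outside the open arc so that
  the densities of different arcs can simply be added. The limits \<open>L\<close> and
  \<open>R\<close> are the values of the extension at the end points.\<close>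

lemma abs_continuous_on_arc_density:
  fixes f :: "real \<Rightarrow> real"
  assumes ab: "a < b" and ac: "abs_continuous_on {a<..<b} f"
  shows "\<exists>g L R. integrable lborel g \<and> (\<forall>x. x \<notin> {a<..<b} \<longrightarrow> g x = 0) \<and>
    (\<forall>x y. a < x \<longrightarrow> x \<le> y \<longrightarrow> y < b \<longrightarrow> f y - f x = (LINT t:{x<..y}|lborel. g t)) \<and>
    (f \<longlongrightarrow> L) (at_right a) \<and> (f \<longlongrightarrow> R) (at_left b) \<and> R - L = (LINT t|lborel. g t)"
proof -
  obtain F where F: "abs_continuous_on UNIV F" "\<forall>x\<le>a. F x = F a" "\<forall>x\<ge>b. F x = F b"
    "\<forall>x\<in>{a<..<b}. F x = f x"
    using abs_continuous_on_extension[OF assms] by blast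
  obtain h where h: "integrable lborel h" "\<forall>x y. x \<le> y \<longrightarrow> F y - F x = (LINT t:{x<..y}|lborel. h t)"
    using abs_continuous_density[OF F(1-3)] by blast
  note Fcont = abs_continuous_isCont[OF F(1)]
  define g where "g = (\<lambda>x. indicator {a<..<b} x *\<^sub>R h x)"
  have gint: "integrable lborel g"
    unfolding g_def by (rule integrable_mult_indicator) (use h in auto)
  have "f y - f x = (LINT t:{x<..y}|lborel. g t)" if "a < x" "x \<le> y" "y < b" for x y
  proof -
    have "(LINT t:{x<..y}|lborel. g t) = (LINT t:{x<..y}|lborel. h t)"
      using that by (intro set_lebesgue_integral_cong) (auto simp: g_def)
    then show ?thesis using h(2)[rule_format, of x y] F(4) that by auto
  qed
  moreover have "(f \<longlongrightarrow> F a) (at_right a)"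
  proof (rule Lim_transform_eventually)
    show "(F \<longlongrightarrow> F a) (at_right a)" using Fcont[of a] by (auto simp: isCont_def intro: filterlim_at_split[THEN iffD1, THEN conjunct2])
    show "\<forall>\<^sub>F x in at_right a. F x = f x"
      using eventually_at_right_less[of a] eventually_at_right[OF ab, of "\<lambda>x. F x = f x"] F(4) ab by auto
  qed
  moreover have "(f \<longlongrightarrow> F b) (at_left b)"
  proof (rule Lim_transform_eventually)
    show "(F \<longlongrightarrow> F b) (at_left b)" using Fcont[of b] by (auto simp: isCont_def intro: filterlim_at_split[THEN iffD1, THEN conjunct1])
    show "\<forall>\<^sub>F x in at_left b. F x = f x"
      using eventually_at_left[OF ab, of "\<lambda>x. F x = f x"] F(4) ab by auto
  qed
  moreover have "F b - F a = (LINT t|lborel. g t)"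
  proof -
    have "F b - F a = (LINT t:{a<..b}|lborel. h t)" using h(2) ab by simp
    also have "\<dots> = (LINT t:{a<..<b}|lborel. h t)"
      unfolding set_lebesgue_integral_def
      by (intro integral_cong_AE) (use h AE_lborel_singleton[of b] in \<open>auto simp: indicator_def\<close>)
    finally show ?thesis by (simp add: g_def set_lebesgue_integral_def)
  qed
  moreover have "\<forall>x. x \<notin> {a<..<b} \<longrightarrow> g x = 0" by (auto simp: g_def)
  ultimately show ?thesis using gint
    by (intro exI[of _ g] exI[of _ "F a"] exI[of _ "F b"]) auto
qed

section \<open>Convergents\<close>

text \<open>These are the numerators of the convergents for \<alpha> in \<open>[0,1)\<close>: the
  start values 0 and 1 encode that the integer part of \<alpha> vanishes.\<close>

fun conv_numer :: "real \<Rightarrow> nat \<Rightarrow> int" where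
  "conv_numer x 0 = 0"
| "conv_numer x (Suc 0) = 1"
| "conv_numer x (Suc (Suc n)) =
     cf_nth x (Suc (Suc n)) * conv_numer x (Suc n) + conv_numer x n"

context
  fixes \<alpha> :: real
  assumes irr: "\<alpha> \<notin> \<rat>" and range: "\<alpha> \<in> {0..<1}"
begin

lemma cf_rem_irrational: "cf_rem \<alpha> n \<notin> \<rat>"
proof (induction n)
  case (Suc n)
  have "frac (cf_rem \<alpha> n) \<notin> \<rat>"
  proof
    assume "frac (cf_rem \<alpha> n) \<in> \<rat>"
    then have "frac (cf_rem \<alpha> n) + of_int \<lfloor>cf_rem \<alpha> n\<rfloor> \<in> \<rat>" by (intro Rats_add) auto
    then show False using Suc by (simp add: frac_def)
  qed
  then have "inverse (frac (cf_rem \<alpha> n)) \<notin> \<rat>"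
    by (metis Rats_inverse inverse_inverse_eq)
  then show ?case by (simp add: inverse_eq_divide)
qed (use irr in simp)

lemma frac_cf_rem: "0 < frac (cf_rem \<alpha> n)" "frac (cf_rem \<alpha> n) < 1"
proof -
  have "cf_rem \<alpha> n \<notin> \<int>" using cf_rem_irrational Ints_subset_Rats by blast
  then show "0 < frac (cf_rem \<alpha> n)" by (simp add: frac_gt_0_iff)
qed (rule frac_lt_1)

lemma cf_rem_Suc_gt_1: "1 < cf_rem \<alpha> (Suc n)"
  using frac_cf_rem[of n] by simp

lemma cf_rem_eq: "cf_rem \<alpha> n = cf_nth \<alpha> n + 1 / cf_rem \<alpha> (Suc n)"
  by (simp add: cf_nth_def frac_def)

lemma cf_nth_pos: "1 \<le> cf_nth \<alpha> (Suc n)"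
  using cf_rem_Suc_gt_1[of n] by (simp add: cf_nth_def le_floor_iff)

lemma conv_denom_bounds: "1 \<le> conv_denom \<alpha> n \<and> 1 \<le> conv_denom \<alpha> (Suc n) \<and> int n \<le> conv_denom \<alpha> (Suc n)"
proof (induction n)
  case 0
  show ?case using cf_nth_pos[of 0] by simp
next
  case (Suc n)
  have "1 * conv_denom \<alpha> (Suc n) \<le> cf_nth \<alpha> (Suc (Suc n)) * conv_denom \<alpha> (Suc n)"
    using cf_nth_pos[of "Suc n"] Suc by (intro mult_right_mono) auto
  with Suc show ?case unfolding conv_denom.simps(3) of_nat_Suc by linarith
qed

text \<open>This is \<alpha> = (p r + p') / (q r + q') for the complete quotient r, multiplied out.
  The induction step expands r by \<open>cf_rem_eq\<close> and clears the new denominator.\<close>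

lemma convergents_eq:
  "\<alpha> * (conv_denom \<alpha> (Suc n) * cf_rem \<alpha> (Suc (Suc n)) + conv_denom \<alpha> n)
    = conv_numer \<alpha> (Suc n) * cf_rem \<alpha> (Suc (Suc n)) + conv_numer \<alpha> n"
proof (induction n)
  case 0
  have "frac \<alpha> = \<alpha>" using range by (simp add: frac_eq)
  then have 1: "cf_rem \<alpha> (Suc 0) = 1 / \<alpha>" "\<alpha> \<noteq> 0" using frac_cf_rem[of 0] by auto
  have "cf_nth \<alpha> (Suc 0) + 1 / cf_rem \<alpha> (Suc (Suc 0)) = 1 / \<alpha>"
    using cf_rem_eq[of "Suc 0"] 1 by simp
  moreover have "cf_rem \<alpha> (Suc (Suc 0)) \<noteq> 0" using cf_rem_Suc_gt_1[of "Suc 0"] by linarith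
  ultimately show ?case using 1(2) by (simp add: divide_simps del: cf_rem.simps) (simp add: algebra_simps del: cf_rem.simps)
next
  case (Suc n)
  let ?r = "cf_rem \<alpha> (Suc (Suc (Suc n)))"
  let ?a = "cf_nth \<alpha> (Suc (Suc n))"
  have r: "?r \<noteq> 0" using cf_rem_Suc_gt_1[of "Suc (Suc n)"] by linarith
  have eq: "cf_rem \<alpha> (Suc (Suc n)) = ?a + 1 / ?r" by (rule cf_rem_eq)
  have rr: "cf_rem \<alpha> (Suc (Suc n)) * ?r = ?a * ?r + 1"
    unfolding eq using r by (simp add: field_simps del: cf_rem.simps)
  have "\<alpha> * (conv_denom \<alpha> (Suc n) * (cf_rem \<alpha> (Suc (Suc n)) * ?r) + conv_denom \<alpha> n * ?r)
      = conv_numer \<alpha> (Suc n) * (cf_rem \<alpha> (Suc (Suc n)) * ?r) + conv_numer \<alpha> n * ?r"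
    using arg_cong[OF Suc, of "\<lambda>z. z * ?r"] by (simp add: algebra_simps del: cf_rem.simps)
  then show ?case unfolding rr by (simp add: algebra_simps del: cf_rem.simps)
qed

lemma convergents_det:
  "conv_numer \<alpha> (Suc n) * conv_denom \<alpha> n - conv_numer \<alpha> n * conv_denom \<alpha> (Suc n) = (-1) ^ n"
  by (induction n) (simp_all add: algebra_simps)

lemma convergents_coprime: "coprime (conv_numer \<alpha> (Suc n)) (conv_denom \<alpha> (Suc n))"
proof (rule coprimeI)
  fix c assume "c dvd conv_numer \<alpha> (Suc n)" "c dvd conv_denom \<alpha> (Suc n)"
  then have "c dvd conv_numer \<alpha> (Suc n) * conv_denom \<alpha> n - conv_numer \<alpha> n * conv_denom \<alpha> (Suc n)"
    by (intro dvd_diff dvd_mult2 dvd_mult) auto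
  then have "c dvd (-1) ^ n" by (simp only: convergents_det)
  then have "c dvd (-1) ^ n * (-1) ^ n" by (rule dvd_mult2)
  then show "is_unit c" by (simp flip: power_mult_distrib)
qed

text \<open>By \<open>convergents_eq\<close> and the determinant, the error times q r + q' has
  absolute value 1, where r > 1 and q' \<ge> 1. The summand 1 beside the denominator forces the
  error below 1/2 even for denominator 1, so that rounding yields the numerator in
  \<open>int_dist_convergents\<close>.\<close>

lemma convergents_approx:
  "\<bar>conv_denom \<alpha> (Suc n) * \<alpha> - conv_numer \<alpha> (Suc n)\<bar> * (real_of_int (conv_denom \<alpha> (Suc n)) + 1) < 1"
proof -
  let ?q = "real_of_int (conv_denom \<alpha> (Suc n))" let ?p = "real_of_int (conv_numer \<alpha> (Suc n))"
  let ?qq = "real_of_int (conv_denom \<alpha> n)" let ?pp = "real_of_int (conv_numer \<alpha> n)"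
  let ?d = "?q * cf_rem \<alpha> (Suc (Suc n)) + ?qq"
  have q: "1 \<le> ?q" "1 \<le> ?qq" using conv_denom_bounds[of n] by linarith+
  have r: "1 < cf_rem \<alpha> (Suc (Suc n))" by (rule cf_rem_Suc_gt_1)
  have d: "?q + 1 < ?d" using mult_strict_left_mono[OF r, of ?q] q by linarith
  have det: "?p * ?qq - ?pp * ?q = (-1) ^ n"
    using arg_cong[OF convergents_det[of n], of real_of_int]
    by (simp only: of_int_diff of_int_mult of_int_power of_int_minus of_int_1)
  have "(?q * \<alpha> - ?p) * ?d = ?q * (\<alpha> * ?d) - ?p * ?d" by (simp only: algebra_simps)
  also have "\<dots> = - ((-1) ^ n)"
    unfolding convergents_eq det[symmetric] by (simp add: algebra_simps del: cf_rem.simps)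
  finally have "\<bar>(?q * \<alpha> - ?p) * ?d\<bar> = 1" by (simp only: abs_minus_cancel power_abs abs_1 power_one abs_neg_one)
  moreover have "0 < ?d" using d q by linarith
  ultimately have "\<bar>?q * \<alpha> - ?p\<bar> * ?d = 1" by (simp only: abs_mult abs_of_pos)
  moreover have "\<bar>?q * \<alpha> - ?p\<bar> * (?q + 1) < \<bar>?q * \<alpha> - ?p\<bar> * ?d"
  proof (rule mult_strict_left_mono[OF d])
    show "0 < \<bar>?q * \<alpha> - ?p\<bar>" using calculation by (cases "?q * \<alpha> - ?p = 0") auto
  qed
  ultimately show ?thesis by simp
qed

lemma int_dist_convergents:
  "int_dist (conv_denom \<alpha> (Suc n) * \<alpha>) = \<bar>conv_denom \<alpha> (Suc n) * \<alpha> - conv_numer \<alpha> (Suc n)\<bar>"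
proof -
  let ?e = "\<bar>conv_denom \<alpha> (Suc n) * \<alpha> - conv_numer \<alpha> (Suc n)\<bar>"
  have "?e * 2 \<le> ?e * (real_of_int (conv_denom \<alpha> (Suc n)) + 1)"
    using conv_denom_bounds[of n] by (intro mult_left_mono) auto
  also have "\<dots> < 1" by (rule convergents_approx)
  finally have "?e < 1/2" by simp
  then have "round (conv_denom \<alpha> (Suc n) * \<alpha>) = conv_numer \<alpha> (Suc n)"
    by (intro round_unique') auto
  then show ?thesis by (simp add: int_dist_def)
qed

end

text \<open>This is all that the Denjoy--Koksma argument needs to know about a convergent p /
  q.\<close>

definition rational_approx :: "real \<Rightarrow> nat \<Rightarrow> int \<Rightarrow> bool" where
  "rational_approx \<alpha> q p \<longleftrightarrow> 0 < q \<and> coprime p (int q) \<and> \<bar>real q * \<alpha> - real_of_int p\<bar> < 1 / real q"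

lemma Lambda_set_approx:
  assumes "\<alpha> \<in> Lambda_set" "0 < \<epsilon>"
  shows "\<exists>\<delta> q p. 0 < \<delta> \<and> \<delta> < \<epsilon> \<and> (\<forall>k. rational_approx \<alpha> (q k) (p k)) \<and> filterlim q at_top sequentially \<and>
    (\<lambda>k. real (q k) * \<bar>real (q k) * \<alpha> - p k\<bar>) \<longlonglongrightarrow> \<delta>"
proof -
  have \<alpha>: "\<alpha> \<notin> \<rat>" "\<alpha> \<in> {0..<1}" using assms(1) by (auto simp: Lambda_set_def)
  note bounds = conv_denom_bounds[OF \<alpha>] and approx = convergents_approx[OF \<alpha>]
  obtain \<delta> n where \<delta>: "0 < \<delta>" "\<delta> < \<epsilon>" and n: "strict_mono (n :: nat \<Rightarrow> nat)"
    and lim: "(\<lambda>k. of_int (conv_denom \<alpha> (n k)) * int_dist (of_int (conv_denom \<alpha> (n k)) * \<alpha>)) \<longlonglongrightarrow> \<delta>"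
    using assms unfolding Lambda_set_def by blast
  \<comment> \<open>The first term of the subsequence is dropped, so that all its indices are
    successors, as in the estimates on convergents.\<close>
  define m where "m k = n (Suc k) - 1" for k
  have m: "n (Suc k) = Suc (m k)" "k \<le> m k" for k
    using strict_mono_imp_increasing[OF n, of "Suc k"] by (auto simp: m_def)
  define q where "q k = nat (conv_denom \<alpha> (Suc (m k)))" for k
  define p where "p k = conv_numer \<alpha> (Suc (m k))" for k
  have q: "int (q k) = conv_denom \<alpha> (Suc (m k))" "real (q k) = real_of_int (conv_denom \<alpha> (Suc (m k)))"
     "0 < q k" "k \<le> q k" for k
    using bounds[of "m k"] m(2)[of k] by (auto simp: q_def)
  have "rational_approx \<alpha> (q k) (p k)" for k
  proof -
    have "\<bar>real (q k) * \<alpha> - p k\<bar> * real (q k) \<le> \<bar>real (q k) * \<alpha> - p k\<bar> * (real (q k) + 1)"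
      by (intro mult_left_mono) auto
    also have "\<dots> < 1" using approx[of "m k"] by (simp add: q p_def)
    finally show ?thesis using q(3)[of k] convergents_coprime[OF \<alpha>, of "m k"]
      by (auto simp: rational_approx_def field_simps p_def q(1))
  qed
  moreover have "filterlim q at_top sequentially"
    using q(4) by (intro filterlim_at_top_mono[OF filterlim_ident]) auto
  moreover have "(\<lambda>k. real (q k) * \<bar>real (q k) * \<alpha> - p k\<bar>) \<longlonglongrightarrow> \<delta>"
    using LIMSEQ_ignore_initial_segment[OF lim, of 1]
    by (simp add: m int_dist_convergents[OF \<alpha>] q(2) p_def)
  ultimately show ?thesis using \<delta> by blast
qed

section \<open>Birkhoff sums and the Denjoy--Koksma inequality\<close>

definition periodic :: "(real \<Rightarrow> real) \<Rightarrow> bool" where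
  "periodic u \<longleftrightarrow> (\<forall>x. u (x + 1) = u x)"

text \<open>Intervals are open on the left and closed on the right, so that adjacent integrals add
  up with no null set to be discussed.\<close>

definition locally_integrable :: "(real \<Rightarrow> real) \<Rightarrow> bool" where
  "locally_integrable u \<longleftrightarrow> (\<forall>a b. set_integrable lborel {a<..b} u)"

abbreviation ivl_integral :: "(real \<Rightarrow> real) \<Rightarrow> real \<Rightarrow> real \<Rightarrow> real" where
  "ivl_integral u a b \<equiv> (LINT t:{a<..b}|lborel. u t)"

lemma periodic_add_int:
  assumes "periodic u"
  shows "u (x + of_int m) = u x"
proof -
  have nat: "u (x + real n) = u x" for n x
    by (induction n) (use assms in \<open>auto simp: periodic_def algebra_simps, metis add.assoc add.commute\<close>)
  show ?thesis
    using nat[of x "nat m"] nat[of "x + of_int m" "nat (-m)"] by (cases "0 \<le> m") auto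
qed

lemma periodic_diff_int: "periodic u \<Longrightarrow> u (x - of_int m) = u x"
  using periodic_add_int[of u x "-m"] by simp

lemma periodic_frac: "periodic u \<Longrightarrow> u (frac x) = u x"
  unfolding frac_def by (rule periodic_diff_int)

lemma periodic_comp_frac [simp]: "periodic (\<lambda>x. g (frac x))"
  by (simp add: periodic_def frac_1_eq)

lemma locally_integrableD: "locally_integrable u \<Longrightarrow> set_integrable lborel {a<..b} u"
  by (simp add: locally_integrable_def)

lemma locally_integrable_diff:
  "locally_integrable u \<Longrightarrow> locally_integrable v \<Longrightarrow> locally_integrable (\<lambda>x. u x - v x)"
  by (auto simp: locally_integrable_def)

lemma locally_integrable_add:
  "locally_integrable u \<Longrightarrow> locally_integrable v \<Longrightarrow> locally_integrable (\<lambda>x. u x + v x)"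
  by (auto simp: locally_integrable_def)

lemma locally_integrable_abs: "locally_integrable u \<Longrightarrow> locally_integrable (\<lambda>x. \<bar>u x\<bar>)"
  by (auto simp: locally_integrable_def set_integrable_abs)

lemma locally_integrable_cmult: "locally_integrable u \<Longrightarrow> locally_integrable (\<lambda>x. c * u x)"
  by (auto simp: locally_integrable_def)

lemma locally_integrable_sum:
  "(\<And>i. i \<in> I \<Longrightarrow> locally_integrable (u i)) \<Longrightarrow> locally_integrable (\<lambda>x. \<Sum>i\<in>I. u i x)"
  unfolding locally_integrable_def set_integrable_def scaleR_sum_right
  by (intro allI Bochner_Integration.integrable_sum) auto

lemma locally_integrable_bounded:
  assumes "u \<in> borel_measurable borel" "\<And>x. \<bar>u x\<bar> \<le> B"
  shows "locally_integrable u"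
  unfolding locally_integrable_def
proof (intro allI)
  fix a b :: real
  have B: "0 \<le> B" using assms(2)[of 0] by linarith
  have "set_integrable lborel {a<..b} (\<lambda>_. B)"
    unfolding set_integrable_def by (rule integrable_scaleR_left, cases "a \<le> b") (simp_all add: integrable_indicator_iff)
  then show "set_integrable lborel {a<..b} u"
    by (rule set_integrable_bound) (use assms B in \<open>auto simp: set_borel_measurable_def\<close>)
qed

lemma locally_integrable_const: "locally_integrable (\<lambda>_. c)"
  by (rule locally_integrable_bounded[of _ "\<bar>c\<bar>"]) auto

lemma integrable_imp_locally_integrable: "integrable lborel g \<Longrightarrow> locally_integrable g"
  unfolding locally_integrable_def set_integrable_def by (intro allI integrable_mult_indicator) auto

lemma locally_integrable_shift:
  assumes "locally_integrable u"
  shows "locally_integrable (\<lambda>x. u (x + s))"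
  unfolding locally_integrable_def set_integrable_def
proof (intro allI)
  fix a b :: real
  have "integrable lborel (\<lambda>x. indicator {a + s<..b + s} x *\<^sub>R u x)"
    using assms by (simp add: locally_integrable_def set_integrable_def)
  then have "integrable lborel (\<lambda>x. indicator {a + s<..b + s} (s + 1 * x) *\<^sub>R u (s + 1 * x))"
    by (subst lborel_integrable_real_affine_iff) auto
  also have "(\<lambda>x. indicator {a + s<..b + s} (s + 1 * x) *\<^sub>R u (s + 1 * x)) =
      (\<lambda>x. indicator {a<..b} x *\<^sub>R u (x + s))"
    by (auto simp: fun_eq_iff indicator_def add.commute)
  finally show "integrable lborel (\<lambda>x. indicator {a<..b} x *\<^sub>R u (x + s))" .
qed

lemma ivl_integral_shift: "ivl_integral (\<lambda>x. u (x + s)) a b = ivl_integral u (a + s) (b + s)"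
proof -
  have "ivl_integral u (a + s) (b + s) =
      (LINT x|lborel. indicator {a + s<..b + s} (s + 1 * x) *\<^sub>R u (s + 1 * x))"
    unfolding set_lebesgue_integral_def by (subst lborel_integral_real_affine[of 1 _ s]) auto
  also have "(\<lambda>x. indicator {a + s<..b + s} (s + 1 * x) *\<^sub>R u (s + 1 * x)) =
      (\<lambda>x. indicator {a<..b} x *\<^sub>R u (x + s))"
    by (auto simp: fun_eq_iff indicator_def add.commute)
  finally show ?thesis by (simp add: set_lebesgue_integral_def)
qed

lemma ivl_integral_combine:
  assumes "locally_integrable u" "a \<le> b" "b \<le> c"
  shows "ivl_integral u a b + ivl_integral u b c = ivl_integral u a c"
proof -
  have "{a<..c} = {a<..b} \<union> {b<..c}" using assms by auto
  then show ?thesis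
    using assms(1) by (subst set_integral_Un[symmetric]) (auto simp: locally_integrable_def)
qed

lemma ivl_integral_nonneg: "(\<And>x. 0 \<le> u x) \<Longrightarrow> 0 \<le> ivl_integral u a b"
  unfolding set_lebesgue_integral_def by (intro integral_nonneg_AE) auto

lemma ivl_integral_mono:
  assumes "locally_integrable u" "locally_integrable v" "\<And>x. a < x \<Longrightarrow> x \<le> b \<Longrightarrow> u x \<le> v x"
  shows "ivl_integral u a b \<le> ivl_integral v a b"
  using assms by (intro set_integral_mono) (auto simp: locally_integrable_def)

lemma ivl_integral_abs:
  assumes "locally_integrable u"
  shows "\<bar>ivl_integral u a b\<bar> \<le> ivl_integral (\<lambda>x. \<bar>u x\<bar>) a b"
  using set_integral_norm_bound[OF locally_integrableD[OF assms]] by simp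

lemma ivl_integral_const: "a \<le> b \<Longrightarrow> ivl_integral (\<lambda>_. c) a b = (b - a) * c"
  by (simp add: set_lebesgue_integral_def)

text \<open>The part of the interval beyond \<open>of_int m + 1\<close> is moved back by one period,
  which completes the interval between two consecutive integers.\<close>

lemma ivl_integral_period:
  assumes "periodic u" "locally_integrable u"
  shows "ivl_integral u x (x + 1) = ivl_integral u 0 1"
proof -
  define m where "m = \<lfloor>x\<rfloor>"
  have m: "of_int m \<le> x" "x \<le> of_int m + 1" unfolding m_def by linarith+
  have sh: "ivl_integral u (a + of_int k) (b + of_int k) = ivl_integral u a b" for a b k
    by (subst ivl_integral_shift[symmetric]) (simp add: periodic_add_int[OF assms(1)])
  have "ivl_integral u x (x + 1) = ivl_integral u x (of_int m + 1) + ivl_integral u (of_int m + 1) (x + 1)"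
    using m by (intro ivl_integral_combine[symmetric] assms) auto
  also have "ivl_integral u (of_int m + 1) (x + 1) = ivl_integral u (of_int m) x"
    using sh[of "of_int m" 1 x] by simp
  also have "ivl_integral u x (of_int m + 1) + ivl_integral u (of_int m) x = ivl_integral u (of_int m) (of_int m + 1)"
    using ivl_integral_combine[OF assms(2), of "of_int m" x "of_int m + 1"] m by simp
  also have "\<dots> = ivl_integral u 0 1" using sh[of 0 m 1] by (simp add: add.commute)
  finally show ?thesis .
qed

lemma ivl_integral_sum_steps:
  assumes "locally_integrable u" "0 \<le> h"
  shows "(\<Sum>j<n. ivl_integral u (x + real j * h) (x + real (Suc j) * h)) = ivl_integral u x (x + real n * h)"
proof (induction n)
  case (Suc n)
  have "ivl_integral u x (x + real n * h) + ivl_integral u (x + real n * h) (x + real (Suc n) * h)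
      = ivl_integral u x (x + real (Suc n) * h)"
    using assms by (intro ivl_integral_combine) (auto simp: algebra_simps)
  with Suc show ?case by simp
qed (simp add: set_lebesgue_integral_def)

definition birkhoff_sum :: "real \<Rightarrow> (real \<Rightarrow> real) \<Rightarrow> nat \<Rightarrow> real \<Rightarrow> real" where
  "birkhoff_sum \<alpha> u n x = (\<Sum>i<n. u (x + real i * \<alpha>))"

lemma birkhoff_sum_periodic: "periodic u \<Longrightarrow> periodic (birkhoff_sum \<alpha> u n)"
  unfolding periodic_def birkhoff_sum_def
  by (auto intro!: sum.cong simp: add.assoc add.left_commute) (metis add.assoc add.commute)

text \<open>One has i \<alpha> = i p / q + i (q \<alpha> - p) / q. The first terms run through all
  multiples of 1 / q modulo 1, as \<open>p\<close> is prime to \<open>q\<close>. The second terms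
  are smaller than 1 / q and never differ in sign, so every point lands in the arc adjacent to its
  multiple, always on the same side.\<close>

lemma rational_approx_orbit:
  assumes "rational_approx \<alpha> q p"
  obtains j where "bij_betw j {..<q} {..<q}"
    "\<And>i. i < q \<Longrightarrow> \<exists>m::int. real i * \<alpha> - of_int m \<in> {real (j i) / real q .. (real (j i) + 1) / real q}"
proof -
  have q: "0 < q" and cop: "coprime p (int q)" and ap: "\<bar>real q * \<alpha> - p\<bar> < 1 / real q"
    using assms by (auto simp: rational_approx_def)
  \<comment> \<open>\<open>e\<close> is 1 if the points are displaced to the left. The arcs have to
    be closed: for \<open>i = 0\<close> and \<open>e = 1\<close> the orbit point is the right end
    point of its arc.\<close>
  define e where "e = (if real q * \<alpha> < p then 1 else 0 :: int)"
  define j where "j i = nat ((int i * p - e) mod int q)" for i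
  have jq: "int (j i) = (int i * p - e) mod int q" "j i < q" for i
    using q by (auto simp: j_def nat_less_iff)
  have inj: "inj_on j {..<q}"
  proof (rule inj_onI)
    fix a b assume ab: "a \<in> {..<q}" "b \<in> {..<q}" "j a = j b"
    then have "(int a * p - e) mod int q = (int b * p - e) mod int q" using jq(1) by metis
    then have "int q dvd (int a * p - e) - (int b * p - e)" by (simp add: mod_eq_dvd_iff)
    then have "int q dvd (int a - int b) * p" by (simp add: algebra_simps)
    then have "int q dvd int a - int b" using cop by (simp add: coprime_dvd_mult_left_iff coprime_commute)
    moreover have "\<bar>int a - int b\<bar> < int q" using ab by auto
    ultimately show "a = b" using zdvd_not_zless[of "\<bar>int a - int b\<bar>" "int q"] by (cases "a = b") auto
  qed
  have "j ` {..<q} = {..<q}"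
    using jq(2) inj by (intro endo_inj_surj) auto
  with inj have "bij_betw j {..<q} {..<q}" by (simp add: bij_betw_def)
  moreover have "\<exists>m::int. real i * \<alpha> - of_int m \<in> {real (j i) / real q .. (real (j i) + 1) / real q}"
    if i: "i < q" for i
  proof
    let ?m = "(int i * p - e) div int q"
    have "int i * p - e = int q * ?m + int (j i)" unfolding jq(1) by simp
    then have "real i * p - e = real q * ?m + real (j i)"
      by (metis of_int_add of_int_diff of_int_mult of_int_of_nat_eq)
    moreover have "\<bar>real i * (real q * \<alpha> - p)\<bar> < 1"
    proof -
      have "\<bar>real i * (real q * \<alpha> - p)\<bar> \<le> real q * \<bar>real q * \<alpha> - p\<bar>"
        unfolding abs_mult using i by (intro mult_right_mono) auto
      also have "\<dots> < 1" using ap q by (simp add: field_simps)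
      finally show ?thesis .
    qed
    moreover have "0 \<le> real i * (real q * \<alpha> - p) \<longleftrightarrow> e = 0 \<or> i = 0"
      by (auto simp: e_def zero_le_mult_iff)
    ultimately have "real (j i) \<le> real q * (real i * \<alpha> - ?m)" "real q * (real i * \<alpha> - ?m) \<le> real (j i) + 1"
      by (auto simp: e_def algebra_simps split: if_splits)
    then show "real i * \<alpha> - of_int ?m \<in> {real (j i) / real q .. (real (j i) + 1) / real q}"
      using q by (simp add: field_simps)
  qed
  ultimately show ?thesis using that by blast
qed

text \<open>Two and not one, since the arcs are closed and a translate of \<open>z\<close> may be a
  common end point. The candidates are \<open>\<lfloor>t\<rfloor>\<close> and its predecessor modulo
  \<open>q\<close>.\<close>

lemma card_arcs_meeting:
  fixes x z :: real
  assumes "0 < q"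
  shows "card {j\<in>{..<q}. \<exists>m::int. z + of_int m \<in> {x + real j / real q..x + (real j + 1) / real q}} \<le> 2"
proof -
  define t where "t = real q * (z - x)"
  let ?A = "{nat (\<lfloor>t\<rfloor> mod int q), nat ((\<lfloor>t\<rfloor> - 1) mod int q)}"
  have "{j\<in>{..<q}. \<exists>m::int. z + of_int m \<in> {x + real j / real q..x + (real j + 1) / real q}} \<subseteq> ?A"
  proof
    fix j assume "j \<in> {j\<in>{..<q}. \<exists>m::int. z + of_int m \<in> {x + real j / real q..x + (real j + 1) / real q}}"
    then obtain m :: int where j: "j < q" and m: "x + real j / real q \<le> z + m" "z + m \<le> x + (real j + 1) / real q"
      by auto
    have "real j \<le> t + real q * m" "t + real q * m \<le> real j + 1"
      using m assms by (auto simp: t_def field_simps)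
    then have "\<lfloor>t + of_int (int q * m)\<rfloor> = int j \<or> \<lfloor>t + of_int (int q * m)\<rfloor> = int j + 1"
      unfolding floor_eq_iff by auto
    then have "\<lfloor>t\<rfloor> + int q * m = int j \<or> \<lfloor>t\<rfloor> + int q * m = int j + 1"
      by (simp only: floor_add_int[symmetric])
    then have "\<lfloor>t\<rfloor> = int j + int q * (-m) \<or> \<lfloor>t\<rfloor> - 1 = int j + int q * (-m)" by auto
    then have "\<lfloor>t\<rfloor> mod int q = int j \<or> (\<lfloor>t\<rfloor> - 1) mod int q = int j"
      using j by (metis mod_mult_self2 mod_pos_pos_trivial of_nat_0_le_iff of_nat_less_iff)
    then show "j \<in> ?A" by (metis insertCI nat_int)
  qed
  then have "card {j\<in>{..<q}. \<exists>m::int. z + of_int m \<in> {x + real j / real q..x + (real j + 1) / real q}} \<le> card ?A"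
    by (intro card_mono) auto
  also have "\<dots> \<le> 2" by (simp add: card_insert_if)
  finally show ?thesis .
qed

text \<open>Each of \<open>q\<close> arcs of length 1 / q receives one orbit point, and
  \<open>q\<close> times the integral over an arc is the mean of \<open>u\<close> there. Value and
  mean differ by at most the oscillation on the arc: the integral of \<open>\<omega>\<close> if the
  arc avoids \<open>Z\<close>, and \<open>2 * M\<close> otherwise. A point of \<open>Z\<close> meets
  at most two arcs, whence \<open>4 * M\<close>.\<close>

lemma denjoy_koksma:
  assumes ra: "rational_approx \<alpha> q p"
    and per: "periodic u" and meas: "u \<in> borel_measurable borel" and bd: "\<And>x. \<bar>u x\<bar> \<le> M"
    and \<omega>: "periodic \<omega>" "locally_integrable \<omega>" "\<And>x. 0 \<le> \<omega> x"
    and Z: "finite Z"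
    and osc: "\<And>a b. a \<le> b \<Longrightarrow> (\<forall>z\<in>Z. \<forall>m::int. z + of_int m \<notin> {a..b}) \<Longrightarrow> \<bar>u b - u a\<bar> \<le> ivl_integral \<omega> a b"
  shows "\<bar>birkhoff_sum \<alpha> u q x - real q * ivl_integral u 0 1\<bar> \<le> ivl_integral \<omega> 0 1 + 4 * M * card Z"
proof -
  have q: "0 < q" using ra by (simp add: rational_approx_def)
  have M: "0 \<le> M" using bd[of 0] by linarith
  have uli: "locally_integrable u" by (rule locally_integrable_bounded[OF meas bd])
  obtain j where j: "bij_betw j {..<q} {..<q}"
    and ji: "\<And>i. i < q \<Longrightarrow> \<exists>m::int. real i * \<alpha> - of_int m \<in> {real (j i) / real q .. (real (j i) + 1) / real q}"
    using rational_approx_orbit[OF ra] by blast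
  define A where "A k = x + real k * (1 / real q)" for k
  have A: "A k \<le> A (Suc k)" "A (Suc k) - A k = 1 / real q" for k
    using q by (auto simp: A_def field_simps)
  define hit where "hit z k \<longleftrightarrow> (\<exists>m::int. z + of_int m \<in> {A k..A (Suc k)})" for z k
  define W where "W k = ivl_integral \<omega> (A k) (A (Suc k)) + (\<Sum>z\<in>Z. if hit z k then 2 * M else 0)" for k
  have W0: "0 \<le> ivl_integral \<omega> (A k) (A (Suc k))" for k by (rule ivl_integral_nonneg) (rule \<omega>(3))
  have arc: "\<bar>u y - u t\<bar> \<le> W k" if yt: "y \<in> {A k..A (Suc k)}" "t \<in> {A k..A (Suc k)}" for y t k
  proof (cases "\<exists>z\<in>Z. hit z k")
    case True
    then obtain z where "z \<in> Z" "hit z k" by blast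
    then have "2 * M \<le> (\<Sum>z\<in>Z. if hit z k then 2 * M else 0)"
      using M sum_nonneg[of "Z - {z}" "\<lambda>z. if hit z k then 2 * M else 0"]
      by (subst sum.remove[OF Z]) auto
    moreover have "\<bar>u y - u t\<bar> \<le> 2 * M" using bd[of y] bd[of t] by linarith
    ultimately show ?thesis using W0[of k] by (simp add: W_def)
  next
    case False
    have "\<bar>u t' - u s\<bar> \<le> W k" if "s \<le> t'" "A k \<le> s" "t' \<le> A (Suc k)" for s t'
    proof -
      have "\<forall>z\<in>Z. \<forall>m::int. z + of_int m \<notin> {s..t'}"
      proof (intro ballI allI notI)
        fix z m assume "z \<in> Z" "z + real_of_int m \<in> {s..t'}"
        with that have "hit z k" unfolding hit_def by (intro exI[of _ m]) auto
        with False \<open>z \<in> Z\<close> show False by blast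
      qed
      then have "\<bar>u t' - u s\<bar> \<le> ivl_integral \<omega> s t'" by (rule osc[OF that(1)])
      also have "\<dots> \<le> ivl_integral \<omega> (A k) (A (Suc k))"
        using ivl_integral_combine[OF \<omega>(2), of "A k" s t'] ivl_integral_combine[OF \<omega>(2), of "A k" t' "A (Suc k)"]
          ivl_integral_nonneg[of \<omega> "A k" s, OF \<omega>(3)] ivl_integral_nonneg[of \<omega> t' "A (Suc k)", OF \<omega>(3)]
          that order.trans[OF that(2,1)] by linarith
      also have "\<dots> \<le> W k" using M by (auto simp: W_def intro!: sum_nonneg)
      finally show ?thesis .
    qed
    from this[of y t] this[of t y] show ?thesis using yt
      by (cases "y \<le> t") (auto simp: abs_minus_commute)
  qed
  have mean: "\<bar>u y - real q * ivl_integral u (A k) (A (Suc k))\<bar> \<le> W k" if y: "y \<in> {A k..A (Suc k)}" for y k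
  proof -
    have "ivl_integral (\<lambda>t. u t - u y) (A k) (A (Suc k)) = ivl_integral u (A k) (A (Suc k)) - (1 / real q) * u y"
      using A ivl_integral_const[OF A(1)]
      by (subst set_integral_diff) (auto intro: locally_integrableD uli locally_integrable_const)
    moreover have "\<bar>ivl_integral (\<lambda>t. u t - u y) (A k) (A (Suc k))\<bar> \<le> ivl_integral (\<lambda>_. W k) (A k) (A (Suc k))"
      using arc[OF y] by (intro order.trans[OF ivl_integral_abs] ivl_integral_mono locally_integrable_abs
          locally_integrable_diff uli locally_integrable_const) (auto simp: abs_minus_commute)
    ultimately have "\<bar>ivl_integral u (A k) (A (Suc k)) - (1 / real q) * u y\<bar> \<le> (1 / real q) * W k"
      using ivl_integral_const[OF A(1)] A(2) by simp
    then have "real q * \<bar>ivl_integral u (A k) (A (Suc k)) - (1 / real q) * u y\<bar> \<le> W k"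
      using q by (simp add: field_simps)
    also have "real q * \<bar>ivl_integral u (A k) (A (Suc k)) - (1 / real q) * u y\<bar>
        = \<bar>real q * (ivl_integral u (A k) (A (Suc k)) - (1 / real q) * u y)\<bar>" by (simp add: abs_mult)
    also have "\<dots> = \<bar>u y - real q * ivl_integral u (A k) (A (Suc k))\<bar>"
      using q by (simp add: right_diff_distrib abs_minus_commute)
    finally show ?thesis .
  qed
  have near: "\<bar>u (x + real i * \<alpha>) - real q * ivl_integral u (A (j i)) (A (Suc (j i)))\<bar> \<le> W (j i)" if i: "i < q" for i
  proof -
    obtain m :: int where "real i * \<alpha> - of_int m \<in> {real (j i) / real q .. (real (j i) + 1) / real q}"
      using ji[OF i] by blast
    then have "x + real i * \<alpha> - of_int m \<in> {A (j i)..A (Suc (j i))}"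
      by (auto simp: A_def add.commute)
    from mean[OF this] show ?thesis by (simp only: periodic_diff_int[OF per])
  qed
  \<comment> \<open>The arcs start at \<open>x\<close> and not at 0; periodicity moves their union
    back to the unit interval.\<close>
  have tot: "(\<Sum>k<q. ivl_integral v (A k) (A (Suc k))) = ivl_integral v 0 1" if "periodic v" "locally_integrable v" for v
    using ivl_integral_sum_steps[OF that(2), of "1 / real q" x q] ivl_integral_period[OF that, of x] q
    by (simp add: A_def)
  have "\<bar>birkhoff_sum \<alpha> u q x - real q * ivl_integral u 0 1\<bar> =
      \<bar>\<Sum>i<q. u (x + real i * \<alpha>) - real q * ivl_integral u (A (j i)) (A (Suc (j i)))\<bar>"
    unfolding birkhoff_sum_def sum_subtractf tot[OF per uli, symmetric] sum_distrib_left
    using sum.reindex_bij_betw[OF j, of "\<lambda>k. real q * ivl_integral u (A k) (A (Suc k))"] by simp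
  also have "\<dots> \<le> (\<Sum>i<q. W (j i))"
    by (rule order.trans[OF sum_abs]) (intro sum_mono near, simp)
  also have "\<dots> = (\<Sum>k<q. W k)" by (rule sum.reindex_bij_betw[OF j])
  also have "\<dots> = ivl_integral \<omega> 0 1 + (\<Sum>z\<in>Z. \<Sum>k<q. if hit z k then 2 * M else 0)"
    unfolding W_def sum.distrib tot[OF \<omega>(1,2)] by (subst sum.swap) simp
  also have "(\<Sum>z\<in>Z. \<Sum>k<q. if hit z k then 2 * M else 0) \<le> (\<Sum>z\<in>Z. 4 * M)"
  proof (rule sum_mono)
    fix z
    have "(\<Sum>k<q. if hit z k then 2 * M else 0) = real (card {k\<in>{..<q}. hit z k}) * (2 * M)"
      by (subst sum.inter_filter[symmetric]) auto
    also have "card {k\<in>{..<q}. hit z k} \<le> 2"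
      using card_arcs_meeting[OF q, of z x] by (simp add: hit_def A_def add.commute)
    then have "real (card {k\<in>{..<q}. hit z k}) * (2 * M) \<le> 2 * (2 * M)"
      using M by (intro mult_right_mono) auto
    finally show "(\<Sum>k<q. if hit z k then 2 * M else 0) \<le> 4 * M" by simp
  qed
  finally show ?thesis by (simp add: mult.commute)
qed

section \<open>The mean ergodic theorem along convergents\<close>

lemma borel_measurable_frac [measurable]: "frac \<in> borel_measurable (borel :: real measure)"
  unfolding frac_def[abs_def] by measurable

text \<open>On a bounded interval the lift is a finite sum of integer translates of \<open>g\<close>
  restricted to \<open>{0..<1}\<close>.\<close>

lemma locally_integrable_comp_frac:
  assumes "integrable lborel g"
  shows "locally_integrable (\<lambda>x. g (frac x))"
  unfolding locally_integrable_def
proof (intro allI)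
  fix a b :: real
  define h where "h = (\<lambda>x. indicator {0..<1} x *\<^sub>R g x)"
  have h: "integrable lborel h" unfolding h_def by (rule integrable_mult_indicator) (use assms in auto)
  define s where "s x = (\<Sum>m\<in>{\<lfloor>a\<rfloor>..\<lfloor>b\<rfloor>}. h (x + - of_int m))" for x
  have "locally_integrable s"
    unfolding s_def
    by (intro locally_integrable_sum locally_integrable_shift integrable_imp_locally_integrable h)
  then have "set_integrable lborel {a<..b} s" by (rule locally_integrableD)
  moreover have "s x = g (frac x)" if x: "x \<in> {a<..b}" for x
  proof -
    have fl: "\<lfloor>x\<rfloor> \<in> {\<lfloor>a\<rfloor>..\<lfloor>b\<rfloor>}" using x by (auto intro: floor_mono)
    have "h (x + - of_int m) = 0" if "m \<noteq> \<lfloor>x\<rfloor>" for m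
    proof -
      have "x - of_int m \<notin> {0..<1}" using that by (auto simp: floor_eq_iff) linarith
      then show ?thesis by (simp add: h_def)
    qed
    then have "s x = h (x + - of_int \<lfloor>x\<rfloor>)"
      unfolding s_def using fl by (subst sum.remove[OF _ fl]) (auto intro!: sum.neutral)
    also have "\<dots> = g (frac x)" using frac_lt_1[of x] frac_ge_0[of x] by (simp add: h_def frac_def)
    finally show ?thesis .
  qed
  ultimately show "set_integrable lborel {a<..b} (\<lambda>x. g (frac x))"
    using set_integrable_cong[of lborel lborel "{a<..b}" "{a<..b}" s "\<lambda>x. g (frac x)"] by simp
qed

lemma birkhoff_sum_locally_integrable:
  "locally_integrable u \<Longrightarrow> locally_integrable (birkhoff_sum \<alpha> u n)"
  unfolding birkhoff_sum_def by (intro locally_integrable_sum locally_integrable_shift)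

lemma ivl_integral_birkhoff_sum:
  assumes "periodic u" "locally_integrable u"
  shows "ivl_integral (birkhoff_sum \<alpha> u n) 0 1 = real n * ivl_integral u 0 1"
proof -
  have "ivl_integral (birkhoff_sum \<alpha> u n) 0 1 = (\<Sum>i<n. ivl_integral (\<lambda>x. u (x + real i * \<alpha>)) 0 1)"
    unfolding birkhoff_sum_def set_lebesgue_integral_def scaleR_sum_right
    using locally_integrable_shift[OF assms(2)]
    by (intro Bochner_Integration.integral_sum) (auto simp: locally_integrable_def set_integrable_def)
  also have "\<dots> = real n * ivl_integral u 0 1"
    by (simp add: ivl_integral_shift ivl_integral_period[OF assms] add.commute[of 1])
  finally show ?thesis .
qed

context
  fixes \<alpha> :: real and q :: "nat \<Rightarrow> nat" and p :: "nat \<Rightarrow> int"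
  assumes approx: "\<And>k. rational_approx \<alpha> (q k) (p k)" and q_lim: "filterlim q at_top sequentially"
begin

definition mean_error :: "(real \<Rightarrow> real) \<Rightarrow> nat \<Rightarrow> real \<Rightarrow> real" where
  "mean_error u k x = \<bar>birkhoff_sum \<alpha> u (q k) x / real (q k) - ivl_integral u 0 1\<bar>"

definition mean_ergodic :: "(real \<Rightarrow> real) \<Rightarrow> bool" where
  "mean_ergodic u \<longleftrightarrow> (\<lambda>k. ivl_integral (mean_error u k) 0 1) \<longlonglongrightarrow> 0"

lemma q_pos: "0 < q k"
  using approx[of k] by (simp add: rational_approx_def)

lemma mean_error_locally_integrable: "locally_integrable u \<Longrightarrow> locally_integrable (mean_error u k)"
  unfolding mean_error_def
  using locally_integrable_cmult[OF birkhoff_sum_locally_integrable, of u "1 / real (q k)" \<alpha> "q k"]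
  by (intro locally_integrable_abs locally_integrable_diff locally_integrable_const) simp

lemma mean_error_nonneg: "0 \<le> ivl_integral (mean_error u k) 0 1"
  by (rule ivl_integral_nonneg) (simp add: mean_error_def)

lemma mean_error_add:
  assumes "locally_integrable u" "locally_integrable v"
  shows "mean_error (\<lambda>x. u x + v x) k x \<le> mean_error u k x + mean_error v k x"
proof -
  have "ivl_integral (\<lambda>x. u x + v x) 0 1 = ivl_integral u 0 1 + ivl_integral v 0 1"
    using assms by (intro set_integral_add) (auto intro: locally_integrableD)
  then show ?thesis
    by (simp add: mean_error_def birkhoff_sum_def sum.distrib add_divide_distrib)
qed

lemma mean_ergodic_add:
  assumes "locally_integrable u" "locally_integrable v" "mean_ergodic u" "mean_ergodic v"
  shows "mean_ergodic (\<lambda>x. u x + v x)"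
proof -
  have le: "ivl_integral (mean_error (\<lambda>x. u x + v x) k) 0 1
      \<le> ivl_integral (mean_error u k) 0 1 + ivl_integral (mean_error v k) 0 1" for k
  proof -
    note [intro] = mean_error_locally_integrable locally_integrable_add assms(1,2)
    have "ivl_integral (mean_error (\<lambda>x. u x + v x) k) 0 1 \<le> ivl_integral (\<lambda>x. mean_error u k x + mean_error v k x) 0 1"
      by (intro ivl_integral_mono mean_error_add) auto
    also have "\<dots> = ivl_integral (mean_error u k) 0 1 + ivl_integral (mean_error v k) 0 1"
      by (intro set_integral_add locally_integrableD) auto
    finally show ?thesis .
  qed
  have "(\<lambda>k. ivl_integral (mean_error u k) 0 1 + ivl_integral (mean_error v k) 0 1) \<longlonglongrightarrow> 0"
    using tendsto_add[OF assms(3,4)[unfolded mean_ergodic_def]] by simp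
  then show ?thesis unfolding mean_ergodic_def
    by (rule tendsto_sandwich[OF always_eventually[OF allI[OF mean_error_nonneg]]
        always_eventually[OF allI[OF le]] tendsto_const])
qed

lemma mean_ergodic_cmult:
  assumes "mean_ergodic u"
  shows "mean_ergodic (\<lambda>x. c * u x)"
proof -
  have "mean_error (\<lambda>x. c * u x) k = (\<lambda>x. \<bar>c\<bar> * mean_error u k x)" for k
    by (auto simp: mean_error_def birkhoff_sum_def fun_eq_iff abs_mult[symmetric] algebra_simps sum_distrib_left)
  then have "(\<lambda>k. ivl_integral (mean_error (\<lambda>x. c * u x) k) 0 1) = (\<lambda>k. \<bar>c\<bar> * ivl_integral (mean_error u k) 0 1)"
    by simp
  then show ?thesis using tendsto_mult_left[OF assms[unfolded mean_ergodic_def], of "\<bar>c\<bar>"]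
    by (simp add: mean_ergodic_def)
qed

text \<open>Averaging over the orbit and taking the mean are both contractions in L1. This bound,
  uniform in \<open>k\<close>, is what lets mean ergodicity pass to L1 limits.\<close>

lemma mean_error_le:
  assumes "periodic u" "locally_integrable u"
  shows "ivl_integral (mean_error u k) 0 1 \<le> 2 * ivl_integral (\<lambda>x. \<bar>u x\<bar>) 0 1"
proof -
  let ?a = "\<lambda>x. \<bar>u x\<bar>"
  have a: "periodic ?a" "locally_integrable ?a" using assms by (auto simp: periodic_def locally_integrable_abs)
  let ?b = "\<lambda>x. (1 / real (q k)) * birkhoff_sum \<alpha> ?a (q k) x"
  have b: "locally_integrable ?b" by (intro locally_integrable_cmult birkhoff_sum_locally_integrable a)
  have "ivl_integral (mean_error u k) 0 1 \<le> ivl_integral (\<lambda>x. ?b x + ivl_integral ?a 0 1) 0 1"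
  proof (rule ivl_integral_mono)
    fix x
    have "\<bar>birkhoff_sum \<alpha> u (q k) x / real (q k)\<bar> \<le> ?b x"
      unfolding birkhoff_sum_def by (simp add: divide_right_mono)
    moreover have "\<bar>ivl_integral u 0 1\<bar> \<le> ivl_integral ?a 0 1" by (rule ivl_integral_abs[OF assms(2)])
    ultimately show "mean_error u k x \<le> ?b x + ivl_integral ?a 0 1" unfolding mean_error_def by linarith
  qed (intro mean_error_locally_integrable assms locally_integrable_add b locally_integrable_const)+
  also have "\<dots> = ivl_integral ?b 0 1 + ivl_integral ?a 0 1"
    using b by (subst set_integral_add) (auto intro: locally_integrableD locally_integrable_const simp: ivl_integral_const)
  also have "ivl_integral ?b 0 1 = ivl_integral ?a 0 1"
    using ivl_integral_birkhoff_sum[OF a] q_pos[of k] by simp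
  finally show ?thesis by simp
qed

lemma mean_ergodic_limit:
  assumes u: "periodic u" "locally_integrable u"
    and v: "\<And>n. periodic (v n)" "\<And>n. locally_integrable (v n)" "\<And>n. mean_ergodic (v n)"
    and lim: "(\<lambda>n. ivl_integral (\<lambda>x. \<bar>u x - v n x\<bar>) 0 1) \<longlonglongrightarrow> 0"
  shows "mean_ergodic u"
  unfolding mean_ergodic_def
proof (rule LIMSEQ_I)
  fix e :: real assume e: "0 < e"
  have "\<forall>\<^sub>F n in sequentially. ivl_integral (\<lambda>x. \<bar>u x - v n x\<bar>) 0 1 < e / 4"
    using order_tendstoD(2)[OF lim, of "e/4"] e by simp
  then obtain n where n: "ivl_integral (\<lambda>x. \<bar>u x - v n x\<bar>) 0 1 < e / 4"
    by (auto simp: eventually_sequentially)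
  obtain N where N: "\<forall>k\<ge>N. norm (ivl_integral (mean_error (v n) k) 0 1 - 0) < e / 2"
    using LIMSEQ_D[OF v(3)[of n, unfolded mean_ergodic_def], of "e/2"] e by auto
  have "norm (ivl_integral (mean_error u k) 0 1 - 0) < e" if "k \<ge> N" for k
  proof -
    define d where "d x = u x - v n x" for x
    have d: "periodic d" "locally_integrable d"
      using u v by (auto simp: periodic_def d_def[abs_def] locally_integrable_diff)
    have eq: "u = (\<lambda>x. d x + v n x)" by (simp add: d_def fun_eq_iff)
    have "ivl_integral (mean_error u k) 0 1 \<le> ivl_integral (\<lambda>x. mean_error d k x + mean_error (v n) k x) 0 1"
      by (subst eq) (intro ivl_integral_mono mean_error_add mean_error_locally_integrable locally_integrable_add d v)
    also have "\<dots> = ivl_integral (mean_error d k) 0 1 + ivl_integral (mean_error (v n) k) 0 1"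
      by (intro set_integral_add locally_integrableD mean_error_locally_integrable d v)
    also have "ivl_integral (mean_error d k) 0 1 \<le> 2 * ivl_integral (\<lambda>x. \<bar>d x\<bar>) 0 1"
      by (rule mean_error_le[OF d])
    finally have "ivl_integral (mean_error u k) 0 1 < e"
      using n N[rule_format, OF that] by (simp add: d_def)
    moreover have "0 \<le> ivl_integral (mean_error u k) 0 1"
      by (rule mean_error_nonneg)
    ultimately show ?thesis by simp
  qed
  then show "\<exists>no. \<forall>k\<ge>no. norm (ivl_integral (mean_error u k) 0 1 - 0) < e" by blast
qed

text \<open>Pointwise convergence under a common locally integrable majorant is convergence in L1 on
  a period, where \<open>mean_ergodic_limit\<close> applies.\<close>

lemma mean_ergodic_dominated:
  assumes meas: "u \<in> borel_measurable borel" "\<And>n. v n \<in> borel_measurable borel"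
    and u: "periodic u"
    and v: "\<And>n. periodic (v n)" "\<And>n. mean_ergodic (v n)"
    and lim: "\<And>x. (\<lambda>n. v n x) \<longlonglongrightarrow> u x" and w: "locally_integrable w" "\<And>n x. \<bar>v n x\<bar> \<le> w x"
  shows "mean_ergodic u"
proof -
  have uw: "\<bar>u x\<bar> \<le> w x" for x
    using tendsto_rabs[OF lim[of x]] w(2) by (intro LIMSEQ_le_const2[of "\<lambda>n. \<bar>v n x\<bar>"]) auto
  have li: "locally_integrable z" if "z \<in> borel_measurable borel" "\<And>x. \<bar>z x\<bar> \<le> w x" for z
    unfolding locally_integrable_def
  proof (intro allI)
    fix a b
    show "set_integrable lborel {a<..b} z"
      using that by (intro set_integrable_bound[OF locally_integrableD[OF w(1)]])
        (auto simp: set_borel_measurable_def intro: order.trans[OF _ abs_ge_self])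
  qed
  have "(\<lambda>n. LINT x|lborel. indicator {0<..1} x *\<^sub>R \<bar>u x - v n x\<bar>) \<longlonglongrightarrow> (LINT (x::real)|lborel. (0::real))"
  proof (rule integral_dominated_convergence[where M = lborel and f = "\<lambda>_. 0" and
        s = "\<lambda>n x. indicator {0<..1} x *\<^sub>R \<bar>u x - v n x\<bar>" and w = "\<lambda>x. indicator {0<..1} x *\<^sub>R (2 * w x)"])
    show "integrable lborel (\<lambda>x. indicator {0<..1} x *\<^sub>R (2 * w x))"
      using locally_integrableD[OF locally_integrable_cmult[OF w(1), of 2]] by (simp add: set_integrable_def)
    show "AE x in lborel. (\<lambda>n. indicator {0<..1} x *\<^sub>R \<bar>u x - v n x\<bar>) \<longlonglongrightarrow> 0"
    proof (intro AE_I2)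
      fix x :: real
      have "(\<lambda>n. \<bar>u x - v n x\<bar>) \<longlonglongrightarrow> \<bar>u x - u x\<bar>" by (intro tendsto_intros lim)
      from tendsto_scaleR[OF tendsto_const this] show "(\<lambda>n. indicator {0<..1} x *\<^sub>R \<bar>u x - v n x\<bar>) \<longlonglongrightarrow> 0"
        by simp
    qed
    show "AE x in lborel. norm (indicator {0<..1} x *\<^sub>R \<bar>u x - v n x\<bar>) \<le> indicator {0<..1} x *\<^sub>R (2 * w x)" for n
    proof (intro AE_I2)
      fix x :: real
      have "\<bar>u x - v n x\<bar> \<le> 2 * w x" using uw[of x] w(2)[of n x] by linarith
      then show "norm (indicator {0<..1} x *\<^sub>R \<bar>u x - v n x\<bar>) \<le> indicator {0<..1} x *\<^sub>R (2 * w x)"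
        by (simp add: indicator_def)
    qed
  qed (use meas in measurable)
  then show ?thesis
    by (intro mean_ergodic_limit[of u v] u v li meas w(2) uw) (simp add: set_lebesgue_integral_def)
qed

text \<open>Denjoy--Koksma with \<open>\<omega> = 0\<close>: the indicator is locally constant off
  the integers and the translates of \<open>a\<close>, so the deviation is at most 4 for each of
  these two points, and division by \<open>q k\<close> sends it to 0.\<close>

lemma mean_ergodic_atMost: "mean_ergodic (\<lambda>x. indicator {..a} (frac x))"
proof -
  let ?u = "\<lambda>x. indicator {..a} (frac x) :: real"
  have meas: "?u \<in> borel_measurable borel" by measurable
  have dk: "\<bar>birkhoff_sum \<alpha> ?u (q k) x - real (q k) * ivl_integral ?u 0 1\<bar> \<le> ivl_integral (\<lambda>_. 0) 0 1 + 4 * 1 * real (card {0, a})" for k x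
  proof (rule denjoy_koksma[OF approx])
    fix s t :: real assume st: "s \<le> t" "\<forall>z\<in>{0, a}. \<forall>m::int. z + of_int m \<notin> {s..t}"
    have fl: "\<lfloor>s\<rfloor> = \<lfloor>t\<rfloor>"
    proof (rule ccontr)
      assume "\<lfloor>s\<rfloor> \<noteq> \<lfloor>t\<rfloor>"
      then have "\<lfloor>s\<rfloor> < \<lfloor>t\<rfloor>" using floor_mono[OF st(1)] by linarith
      then have "0 + of_int \<lfloor>t\<rfloor> \<in> {s..t}" by simp linarith
      with st(2) show False by blast
    qed
    have "frac s \<le> a \<longleftrightarrow> frac t \<le> a"
      using st(2)[rule_format, of a "\<lfloor>t\<rfloor>"] st(1) by (auto simp: frac_def fl)
    then show "\<bar>?u t - ?u s\<bar> \<le> ivl_integral (\<lambda>_. 0) s t" by (simp add: indicator_def set_lebesgue_integral_def)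
  qed (use meas in \<open>auto simp: indicator_def periodic_def frac_1_eq locally_integrable_const\<close>)
  have bound: "ivl_integral (mean_error ?u k) 0 1 \<le> 8 / real (q k)" for k
  proof -
    have "mean_error ?u k x \<le> 8 / real (q k)" for x
    proof -
      have "card {0, a} \<le> 2" by (simp add: card_insert_if)
      then have "\<bar>birkhoff_sum \<alpha> ?u (q k) x - real (q k) * ivl_integral ?u 0 1\<bar> \<le> 8"
        using dk[of k x] by (simp add: set_lebesgue_integral_def)
      then have "\<bar>birkhoff_sum \<alpha> ?u (q k) x - real (q k) * ivl_integral ?u 0 1\<bar> / real (q k) \<le> 8 / real (q k)"
        by (rule divide_right_mono) simp
      also have "\<bar>birkhoff_sum \<alpha> ?u (q k) x - real (q k) * ivl_integral ?u 0 1\<bar> / real (q k) = mean_error ?u k x"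
      proof -
        have "birkhoff_sum \<alpha> ?u (q k) x / real (q k) - c = (birkhoff_sum \<alpha> ?u (q k) x - real (q k) * c) / real (q k)" for c
          using q_pos[of k] by (simp add: diff_divide_distrib)
        then show ?thesis by (simp add: mean_error_def abs_divide)
      qed
      finally show ?thesis .
    qed
    then have "ivl_integral (mean_error ?u k) 0 1 \<le> ivl_integral (\<lambda>_. 8 / real (q k)) 0 1"
      using meas by (intro ivl_integral_mono mean_error_locally_integrable locally_integrable_const
          locally_integrable_bounded[of _ 1]) (auto simp: indicator_def)
    then show ?thesis by (simp add: ivl_integral_const)
  qed
  have "(\<lambda>k. 8 / real (q k)) \<longlonglongrightarrow> 0"
    using filterlim_compose[OF lim_const_over_n[of "8::real"] q_lim] by simp
  then show ?thesis unfolding mean_ergodic_def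
    by (rule tendsto_sandwich[OF always_eventually[OF allI[OF mean_error_nonneg]]
        always_eventually[OF allI[OF bound]] tendsto_const])
qed

text \<open>Dynkin's argument: rays form an intersection-stable generator, and the sets with mean
  ergodic indicator are closed under complements and, by dominated convergence of the partial
  unions, under countable disjoint unions.\<close>

lemma mean_ergodic_indicator:
  assumes "A \<in> sets borel"
  shows "mean_ergodic (\<lambda>x. indicator A (frac x))"
proof -
  have eq: "sigma_sets UNIV (range atMost) = sets (borel :: real measure)"
    by (simp add: borel_eq_atMost)
  have li: "locally_integrable (\<lambda>x. indicator A (frac x) :: real)" if "A \<in> sets borel" for A
  proof (rule locally_integrable_bounded[of _ 1])
    show "(\<lambda>x. indicator A (frac x) :: real) \<in> borel_measurable borel"
      using that by measurable
  qed (simp add: indicator_def)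
  have one: "mean_ergodic (\<lambda>x. 1)"
  proof -
    have "mean_error (\<lambda>x. 1) k = (\<lambda>x. 0)" for k
      using q_pos[of k] by (auto simp: mean_error_def birkhoff_sum_def ivl_integral_const)
    then show ?thesis by (simp add: mean_ergodic_def set_lebesgue_integral_def)
  qed
  have "A \<in> sigma_sets UNIV (range atMost)" using assms eq by simp
  then show ?thesis
  proof (induction rule: sigma_sets_induct_disjoint[OF _ _ \<open>A \<in> sigma_sets UNIV (range atMost)\<close>, consumes 0])
    case 1
    then show ?case by (auto simp: Int_stable_def)
  next
    case 2 then show ?case by auto
  next
    case (3 A) then show ?case using mean_ergodic_atMost by auto
  next
    case 4
    show ?case using mean_ergodic_cmult[OF one, of 0] by simp
  next
    case (5 A)
    then have "A \<in> sets borel" by (simp add: eq)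
    then have "mean_ergodic (\<lambda>x. 1 + (- 1) * indicator A (frac x))"
      by (intro mean_ergodic_add mean_ergodic_cmult one 5 locally_integrable_cmult li locally_integrable_const)
    also have "(\<lambda>x. 1 + (- 1) * indicator A (frac x)) = (\<lambda>x. indicator (UNIV - A) (frac x) :: real)"
      by (auto simp: indicator_def)
    finally show ?case .
  next
    case (6 A)
    then have A: "\<And>i. A i \<in> sets borel" by (auto simp: eq)
    have dis: "disjoint_family A" by fact
    define v where "v n x = (\<Sum>i<n. indicator (A i) (frac x) :: real)" for n :: nat and x
    have v: "mean_ergodic (v n) \<and> locally_integrable (v n)" for n
    proof (induction n)
      case 0
      then show ?case using mean_ergodic_cmult[OF one, of 0]
        by (simp add: v_def[abs_def] locally_integrable_const)
    next
      case (Suc n)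
      have "v (Suc n) = (\<lambda>x. v n x + indicator (A n) (frac x))" by (simp add: v_def fun_eq_iff)
      then show ?case using Suc 6 A by (auto intro!: mean_ergodic_add locally_integrable_add li)
    qed
    have vU: "v n x = indicator (\<Union>i<n. A i) (frac x)" for n x
      unfolding v_def using dis by (subst indicator_UN_disjoint) (auto simp: disjoint_family_on_def)
    show ?case
    proof (rule mean_ergodic_dominated[where v = v and w = "\<lambda>_. 1"])
      show "(\<lambda>n. v n x) \<longlonglongrightarrow> indicator (\<Union> (range A)) (frac x)" for x
        unfolding vU using LIMSEQ_indicator_UN[of A "frac x"] by simp
      show "\<bar>v n x\<bar> \<le> 1" for n x unfolding vU by (simp add: indicator_def)
      show "v n \<in> borel_measurable borel" for n unfolding v_def using A by measurable
      show "(\<lambda>x. indicator (\<Union> (range A)) (frac x) :: real) \<in> borel_measurable borel"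
      proof -
        have "\<Union> (range A) \<in> sets borel" using A by auto
        then show ?thesis by measurable
      qed
      show "periodic (v n)" for n by (simp add: v_def periodic_def frac_1_eq)
    qed (use v locally_integrable_const in auto)
  qed
qed

lemma mean_ergodic_integrable:
  assumes "integrable lborel g"
  shows "mean_ergodic (\<lambda>x. g (frac x))"
  using assms
proof (induction rule: integrable_induct)
  case (base A c)
  then have "mean_ergodic (\<lambda>x. c * indicator A (frac x))"
    by (intro mean_ergodic_cmult mean_ergodic_indicator) auto
  then show ?case by (simp add: mult.commute)
next
  case (add f g)
  then show ?case by (intro mean_ergodic_add locally_integrable_comp_frac) auto
next
  case (lim f s)
  show ?case
  proof (rule mean_ergodic_dominated[where v = "\<lambda>n x. s n (frac x)" and w = "\<lambda>x. 2 * \<bar>f (frac x)\<bar>"])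
    show "locally_integrable (\<lambda>x. 2 * \<bar>f (frac x)\<bar>)"
      by (intro locally_integrable_cmult locally_integrable_abs locally_integrable_comp_frac lim)
    have m: "f \<in> borel_measurable borel" "\<And>n. s n \<in> borel_measurable borel"
      using borel_measurable_integrable[OF lim(4)] borel_measurable_integrable[OF lim(1)] by auto
    show "(\<lambda>x. f (frac x)) \<in> borel_measurable borel" using m(1) by measurable
    show "(\<lambda>x. s n (frac x)) \<in> borel_measurable borel" for n using m(2)[of n] by measurable
  qed (use lim in auto)
qed

theorem mean_ergodic_periodic:
  assumes "periodic u" "locally_integrable u"
  shows "mean_ergodic u"
proof -
  \<comment> \<open>\<open>{-1<..1}\<close> rather than \<open>{0<..1}\<close>, because
    \<open>frac\<close> takes the value 0.\<close>
  define g where "g x = indicator {-1<..1} x *\<^sub>R u x" for x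
  have "integrable lborel g"
    using locally_integrableD[OF assms(2), of "-1" 1] by (simp add: set_integrable_def g_def[abs_def])
  then have "mean_ergodic (\<lambda>x. g (frac x))" by (rule mean_ergodic_integrable)
  also have "(\<lambda>x. g (frac x)) = u"
  proof
    fix x :: real
    have "frac x \<in> {-1<..1}" using frac_ge_0[of x] frac_lt_1[of x] by (simp, linarith)
    then show "g (frac x) = u x" using periodic_frac[OF assms(1)] by (simp add: g_def)
  qed
  finally show ?thesis .
qed

end

section \<open>Increments of Birkhoff sums\<close>

lemma measure_frac_le:
  assumes "0 \<le> l"
  shows "measure lborel ({x. frac (x - s) \<le> l} \<inter> {0<..1}) \<le> l"
proof -
  let ?u = "\<lambda>x. indicator {..l} (frac x) :: real"
  have li: "locally_integrable ?u"
  proof (rule locally_integrable_bounded[of _ 1])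
    show "?u \<in> borel_measurable borel" by measurable
  qed (simp add: indicator_def)
  have "measure lborel ({x. frac (x - s) \<le> l} \<inter> {0<..1}) = ivl_integral (\<lambda>x. ?u (x + - s)) 0 1"
  proof -
    have "ivl_integral (\<lambda>x. ?u (x + - s)) 0 1 = (LINT x|lborel. indicator ({x. frac (x - s) \<le> l} \<inter> {0<..1}) x)"
      unfolding set_lebesgue_integral_def by (intro Bochner_Integration.integral_cong) (auto simp: indicator_def)
    then show ?thesis by simp
  qed
  also have "\<dots> = ivl_integral ?u 0 1"
    using ivl_integral_period[OF periodic_comp_frac[of "\<lambda>x. indicator {..l} x"] li, of "- s"]
    unfolding ivl_integral_shift[where u = ?u] by (simp only: add.commute[of _ "- s"] add_0_right)
  also have "\<dots> = measure lborel ({x. frac x \<le> l} \<inter> {0<..1})"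
  proof -
    have "ivl_integral ?u 0 1 = (LINT x|lborel. indicator ({x. frac x \<le> l} \<inter> {0<..1}) x)"
      unfolding set_lebesgue_integral_def by (intro Bochner_Integration.integral_cong) (auto simp: indicator_def)
    then show ?thesis by simp
  qed
  \<comment> \<open>The point 1 has fractional part 0 and has to be added.\<close>
  also have "\<dots> \<le> measure lborel ({0..l} \<union> {1})"
  proof (rule measure_mono_fmeasurable)
    show "{x. frac x \<le> l} \<inter> {0<..1} \<subseteq> {0..l} \<union> {1}"
    proof
      fix x :: real assume x: "x \<in> {x. frac x \<le> l} \<inter> {0<..1}"
      show "x \<in> {0..l} \<union> {1}"
      proof (cases "x = 1")
        case False
        then have "frac x = x" using x by (auto simp: frac_eq)
        then show ?thesis using x by auto
      qed simp
    qed
    show "{x. frac x \<le> l} \<inter> {0<..1} \<in> sets lborel" by measurable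
    show "{0..l} \<union> {1} \<in> fmeasurable lborel" 
      using fmeasurable_cbox[of 0 l] by (intro fmeasurable.Un) (auto intro: fmeasurableI)
  qed
  also have "\<dots> \<le> measure lborel {0..l} + measure lborel {1::real}" by (rule measure_Un_le) auto
  finally show ?thesis using assms by simp
qed

text \<open>By Fubini and periodicity, the window integral has integral
  \<open>(b - a) * ivl_integral w 0 1\<close> over a period; Markov's inequality does the
  rest.\<close>

lemma window_average_small:
  fixes w :: "real \<Rightarrow> real"
  assumes meas: "w \<in> borel_measurable borel" and w: "periodic w" "locally_integrable w" "\<And>x. 0 \<le> w x"
    and ab: "a \<le> b" and \<kappa>: "0 < \<kappa>"
  shows "{x. \<kappa> \<le> ivl_integral (\<lambda>t. w (x + t)) a b} \<in> sets borel"
    and "measure lborel ({x. \<kappa> \<le> ivl_integral (\<lambda>t. w (x + t)) a b} \<inter> {0<..1})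
      \<le> (b - a) * ivl_integral w 0 1 / \<kappa>"
proof -
  note [measurable] = meas
  let ?W = "\<lambda>x. ivl_integral (\<lambda>t. w (x + t)) a b"
  have Wm [measurable]: "?W \<in> borel_measurable borel"
    unfolding set_lebesgue_integral_def by measurable
  show "{x. \<kappa> \<le> ?W x} \<in> sets borel" by measurable
  have nn: "ennreal (ivl_integral v c d) = (\<integral>\<^sup>+t. indicator {c<..d} t * ennreal (v t) \<partial>lborel)"
    if "locally_integrable v" "\<And>x. 0 \<le> v x" for v c d
  proof -
    have "(\<integral>\<^sup>+t. ennreal (indicator {c<..d} t *\<^sub>R v t) \<partial>lborel) = ennreal (ivl_integral v c d)"
      unfolding set_lebesgue_integral_def
      using locally_integrableD[OF that(1)] that(2) by (intro nn_integral_eq_integral) (auto simp: set_integrable_def)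
    then show ?thesis by (simp add: ennreal_mult ennreal_indicator that(2))
  qed
  have W: "ennreal (?W x) = (\<integral>\<^sup>+t. indicator {a<..b} t * ennreal (w (x + t)) \<partial>lborel)" for x
    using locally_integrable_shift[OF w(2), of x] w(3) by (subst nn) (auto simp: add.commute)
  have "(\<integral>\<^sup>+x. indicator {0<..1} x * ennreal (?W x) \<partial>lborel)
      = (\<integral>\<^sup>+x. \<integral>\<^sup>+t. indicator {0<..1} x * (indicator {a<..b} t * ennreal (w (x + t))) \<partial>lborel \<partial>lborel)"
    unfolding W by (subst nn_integral_cmult[symmetric]) auto
  also have "\<dots> = (\<integral>\<^sup>+t. \<integral>\<^sup>+x. indicator {0<..1} x * (indicator {a<..b} t * ennreal (w (x + t))) \<partial>lborel \<partial>lborel)"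
    by (rule lborel_pair.Fubini') measurable
  also have "\<dots> = (\<integral>\<^sup>+t. indicator {a<..b} t * ennreal (ivl_integral w 0 1) \<partial>lborel)"
  proof (rule nn_integral_cong)
    fix t :: real
    have "(\<integral>\<^sup>+x. indicator {0<..1} x * (indicator {a<..b} t * ennreal (w (x + t))) \<partial>lborel)
        = (\<integral>\<^sup>+x. indicator {a<..b} t * (indicator {0<..1} x * ennreal (w (x + t))) \<partial>lborel)"
      by (simp add: mult.left_commute)
    also have "\<dots> = indicator {a<..b} t * (\<integral>\<^sup>+x. indicator {0<..1} x * ennreal (w (x + t)) \<partial>lborel)"
      by (rule nn_integral_cmult) measurable
    also have "(\<integral>\<^sup>+x. indicator {0<..1} x * ennreal (w (x + t)) \<partial>lborel) = ennreal (ivl_integral (\<lambda>x. w (x + t)) 0 1)"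
      by (rule nn[symmetric]) (use w locally_integrable_shift in auto)
    also have "ivl_integral (\<lambda>x. w (x + t)) 0 1 = ivl_integral w 0 1"
      using ivl_integral_period[OF w(1,2), of t] by (simp add: ivl_integral_shift add.commute)
    finally show "(\<integral>\<^sup>+x. indicator {0<..1} x * (indicator {a<..b} t * ennreal (w (x + t))) \<partial>lborel)
        = indicator {a<..b} t * ennreal (ivl_integral w 0 1)" .
  qed
  also have "\<dots> = ennreal (b - a) * ennreal (ivl_integral w 0 1)"
    using ab by (subst nn_integral_multc) auto
  also have "\<dots> = ennreal ((b - a) * ivl_integral w 0 1)"
    using ab ivl_integral_nonneg[of w 0 1, OF w(3)] by (simp add: ennreal_mult)
  finally have tot: "(\<integral>\<^sup>+x. indicator {0<..1} x * ennreal (?W x) \<partial>lborel) = ennreal ((b - a) * ivl_integral w 0 1)" .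
  have pos: "0 \<le> (b - a) * ivl_integral w 0 1"
    using ab ivl_integral_nonneg[of w 0 1, OF w(3)] by simp
  have "emeasure lborel ({x. \<kappa> \<le> ?W x} \<inter> {0<..1}) \<le>
      emeasure lborel ({x\<in>{0<..1}. 1 \<le> ennreal (1/\<kappa>) * ennreal (?W x)})"
  proof (rule emeasure_mono)
    show "{x. \<kappa> \<le> ?W x} \<inter> {0<..1} \<subseteq> {x\<in>{0<..1}. 1 \<le> ennreal (1/\<kappa>) * ennreal (?W x)}"
    proof
      fix x assume x: "x \<in> {x. \<kappa> \<le> ?W x} \<inter> {0<..1}"
      then have "1 \<le> 1/\<kappa> * ?W x" using \<kappa> by (simp add: field_simps)
      then have "ennreal 1 \<le> ennreal (1/\<kappa> * ?W x)" by (rule ennreal_leI)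
      also have "\<dots> = ennreal (1/\<kappa>) * ennreal (?W x)" using \<kappa> x by (intro ennreal_mult) auto
      finally show "x \<in> {x\<in>{0<..1}. 1 \<le> ennreal (1/\<kappa>) * ennreal (?W x)}" using x by simp
    qed
    show "{x\<in>{0<..1}. 1 \<le> ennreal (1/\<kappa>) * ennreal (?W x)} \<in> sets lborel" by measurable
  qed
  also have "\<dots> \<le> ennreal (1/\<kappa>) * (\<integral>\<^sup>+x. ennreal (?W x) * indicator {0<..1} x \<partial>lborel)"
    by (rule nn_integral_Markov_inequality) auto
  also have "\<dots> = ennreal (1/\<kappa>) * ennreal ((b - a) * ivl_integral w 0 1)"
    using tot by (simp add: mult.commute)
  also have "\<dots> = ennreal ((b - a) * ivl_integral w 0 1 / \<kappa>)"
    using \<kappa> pos by (simp add: ennreal_mult[symmetric])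
  finally have "emeasure lborel ({x. \<kappa> \<le> ?W x} \<inter> {0<..1}) \<le> ennreal ((b - a) * ivl_integral w 0 1 / \<kappa>)" .
  then show "measure lborel ({x. \<kappa> \<le> ?W x} \<inter> {0<..1}) \<le> (b - a) * ivl_integral w 0 1 / \<kappa>"
    using pos \<kappa> unfolding measure_def by (intro enn2real_leI) auto
qed

text \<open>Modulo 1, \<open>x + q * \<alpha>\<close> is \<open>x + h\<close>, so the increment is a
  sum of \<open>q\<close> increments of \<open>u\<close> over segments of length
  \<open>\<bar>h\<bar>\<close>. If no segment contains a jump, it is the integral of the Birkhoff
  sum of \<open>G\<close> over a window of length \<open>\<bar>h\<bar>\<close>, and in L1 this
  Birkhoff sum differs from \<open>q\<close> times the integral of \<open>G\<close> by
  \<open>q * err\<close>.\<close>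

lemma birkhoff_increment:
  assumes ra: "rational_approx \<alpha> q p"
    and u: "periodic u" and G: "G \<in> borel_measurable borel" "periodic G" "locally_integrable G"
    and Z: "finite Z"
    and incr: "\<And>a b. a \<le> b \<Longrightarrow> (\<forall>z\<in>Z. \<forall>m::int. z + of_int m \<notin> {a..b}) \<Longrightarrow> u b - u a = ivl_integral G a b"
    and \<kappa>: "0 < \<kappa>"
  defines "h \<equiv> real q * \<alpha> - p"
  defines "err \<equiv> ivl_integral (\<lambda>x. \<bar>birkhoff_sum \<alpha> G q x / real q - ivl_integral G 0 1\<bar>) 0 1"
  shows "\<exists>B\<in>sets borel. (\<forall>x. x + 1 \<in> B \<longleftrightarrow> x \<in> B) \<and>
    measure lborel (B \<inter> {0<..1}) \<le> card Z * (real q * \<bar>h\<bar>) + err / \<kappa> \<and>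
    (\<forall>x. x \<notin> B \<longrightarrow> \<bar>birkhoff_sum \<alpha> u q (x + real q * \<alpha>) - birkhoff_sum \<alpha> u q x
        - real q * h * ivl_integral G 0 1\<bar> < \<kappa>)"
proof -
  have q: "0 < q" and hq: "\<bar>h\<bar> < 1 / real q" using ra by (auto simp: rational_approx_def h_def)
  then have h1: "\<bar>h\<bar> < 1" using q by (smt (verit) divide_le_eq_1 of_nat_1 of_nat_le_iff less_eq_Suc_le One_nat_def)
  have qh: "real q * \<bar>h\<bar> < 1" using hq q by (simp add: field_simps)
  \<comment> \<open>The window runs from \<open>a \<le> 0\<close> to \<open>b \<ge> 0\<close>, which
    treats both signs of \<open>h\<close> at once.\<close>
  define a where "a = min 0 h"
  define b where "b = max 0 h"
  have ab: "a \<le> b" "b - a = \<bar>h\<bar>" by (auto simp: a_def b_def)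
  define I where "I = ivl_integral G 0 1"
  define w where "w x = \<bar>birkhoff_sum \<alpha> G q x / real q - I\<bar>" for x
  have wm: "w \<in> borel_measurable borel" unfolding w_def birkhoff_sum_def using G(1) by measurable
  have w: "periodic w" "locally_integrable w" "\<And>x. 0 \<le> w x"
  proof -
    show "periodic w" using birkhoff_sum_periodic[OF G(2), of \<alpha> q] by (simp add: periodic_def w_def)
    show "locally_integrable w"
      using locally_integrable_cmult[OF birkhoff_sum_locally_integrable[OF G(3)], of "1 / real q" \<alpha> q]
      unfolding w_def by (intro locally_integrable_abs locally_integrable_diff locally_integrable_const) simp
  qed (simp add: w_def)
  \<comment> \<open>\<open>x\<close> lies in \<open>B1\<close> iff one of the \<open>q\<close>
    segments from \<open>x + i * \<alpha> + a\<close> to \<open>x + i * \<alpha> + b\<close>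
    contains an integer translate of a point of \<open>Z\<close>.\<close>
  define B1 where "B1 = (\<Union>(i, z)\<in>{..<q} \<times> Z. {x. frac (x - (z - real i * \<alpha> - b)) \<le> b - a})"
  \<comment> \<open>The window integral of the Birkhoff sum is off by at most \<open>q\<close> times
    that of \<open>w\<close>, hence the threshold \<open>\<kappa> / q\<close>. The shortness of the
    window, \<open>q * \<bar>h\<bar> < 1\<close>, compensates this factor in the measure of
    \<open>B2\<close>.\<close>
  define B2 where "B2 = {x. \<kappa> / real q \<le> ivl_integral (\<lambda>t. w (x + t)) a b}"
  have \<kappa>q: "0 < \<kappa> / real q" using \<kappa> q by simp
  note B2 = window_average_small[OF wm w ab(1) \<kappa>q, folded B2_def]
  have B1m: "B1 \<in> sets borel"
    unfolding B1_def using Z by (intro sets.finite_UN) (auto simp: split_beta)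
  have fr: "frac (x + 1 - c) = frac (x - c)" for x c :: real
    using frac_1_eq[of "x - c"] by (simp add: algebra_simps)
  have per: "x + 1 \<in> B1 \<union> B2 \<longleftrightarrow> x \<in> B1 \<union> B2" for x
  proof -
    have "w (x + 1 + t) = w (x + t)" for t
      using w(1) unfolding periodic_def by (metis add.assoc add.commute)
    then show ?thesis unfolding B1_def B2_def using fr by auto
  qed
  have "measure lborel (B1 \<inter> {0<..1}) \<le> card Z * (real q * \<bar>h\<bar>)"
  proof -
    have "B1 \<inter> {0<..1} = (\<Union>iz\<in>{..<q} \<times> Z. {x. frac (x - (snd iz - real (fst iz) * \<alpha> - b)) \<le> b - a} \<inter> {0<..1})"
      unfolding B1_def by auto
    also have "measure lborel \<dots> \<le> (\<Sum>iz\<in>{..<q} \<times> Z. measure lborel ({x. frac (x - (snd iz - real (fst iz) * \<alpha> - b)) \<le> b - a} \<inter> {0<..1}))"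
      using Z by (intro measure_UNION_le) auto
    also have "\<dots> \<le> (\<Sum>iz\<in>{..<q} \<times> Z. b - a)"
      using ab by (intro sum_mono measure_frac_le) auto
    finally show ?thesis using ab Z by (simp add: card_cartesian_product algebra_simps)
  qed
  moreover have "measure lborel (B2 \<inter> {0<..1}) \<le> err / \<kappa>"
  proof -
    have e: "ivl_integral w 0 1 = err" by (simp add: err_def w_def I_def)
    then have e0: "0 \<le> err" using ivl_integral_nonneg[of w 0 1, OF w(3)] by simp
    have "measure lborel (B2 \<inter> {0<..1}) \<le> (b - a) * ivl_integral w 0 1 / (\<kappa> / real q)" by (rule B2(2))
    also have "\<dots> = (real q * \<bar>h\<bar>) * (err / \<kappa>)" using ab e by simp
    also have "\<dots> \<le> 1 * (err / \<kappa>)" using qh e0 \<kappa> by (intro mult_right_mono) auto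
    finally show ?thesis by simp
  qed
  moreover have "measure lborel ((B1 \<union> B2) \<inter> {0<..1}) \<le> measure lborel (B1 \<inter> {0<..1}) + measure lborel (B2 \<inter> {0<..1})"
    using B1m B2(1) unfolding Int_Un_distrib2 by (intro measure_Un_le) auto
  moreover have "\<bar>birkhoff_sum \<alpha> u q (x + real q * \<alpha>) - birkhoff_sum \<alpha> u q x - real q * h * I\<bar> < \<kappa>"
    if x: "x \<notin> B1 \<union> B2" for x
  proof -
    have seg: "u (x + real i * \<alpha> + b) - u (x + real i * \<alpha> + a) = ivl_integral (\<lambda>t. G (x + real i * \<alpha> + t)) a b" if i: "i < q" for i
    proof -
      have "u (x + real i * \<alpha> + b) - u (x + real i * \<alpha> + a) = ivl_integral G (x + real i * \<alpha> + a) (x + real i * \<alpha> + b)"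
      proof (rule incr)
        show "x + real i * \<alpha> + a \<le> x + real i * \<alpha> + b" using ab by simp
        show "\<forall>z\<in>Z. \<forall>m::int. z + of_int m \<notin> {x + real i * \<alpha> + a..x + real i * \<alpha> + b}"
        proof (intro ballI allI notI)
          fix z and m :: int assume z: "z \<in> Z" and m: "z + of_int m \<in> {x + real i * \<alpha> + a..x + real i * \<alpha> + b}"
          define y where "y = x - (z - real i * \<alpha> - b) - of_int m"
          have "0 \<le> y" "y \<le> b - a" using m by (auto simp: y_def)
          then have "frac y = y" using ab h1 by (auto simp: frac_eq)
          moreover have "frac y = frac (x - (z - real i * \<alpha> - b))"
            unfolding y_def frac_def by simp
          ultimately have "x \<in> B1" using i z \<open>y \<le> b - a\<close> unfolding B1_def by auto
          with x show False by simp
        qed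
      qed
      also have "\<dots> = ivl_integral (\<lambda>t. G (t + (x + real i * \<alpha>))) a b"
        unfolding ivl_integral_shift by (simp only: add.commute[of "x + real i * \<alpha>"])
      finally show ?thesis by (simp only: add.commute[of "x + real i * \<alpha>"])
    qed
    have bint: "birkhoff_sum \<alpha> u q (x + b) - birkhoff_sum \<alpha> u q (x + a) = ivl_integral (\<lambda>t. birkhoff_sum \<alpha> G q (x + t)) a b"
    proof -
      have "birkhoff_sum \<alpha> u q (x + b) - birkhoff_sum \<alpha> u q (x + a) = (\<Sum>i<q. ivl_integral (\<lambda>t. G (x + real i * \<alpha> + t)) a b)"
        unfolding birkhoff_sum_def sum_subtractf[symmetric]
        using seg by (intro sum.cong refl) (simp add: algebra_simps)
      also have "\<dots> = ivl_integral (\<lambda>t. birkhoff_sum \<alpha> G q (x + t)) a b"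
      proof -
        have G_int: "integrable lborel (\<lambda>t. indicator {a<..b} t *\<^sub>R G (x + real i * \<alpha> + t))" for i
          using locally_integrableD[OF locally_integrable_shift[OF G(3), of "x + real i * \<alpha>"], of a b]
          by (simp add: set_integrable_def add.commute[of _ "x + real i * \<alpha>"])
        have eq: "birkhoff_sum \<alpha> G q (x + t) = (\<Sum>i<q. G (x + real i * \<alpha> + t))" for t
          by (simp add: birkhoff_sum_def add_ac)
        show ?thesis
          unfolding eq set_lebesgue_integral_def scaleR_sum_right
          by (rule Bochner_Integration.integral_sum[symmetric]) (rule G_int)
      qed
      finally show ?thesis .
    qed
    have li: "locally_integrable (\<lambda>t. birkhoff_sum \<alpha> G q (x + t))"
      using locally_integrable_shift[OF birkhoff_sum_locally_integrable[OF G(3)], of \<alpha> q x] by (simp add: add.commute)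
    have "ivl_integral (\<lambda>t. birkhoff_sum \<alpha> G q (x + t) - real q * I) a b
        = ivl_integral (\<lambda>t. birkhoff_sum \<alpha> G q (x + t)) a b - (b - a) * (real q * I)"
      using ivl_integral_const[OF ab(1)]
      by (subst set_integral_diff) (auto intro: locally_integrableD li locally_integrable_const)
    then have "\<bar>birkhoff_sum \<alpha> u q (x + b) - birkhoff_sum \<alpha> u q (x + a) - \<bar>h\<bar> * (real q * I)\<bar>
        = \<bar>ivl_integral (\<lambda>t. birkhoff_sum \<alpha> G q (x + t) - real q * I) a b\<bar>"
      using bint ab by simp
    also have "\<dots> \<le> ivl_integral (\<lambda>t. \<bar>birkhoff_sum \<alpha> G q (x + t) - real q * I\<bar>) a b"
      by (intro ivl_integral_abs locally_integrable_diff li locally_integrable_const)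
    also have "(\<lambda>t. \<bar>birkhoff_sum \<alpha> G q (x + t) - real q * I\<bar>) = (\<lambda>t. real q * w (x + t))"
      using q by (auto simp: w_def fun_eq_iff abs_mult_pos' right_diff_distrib)
    also have "ivl_integral (\<lambda>t. real q * w (x + t)) a b = real q * ivl_integral (\<lambda>t. w (x + t)) a b"
      by simp
    also have "\<dots> < \<kappa>" using x q by (simp add: B2_def field_simps)
    finally have main: "\<bar>birkhoff_sum \<alpha> u q (x + b) - birkhoff_sum \<alpha> u q (x + a) - \<bar>h\<bar> * (real q * I)\<bar> < \<kappa>" .
    have "birkhoff_sum \<alpha> u q (x + real q * \<alpha>) = birkhoff_sum \<alpha> u q (x + h)"
      using periodic_add_int[OF birkhoff_sum_periodic[OF u], of \<alpha> q "x + h" p] by (simp add: h_def)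
    with main show ?thesis
      by (cases "0 \<le> h") (auto simp: a_def b_def algebra_simps abs_minus_commute)
  qed
  ultimately show ?thesis using B1m B2(1) per unfolding I_def
    by (intro bexI[of _ "B1 \<union> B2"]) auto
qed

section \<open>Piecewise absolutely continuous functions\<close>

lemma arc_exists:
  fixes \<beta> :: "nat \<Rightarrow> real"
  shows "\<beta> 0 \<le> x \<Longrightarrow> x < \<beta> n \<Longrightarrow> \<exists>j<n. \<beta> j \<le> x \<and> x < \<beta> (Suc j)"
proof (induction n)
  case (Suc n)
  show ?case
  proof (cases "x < \<beta> n")
    case True
    then show ?thesis using Suc by (auto intro: less_SucI)
  next
    case False
    then show ?thesis using Suc by (intro exI[of _ n]) auto
  qed
qed simp

text \<open>The densities of the arcs, added and made periodic, give \<open>G\<close>. Its integral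
  is the sum over the arcs of the limit at the right end minus the limit at the left end, and this
  is a cyclic rearrangement of the sum of jumps.\<close>

lemma piecewise_abs_continuous_density:
  fixes f :: "real \<Rightarrow> real"
  assumes pac: "piecewise_abs_continuous K \<beta> f"
  defines "u \<equiv> \<lambda>x. f (frac x)"
  shows "\<exists>G M. u \<in> borel_measurable borel \<and> (\<forall>x. \<bar>u x\<bar> \<le> M) \<and>
    G \<in> borel_measurable borel \<and> periodic G \<and> locally_integrable G \<and>
    (\<forall>a b. a \<le> b \<longrightarrow> (\<forall>z\<in>\<beta> ` {..<K}. \<forall>m::int. z + of_int m \<notin> {a..b}) \<longrightarrow> u b - u a = ivl_integral G a b) \<and>
    ivl_integral G 0 1 = sum_of_jumps K \<beta> f"
proof -
  have K: "0 < K" and \<beta>01: "\<beta> ` {..<K} \<subseteq> {0..<1}" and smono: "strict_mono_on {..<K} \<beta>"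
    and \<beta>K: "\<beta> K = \<beta> 0 + 1" and ac: "\<And>j. j < K \<Longrightarrow> abs_continuous_on {\<beta> j<..<\<beta> (Suc j)} u"
    using pac by (auto simp: piecewise_abs_continuous_def u_def)
  have per: "periodic u" unfolding u_def by simp
  have \<beta>step: "\<beta> j < \<beta> (Suc j)" if "j < K" for j
  proof (cases "Suc j < K")
    case True
    then show ?thesis using smono that by (auto simp: strict_mono_on_def)
  next
    case False
    then have "Suc j = K" using that by simp
    moreover have "\<beta> j < 1" "0 \<le> \<beta> 0" using \<beta>01 that K by (auto simp: image_subset_iff)
    ultimately show ?thesis using \<beta>K by simp
  qed
  have \<beta>le: "i \<le> j \<Longrightarrow> j \<le> K \<Longrightarrow> \<beta> i \<le> \<beta> j" for i j
  proof (induction j)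
    case (Suc j)
    then show ?case using \<beta>step[of j] by (cases "i = Suc j") (auto intro: order.trans)
  qed auto
  define L where "L j = Lim (at_right (\<beta> j)) u" for j
  \<comment> \<open>\<open>L\<close> and \<open>R\<close> are indexed by arcs: \<open>R j\<close>
    belongs to the break point \<open>\<beta> (Suc j)\<close>.\<close>
  define R where "R j = Lim (at_left (\<beta> (Suc j))) u" for j
  define arc_density where "arc_density j g \<longleftrightarrow> integrable lborel g \<and>
    (\<forall>x. x \<notin> {\<beta> j<..<\<beta> (Suc j)} \<longrightarrow> g x = 0) \<and>
    (\<forall>x y. \<beta> j < x \<longrightarrow> x \<le> y \<longrightarrow> y < \<beta> (Suc j) \<longrightarrow> u y - u x = ivl_integral g x y) \<and>
    (u \<longlongrightarrow> L j) (at_right (\<beta> j)) \<and> (u \<longlongrightarrow> R j) (at_left (\<beta> (Suc j))) \<and> R j - L j = (LINT t|lborel. g t)" for j g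
  have "\<forall>j\<in>{..<K}. \<exists>g. arc_density j g"
  proof
    fix j assume "j \<in> {..<K}"
    then have j: "j < K" by simp
    obtain g l r where g: "integrable lborel g" "\<forall>x. x \<notin> {\<beta> j<..<\<beta> (Suc j)} \<longrightarrow> g x = 0"
      "\<forall>x y. \<beta> j < x \<longrightarrow> x \<le> y \<longrightarrow> y < \<beta> (Suc j) \<longrightarrow> u y - u x = ivl_integral g x y"
      "(u \<longlongrightarrow> l) (at_right (\<beta> j))" "(u \<longlongrightarrow> r) (at_left (\<beta> (Suc j)))" "r - l = (LINT t|lborel. g t)"
      using abs_continuous_on_arc_density[OF \<beta>step[OF j] ac[OF j]] by blast
    have "L j = l" unfolding L_def by (rule tendsto_Lim[OF _ g(4)]) simp
    moreover have "R j = r" unfolding R_def by (rule tendsto_Lim[OF _ g(5)]) simp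
    ultimately show "\<exists>g. arc_density j g" using g unfolding arc_density_def by blast
  qed
  from bchoice[OF this] obtain g where "\<forall>j\<in>{..<K}. arc_density j (g j)" by blast
  then have g: "\<And>j. j < K \<Longrightarrow> integrable lborel (g j)"
      "\<And>j x. j < K \<Longrightarrow> x \<notin> {\<beta> j<..<\<beta> (Suc j)} \<Longrightarrow> g j x = 0"
      "\<And>j x y. j < K \<Longrightarrow> \<beta> j < x \<Longrightarrow> x \<le> y \<Longrightarrow> y < \<beta> (Suc j) \<Longrightarrow> u y - u x = ivl_integral (g j) x y"
    and L: "\<And>j. j < K \<Longrightarrow> (u \<longlongrightarrow> L j) (at_right (\<beta> j))"
    and R: "\<And>j. j < K \<Longrightarrow> (u \<longlongrightarrow> R j) (at_left (\<beta> (Suc j)))"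
    and RL: "\<And>j. j < K \<Longrightarrow> R j - L j = (LINT t|lborel. g j t)"
    unfolding arc_density_def by blast+
  have cover: "\<exists>j<K. \<beta> j \<le> x \<and> x < \<beta> (Suc j)" if "\<beta> 0 \<le> x" "x < \<beta> 0 + 1" for x
  proof (rule arc_exists[where \<beta> = \<beta> and n = K and x = x, OF that(1)])
    show "x < \<beta> K" unfolding \<beta>K by (rule that(2))
  qed
  have disj: "i = j" if "i < K" "j < K" "\<beta> i \<le> x" "x < \<beta> (Suc i)" "\<beta> j \<le> x" "x < \<beta> (Suc j)" for i j x
  proof (rule ccontr)
    assume "i \<noteq> j"
    then have "Suc i \<le> j \<or> Suc j \<le> i" by linarith
    then have "\<beta> (Suc i) \<le> \<beta> j \<or> \<beta> (Suc j) \<le> \<beta> i" 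
      using \<beta>le[of "Suc i" j] \<beta>le[of "Suc j" i] that(1,2) by auto
    with that show False by linarith
  qed
  define G0 where "G0 x = (\<Sum>j<K. g j x)" for x
  have G0: "integrable lborel G0" unfolding G0_def[abs_def] using g(1) by auto
  have G0_arc: "G0 x = g j x" if j: "j < K" "\<beta> j \<le> x" "x < \<beta> (Suc j)" for j x
  proof -
    have "g i x = 0" if "i < K" "i \<noteq> j" for i
      using g(2)[OF that(1), of x] disj[OF that(1) j(1), of x] that j by (cases "x \<in> {\<beta> i<..<\<beta> (Suc i)}") auto
    then show ?thesis unfolding G0_def using j by (subst sum.remove[of _ j]) (auto intro!: sum.neutral)
  qed
  have G0_out: "G0 x = 0" if "x \<notin> {\<beta> 0<..<\<beta> 0 + 1}" for x
  proof -
    have "g i x = 0" if i: "i < K" for i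
      using \<beta>le[of 0 i] \<beta>le[of "Suc i" K] \<beta>K \<open>x \<notin> _\<close> i by (intro g(2)) auto
    then show ?thesis by (simp add: G0_def)
  qed
  \<comment> \<open>The representative modulo 1 between \<open>\<beta> 0\<close> and
    \<open>\<beta> 0 + 1\<close>, where the arcs lie side by side; \<open>frac\<close> may cut the
    last arc in two.\<close>
  define base where "base x = \<beta> 0 + frac (x - \<beta> 0)" for x
  have base: "\<beta> 0 \<le> base x" "base x < \<beta> 0 + 1" "\<exists>m::int. base x = x - of_int m" for x
  proof -
    show "\<beta> 0 \<le> base x" "base x < \<beta> 0 + 1"
      using frac_ge_0[of "x - \<beta> 0"] frac_lt_1[of "x - \<beta> 0"] unfolding base_def by linarith+
    have "base x = x - of_int \<lfloor>x - \<beta> 0\<rfloor>" by (simp add: base_def frac_def)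
    then show "\<exists>m::int. base x = x - of_int m" by (rule exI)
  qed
  have base_id: "base x = x" if "\<beta> 0 \<le> x" "x < \<beta> 0 + 1" for x
  proof -
    have "frac (x - \<beta> 0) = x - \<beta> 0" using that by (simp add: frac_eq)
    then show ?thesis by (simp add: base_def)
  qed
  have base_meas [measurable]: "base \<in> borel_measurable borel" unfolding base_def[abs_def] by measurable
  have u_base: "u (base x) = u x" for x
  proof -
    obtain m :: int where "base x = x - of_int m" using base(3)[of x] by blast
    then show ?thesis by (simp only: periodic_diff_int[OF per])
  qed
  define G where "G x = G0 (base x)" for x
  have Gm: "G \<in> borel_measurable borel"
    unfolding G_def[abs_def] using borel_measurable_integrable[OF G0] by measurable
  have Gper: "periodic G"
  proof -
    have "base (x + 1) = base x" for x
      using frac_1_eq[of "x - \<beta> 0"] by (simp add: base_def algebra_simps)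
    then show ?thesis by (simp add: periodic_def G_def)
  qed
  have Gli: "locally_integrable G"
  proof -
    have "integrable lborel (\<lambda>y. G0 (\<beta> 0 + 1 * y))"
      using G0 by (subst lborel_integrable_real_affine_iff) auto
    then have "locally_integrable (\<lambda>x. G0 (\<beta> 0 + frac x))"
      using locally_integrable_comp_frac[of "\<lambda>y. G0 (\<beta> 0 + y)"] by simp
    from locally_integrable_shift[OF this, of "- \<beta> 0"] show ?thesis by (simp add: G_def[abs_def] base_def)
  qed
  have incr: "u b - u a = ivl_integral G a b"
    if ab: "a \<le> b" and Z: "\<forall>z\<in>\<beta> ` {..<K}. \<forall>m::int. z + of_int m \<notin> {a..b}" for a b
  proof -
    obtain m :: int where m: "base a = a - of_int m" using base(3) by blast
    define a' where "a' = a - of_int m"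
    define b' where "b' = b - of_int m"
    have Z': "z + of_int k \<notin> {a'..b'}" if "z \<in> \<beta> ` {..<K}" for z and k :: int
      using Z[rule_format, OF that, of "k + m"] by (auto simp: a'_def b'_def)
    obtain j where j: "j < K" "\<beta> j \<le> a'" "a' < \<beta> (Suc j)"
      using cover[OF base(1,2)[of a]] m by (auto simp: a'_def)
    have "\<beta> j \<noteq> a'" using Z'[of "\<beta> j" 0] j ab by (auto simp: a'_def b'_def)
    \<comment> \<open>For the last arc the right end \<open>\<beta> K\<close> is the translate of
      the break point \<open>\<beta> 0\<close> by 1.\<close>
    moreover have "b' < \<beta> (Suc j)"
    proof (cases "Suc j < K")
      case True
      then show ?thesis using Z'[of "\<beta> (Suc j)" 0] j by auto
    next
      case False
      then have "Suc j = K" using j by simp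
      then show ?thesis using Z'[of "\<beta> 0" 1] j K \<beta>K by auto
    qed
    ultimately have jb: "\<beta> j < a'" "b' < \<beta> (Suc j)" "a' \<le> b'" using j ab by (auto simp: a'_def b'_def)
    have "u b - u a = u b' - u a'" by (simp add: a'_def b'_def periodic_diff_int[OF per])
    also have "\<dots> = ivl_integral (g j) a' b'" using g(3)[OF j(1) jb(1,3,2)] .
    also have "\<dots> = ivl_integral G a' b'"
    proof (rule set_lebesgue_integral_cong)
      show "\<forall>x. x \<in> {a'<..b'} \<longrightarrow> g j x = G x"
      proof (intro allI impI)
        fix x assume x: "x \<in> {a'<..b'}"
        have "\<beta> 0 \<le> x" "x < \<beta> 0 + 1" using \<beta>le[of 0 j] \<beta>le[of "Suc j" K] j jb x \<beta>K by auto
        then show "g j x = G x" using G0_arc[OF j(1), of x] jb x by (simp add: G_def base_id)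
      qed
    qed simp
    also have "\<dots> = ivl_integral (\<lambda>x. G (x + of_int m)) a' b'" by (simp add: periodic_add_int[OF Gper])
    also have "\<dots> = ivl_integral G a b" unfolding ivl_integral_shift by (simp add: a'_def b'_def)
    finally show ?thesis .
  qed
  have Gint: "ivl_integral G 0 1 = sum_of_jumps K \<beta> f"
  proof -
    have "ivl_integral G 0 1 = ivl_integral G (\<beta> 0) (\<beta> 0 + 1)" by (rule ivl_integral_period[OF Gper Gli, symmetric])
    also have "\<dots> = (LINT x|lborel. G0 x)"
      unfolding set_lebesgue_integral_def
    proof (intro Bochner_Integration.integral_cong refl)
      fix x
      show "indicator {\<beta> 0<..\<beta> 0 + 1} x *\<^sub>R G x = G0 x"
      proof (cases "x \<in> {\<beta> 0<..<\<beta> 0 + 1}")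
        case True then show ?thesis by (simp add: G_def base_id)
      next
        case False
        have "G (\<beta> 0 + 1) = 0" using Gper G0_out[of "\<beta> 0"] by (simp add: periodic_def G_def base_id)
        then show ?thesis using False G0_out[OF False] by (cases "x = \<beta> 0 + 1") (auto simp: indicator_def)
      qed
    qed
    also have "\<dots> = (\<Sum>j<K. R j - L j)"
      unfolding G0_def using g(1) RL by (subst Bochner_Integration.integral_sum) auto
    also have "\<dots> = sum_of_jumps K \<beta> f"
    proof -
      have LL: "Lim (at_right (\<beta> j)) u = L j" if "j < K" for j
        by (simp add: L_def)
      obtain n where n: "K = Suc n" using K by (cases K) auto
      \<comment> \<open>The last arc ends where the first one begins: by periodicity the left limit
        at \<open>\<beta> 0\<close> is the one at \<open>\<beta> 0 + 1\<close>.\<close>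
      have "(u \<longlongrightarrow> R n) (at_left (\<beta> 0 + 1))" using R[of n] \<beta>K n by simp
      moreover have "at_left (\<beta> 0 + 1) = filtermap (\<lambda>x. x + 1) (at_left (\<beta> 0))"
        using filtermap_at_left_shift[of "-1" "\<beta> 0"] by simp
      ultimately have "((\<lambda>x. u (x + 1)) \<longlongrightarrow> R n) (at_left (\<beta> 0))"
        by (simp only: filterlim_filtermap)
      then have R0: "Lim (at_left (\<beta> 0)) u = R n"
        using per by (intro tendsto_Lim) (simp_all add: periodic_def)
      have "sum_of_jumps K \<beta> f = (\<Sum>j<K. Lim (at_left (\<beta> j)) u) - (\<Sum>j<K. L j)"
        unfolding sum_of_jumps_def u_def[symmetric] sum_subtractf[symmetric] using LL by (intro sum.cong) auto
      also have "(\<Sum>j<K. Lim (at_left (\<beta> j)) u) = (\<Sum>j<K. R j)"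
      proof -
        have "(\<Sum>j<Suc n. Lim (at_left (\<beta> j)) u) = R n + (\<Sum>j<n. R j)"
          unfolding sum.lessThan_Suc_shift comp_def R0 by (simp only: R_def)
        then show ?thesis unfolding n by simp
      qed
      finally show ?thesis by (simp add: sum_subtractf)
    qed
    finally show ?thesis .
  qed
  have um: "u \<in> borel_measurable borel"
  proof -
    \<comment> \<open>Continuity on the open arcs makes the first summands measurable; the finitely
      many break points are put in by hand.\<close>
    define v where "v y = (\<Sum>j<K. indicator {\<beta> j<..<\<beta> (Suc j)} y *\<^sub>R u y + indicator {\<beta> j} y *\<^sub>R u (\<beta> j))" for y
    have cont: "continuous_on {\<beta> j<..<\<beta> (Suc j)} u" if j: "j < K" for j
      unfolding continuous_on_iff
    proof (intro ballI allI impI)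
      fix x e :: real assume x: "x \<in> {\<beta> j<..<\<beta> (Suc j)}" and e: "0 < e"
      obtain d where d: "d > 0" "\<forall>x y. x \<le> y \<longrightarrow> {x..y} \<subseteq> {\<beta> j<..<\<beta> (Suc j)} \<longrightarrow> y - x < d \<longrightarrow> \<bar>u y - u x\<bar> < e"
        using abs_continuous_on_increment[OF ac[OF j] e] by blast
      have "dist (u y) (u x) < e" if y: "y \<in> {\<beta> j<..<\<beta> (Suc j)}" "dist y x < d" for y
      proof (cases "x \<le> y")
        case True
        have "{x..y} \<subseteq> {\<beta> j<..<\<beta> (Suc j)}" using x y by (intro subsetI) simp
        moreover have "y - x < d" using y(2) unfolding dist_real_def by linarith
        ultimately show ?thesis using d(2) True unfolding dist_real_def by blast
      next
        case False
        then have "y \<le> x" by simp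
        moreover have "{y..x} \<subseteq> {\<beta> j<..<\<beta> (Suc j)}" using x y by (intro subsetI) simp
        moreover have "x - y < d" using y(2) unfolding dist_real_def by linarith
        ultimately show ?thesis using d(2) unfolding dist_commute[of "u y"] unfolding dist_real_def by blast
      qed
      with d(1) show "\<exists>d>0. \<forall>x'\<in>{\<beta> j<..<\<beta> (Suc j)}. dist x' x < d \<longrightarrow> dist (u x') (u x) < e" by blast
    qed
    have "v \<in> borel_measurable borel"
      unfolding v_def[abs_def]
      by (intro borel_measurable_sum borel_measurable_add borel_measurable_continuous_on_indicator cont
          borel_measurable_scaleR borel_measurable_indicator borel_measurable_const) auto
    then have "(\<lambda>x. v (base x)) \<in> borel_measurable borel" by measurable
    also have "(\<lambda>x. v (base x)) = u"
    proof
      fix x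
      obtain j where j: "j < K" "\<beta> j \<le> base x" "base x < \<beta> (Suc j)"
        using cover[OF base(1,2)] by blast
      have "indicator {\<beta> i<..<\<beta> (Suc i)} (base x) *\<^sub>R u (base x) + indicator {\<beta> i} (base x) *\<^sub>R u (\<beta> i) = 0"
        if "i < K" "i \<noteq> j" for i
        using disj[of i j "base x"] that j \<beta>step[of i] by (auto simp: indicator_def)
      then have "v (base x) = indicator {\<beta> j<..<\<beta> (Suc j)} (base x) *\<^sub>R u (base x) + indicator {\<beta> j} (base x) *\<^sub>R u (\<beta> j)"
        unfolding v_def using j by (subst sum.remove[of _ j]) (auto intro!: sum.neutral)
      also have "\<dots> = u (base x)" using j by (cases "base x = \<beta> j") auto
      finally show "v (base x) = u x" by (simp add: u_base)
    qed
    finally show ?thesis .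
  qed
  have ub: "\<exists>M. \<forall>x. \<bar>u x\<bar> \<le> M"
  proof -
    define mid where "mid j = (\<beta> j + \<beta> (Suc j)) / 2" for j
    \<comment> \<open>Inside an arc \<open>u\<close> differs from its value at the midpoint by at
      most the L1 norm of the density. The break point is counted separately, as the value there is
      arbitrary.\<close>
    define B where "B j = \<bar>u (\<beta> j)\<bar> + \<bar>u (mid j)\<bar> + (LINT t|lborel. \<bar>g j t\<bar>)" for j
    have B0: "0 \<le> B j" for j by (simp add: B_def)
    have gI: "\<bar>ivl_integral (g j) s t\<bar> \<le> (LINT t|lborel. \<bar>g j t\<bar>)" if "j < K" for j s t
    proof -
      have "\<bar>ivl_integral (g j) s t\<bar> \<le> ivl_integral (\<lambda>x. \<bar>g j x\<bar>) s t"
        by (rule ivl_integral_abs[OF integrable_imp_locally_integrable[OF g(1)[OF that]]])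
      also have "\<dots> \<le> (LINT t|lborel. \<bar>g j t\<bar>)"
        unfolding set_lebesgue_integral_def
      proof (rule integral_mono)
        show i: "integrable lborel (\<lambda>t. \<bar>g j t\<bar>)" by (rule integrable_abs[OF g(1)[OF that]])
        show "integrable lborel (\<lambda>x. indicator {s<..t} x *\<^sub>R \<bar>g j x\<bar>)"
          by (rule integrable_mult_indicator[OF _ i]) simp
      qed (simp add: indicator_def)
      finally show ?thesis .
    qed
    have "\<bar>u x\<bar> \<le> (\<Sum>j<K. B j)" for x
    proof -
      obtain j where j: "j < K" "\<beta> j \<le> base x" "base x < \<beta> (Suc j)"
        using cover[OF base(1,2)] by blast
      have mid: "\<beta> j < mid j" "mid j < \<beta> (Suc j)" using \<beta>step[OF j(1)] by (auto simp: mid_def)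
      have "\<bar>u (base x)\<bar> \<le> B j"
      proof (cases "base x = \<beta> j")
        case True
        then show ?thesis by (simp add: B_def)
      next
        case False
        then have x: "\<beta> j < base x" using j by simp
        have "\<bar>u (base x) - u (mid j)\<bar> \<le> (LINT t|lborel. \<bar>g j t\<bar>)"
        proof (cases "base x \<le> mid j")
          case True
          then show ?thesis using g(3)[OF j(1) x True mid(2)] gI[OF j(1), of "base x" "mid j"] by (simp add: abs_minus_commute)
        next
          case False
          then show ?thesis using g(3)[OF j(1) mid(1) _ j(3)] gI[OF j(1), of "mid j" "base x"] by simp
        qed
        then show ?thesis unfolding B_def by linarith
      qed
      also have "B j \<le> (\<Sum>j<K. B j)" using j B0 by (intro member_le_sum) auto
      finally show ?thesis by (simp add: u_base)
    qed
    then show ?thesis by blast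
  qed
  show ?thesis using um ub Gm Gper Gli incr Gint by blast
qed

section \<open>The special flow in suspension coordinates\<close>

text \<open>On the lift to the line the rotation is the translation by \<alpha>, so the cocycle
  identity involves no fractional parts; integer translates are handled separately by
  \<open>cocycle_periodic\<close>.\<close>

definition cocycle :: "real \<Rightarrow> (real \<Rightarrow> real) \<Rightarrow> int \<Rightarrow> real \<Rightarrow> real" where
  "cocycle \<alpha> u k x = (if 0 \<le> k then \<Sum>i\<in>{0..<k}. u (x + of_int i * \<alpha>)
      else - (\<Sum>i\<in>{k..<0}. u (x + of_int i * \<alpha>)))"

lemma cocycle_0 [simp]: "cocycle \<alpha> u 0 x = 0"
  by (simp add: cocycle_def)

lemma cocycle_step: "cocycle \<alpha> u (k + 1) x = cocycle \<alpha> u k x + u (x + of_int k * \<alpha>)"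
proof (cases "0 \<le> k")
  case True
  then have "{0..<k + 1} = insert k {0..<k}" by auto
  then show ?thesis using True by (simp add: cocycle_def)
next
  case False
  then have "{k..<0} = insert k {k + 1..<0}" by auto
  then show ?thesis using False by (simp add: cocycle_def)
qed

lemma cocycle_add: "cocycle \<alpha> u (k + l) x = cocycle \<alpha> u k x + cocycle \<alpha> u l (x + of_int k * \<alpha>)"
proof (induction l rule: int_induct[where k = 0])
  case (step1 l)
  have "cocycle \<alpha> u (k + (l + 1)) x = cocycle \<alpha> u (k + l) x + u (x + of_int (k + l) * \<alpha>)"
    using cocycle_step[of \<alpha> u "k + l" x] by (simp add: add.assoc)
  also have "x + of_int (k + l) * \<alpha> = x + of_int k * \<alpha> + of_int l * \<alpha>" by (simp add: algebra_simps)
  finally show ?case using step1 by (simp add: cocycle_step)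
next
  case (step2 l)
  have "cocycle \<alpha> u (k + l) x = cocycle \<alpha> u (k + (l - 1)) x + u (x + of_int (k + (l - 1)) * \<alpha>)"
    using cocycle_step[of \<alpha> u "k + (l - 1)" x] by simp
  moreover have "cocycle \<alpha> u l (x + of_int k * \<alpha>) =
      cocycle \<alpha> u (l - 1) (x + of_int k * \<alpha>) + u (x + of_int k * \<alpha> + of_int (l - 1) * \<alpha>)"
    using cocycle_step[of \<alpha> u "l - 1" "x + of_int k * \<alpha>"] by simp
  moreover have "x + of_int (k + (l - 1)) * \<alpha> = x + of_int k * \<alpha> + of_int (l - 1) * \<alpha>"
    by (simp add: algebra_simps)
  ultimately show ?case using step2 by (simp only:)
qed simp

lemma cocycle_of_nat: "cocycle \<alpha> u (int n) x = birkhoff_sum \<alpha> u n x"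
  by (induction n) (simp_all add: birkhoff_sum_def cocycle_step add.commute[of 1])

lemma cocycle_minus: "cocycle \<alpha> u (- k) x = - cocycle \<alpha> u k (x - of_int k * \<alpha>)"
  using cocycle_add[of \<alpha> u "-k" k x] by simp

lemma cocycle_periodic: "periodic u \<Longrightarrow> cocycle \<alpha> u k (x + of_int m) = cocycle \<alpha> u k x"
proof -
  assume u: "periodic u"
  have "u (x + of_int m + of_int i * \<alpha>) = u (x + of_int i * \<alpha>)" for i
    using periodic_add_int[OF u, of "x + of_int i * \<alpha>" m] by (simp add: algebra_simps)
  then show ?thesis by (simp add: cocycle_def)
qed

lemma frac_add_frac: "frac (frac x + y) = frac (x + y)"
  using frac_add_simps(1)[of x y] by simp

text \<open>\<open>inv_into\<close> inverts the rotation only on \<open>{0..<1}\<close>, so the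
  induction for negative \<open>k\<close> keeps every iterate in the form of a fractional
  part.\<close>

lemma int_iterate_rotation:
  assumes x: "x \<in> {0..<1}"
  shows "int_iterate {0..<1} (rotation \<alpha>) k x = frac (x + of_int k * \<alpha>)"
proof -
  have fx: "frac x = x" using x by (simp add: frac_eq)
  have bij: "inj_on (rotation \<alpha>) {0..<1}"
  proof (rule inj_onI)
    fix y z assume yz: "y \<in> {0..<1}" "z \<in> {0..<1}" "rotation \<alpha> y = rotation \<alpha> z"
    have "frac (frac (y + \<alpha>) + - \<alpha>) = frac (frac (z + \<alpha>) + - \<alpha>)" using yz(3) by (simp add: rotation_def)
    then have "frac y = frac z" unfolding frac_add_frac by simp
    then show "y = z" using yz by (simp add: frac_eq[THEN iffD2])
  qed
  have inv: "inv_into {0..<1} (rotation \<alpha>) y = frac (y - \<alpha>)" if y: "y \<in> {0..<1}" for y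
  proof -
    have "rotation \<alpha> (frac (y - \<alpha>)) = y"
      unfolding rotation_def frac_add_frac using y by (simp add: frac_eq)
    moreover have "frac (y - \<alpha>) \<in> {0..<1}" using frac_ge_0 frac_lt_1 by simp
    ultimately show ?thesis using inv_into_f_f[OF bij] by metis
  qed
  have fr01: "frac y \<in> {0..<1}" for y :: real using frac_ge_0[of y] frac_lt_1[of y] by simp
  show ?thesis
  proof (cases "0 \<le> k")
    case True
    have "(rotation \<alpha> ^^ n) x = frac (x + real n * \<alpha>)" for n
      by (induction n) (simp_all add: fx rotation_def frac_add_frac algebra_simps)
    then show ?thesis using True by (simp add: int_iterate_def)
  next
    case False
    have "(inv_into {0..<1} (rotation \<alpha>) ^^ n) x = frac (x - real n * \<alpha>)" for n
    proof (induction n)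
      case (Suc n)
      then have "(inv_into {0..<1} (rotation \<alpha>) ^^ Suc n) x = frac (frac (x - real n * \<alpha>) + - \<alpha>)"
        using inv[OF fr01] by simp
      then show ?case unfolding frac_add_frac by (simp add: algebra_simps)
    qed (simp add: fx)
    then show ?thesis using False by (simp add: int_iterate_def)
  qed
qed

lemma birkhoff_cocycle_rotation:
  assumes "x \<in> {0..<1}"
  shows "birkhoff_cocycle {0..<1} (rotation \<alpha>) f k x = cocycle \<alpha> (\<lambda>x. f (frac x)) k x"
  unfolding birkhoff_cocycle_def cocycle_def int_iterate_rotation[OF assms] ..

context
  fixes \<alpha> :: real and f :: "real \<Rightarrow> real"
  assumes irr: "\<alpha> \<notin> \<rat>" and f_pos: "\<forall>x\<in>{0..<1}. 0 < f x"
    and unbounded: "\<And>B. \<exists>n. \<forall>x. B < birkhoff_sum \<alpha> (\<lambda>x. f (frac x)) n x"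
    and f_meas: "(\<lambda>x. f (frac x)) \<in> borel_measurable borel"
begin

abbreviation "coc \<equiv> cocycle \<alpha> (\<lambda>x. f (frac x))"

lemma lift_pos: "0 < f (frac x)"
  using f_pos frac_ge_0[of x] frac_lt_1[of x] by simp

lemma coc_strict_mono: "k < l \<Longrightarrow> coc k x < coc l x"
proof (induction l rule: int_gr_induct)
  case base
  then show ?case by (simp add: cocycle_step lift_pos)
next
  case (step l)
  then show ?case using lift_pos[of "x + of_int l * \<alpha>"] by (simp add: cocycle_step)
qed

lemma coc_mono: "k \<le> l \<Longrightarrow> coc k x \<le> coc l x"
  using coc_strict_mono[of k l x] by (cases "k = l") auto

lemma coc_unbounded: "\<exists>n::nat. \<forall>x. B < coc (int n) x \<and> coc (- int n) x < - B"
proof -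
  obtain n where "\<forall>x. B < birkhoff_sum \<alpha> (\<lambda>x. f (frac x)) n x" using unbounded by blast
  then show ?thesis by (intro exI[of _ n]) (auto simp: cocycle_minus cocycle_of_nat)
qed

text \<open>A strictly positive \<open>f\<close> may have infimum 0, so existence does not come from
  a lower bound of \<open>f\<close>. The assumption \<open>unbounded\<close> confines the candidates
  to a finite set, and the largest one is taken.\<close>

lemma level_ex1: "\<exists>!n. coc n x \<le> s \<and> s < coc (n + 1) x"
proof -
  obtain N :: nat where N: "\<bar>s\<bar> < coc (int N) x" "coc (- int N) x < - \<bar>s\<bar>" using coc_unbounded by blast
  define A where "A = {n\<in>{- int N..int N}. coc n x \<le> s}"
  have A: "finite A" "- int N \<in> A"
    unfolding A_def using N by (auto intro: finite_subset[of _ "{- int N..int N}"])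
  define n where "n = Max A"
  have n: "n \<in> A" unfolding n_def using A by (intro Max_in) auto
  have "s < coc (n + 1) x"
  proof (rule ccontr)
    assume "\<not> s < coc (n + 1) x"
    moreover have "n \<noteq> int N" using n N by (auto simp: A_def)
    ultimately have "n + 1 \<in> A" using n by (auto simp: A_def)
    then show False using Max_ge[OF A(1), of "n + 1"] by (simp add: n_def)
  qed
  then show ?thesis
  proof (intro ex1I[of _ n])
    fix m assume m: "coc m x \<le> s \<and> s < coc (m + 1) x"
    show "m = n"
    proof (rule ccontr)
      assume "m \<noteq> n"
      then have "m + 1 \<le> n \<or> n + 1 \<le> m" by linarith
      then show False
        using m n \<open>s < coc (n + 1) x\<close> coc_mono[of "m + 1" n x] coc_mono[of "n + 1" m x] by (auto simp: A_def)
    qed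
  qed (use n in \<open>auto simp: A_def\<close>)
qed

definition level :: "real \<Rightarrow> real \<Rightarrow> int" where
  "level x s = (THE n. coc n x \<le> s \<and> s < coc (n + 1) x)"

lemma level: "coc (level x s) x \<le> s" "s < coc (level x s + 1) x"
  using theI'[OF level_ex1[of x s]] by (auto simp: level_def)

lemma level_eq: "coc n x \<le> s \<Longrightarrow> s < coc (n + 1) x \<Longrightarrow> level x s = n"
  using level_ex1[of x s] level(1)[of x s] level(2)[of s x] by blast

text \<open>The point reached from \<open>(frac x, 0)\<close> after time \<open>s\<close>. This maps
  the plane onto the phase space and identifies \<open>(x, s)\<close> with \<open>(x + 1, s)\<close>
  and with \<open>(x + \<alpha>, s - f (frac x))\<close>; in these coordinates the flow is vertical
  translation.\<close>

definition suspend :: "real \<Rightarrow> real \<Rightarrow> real \<times> real" where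
  "suspend x s = (frac (x + of_int (level x s) * \<alpha>), s - coc (level x s) x)"

lemma flow_eq_suspend:
  assumes "x \<in> {0..<1}"
  shows "special_flow {0..<1} (rotation \<alpha>) f t (x, r) = suspend x (r + t)"
  unfolding special_flow_def suspend_def level_def
  by (simp add: Let_def birkhoff_cocycle_rotation[OF assms] int_iterate_rotation[OF assms])

lemma suspend_add_int: "suspend (x + of_int m) s = suspend x s"
proof -
  have c: "coc k (x + of_int m) = coc k x" for k by (rule cocycle_periodic) simp
  have "level (x + of_int m) s = level x s" by (simp add: level_def c)
  moreover have "frac (x + of_int m + y) = frac (x + y)" for y
    unfolding frac_def by (simp add: add.assoc add.commute[of _ y] flip: add.assoc)
  ultimately show ?thesis by (simp add: suspend_def c)
qed

text \<open>Starting \<open>k\<close> returns later on the same orbit lowers the level by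
  \<open>k\<close>, and the cocycle identity accounts for the time already spent.\<close>

lemma suspend_rotate: "suspend (x + of_int k * \<alpha>) (s - coc k x) = suspend x s"
proof -
  have c: "coc l (x + of_int k * \<alpha>) = coc (k + l) x - coc k x" for l
    using cocycle_add[of \<alpha> "\<lambda>x. f (frac x)" k l x] by simp
  have "level (x + of_int k * \<alpha>) (s - coc k x) = level x s - k"
  proof (rule level_eq)
    show "coc (level x s - k) (x + of_int k * \<alpha>) \<le> s - coc k x"
      unfolding c using level(1)[of x s] by simp
    have "k + (level x s - k + 1) = level x s + 1" by simp
    then show "s - coc k x < coc (level x s - k + 1) (x + of_int k * \<alpha>)"
      unfolding c using level(2)[of s x] by simp
  qed
  moreover have "x + of_int k * \<alpha> + of_int (level x s - k) * \<alpha> = x + of_int (level x s) * \<alpha>"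
    by (simp add: algebra_simps)
  ultimately show ?thesis by (simp add: suspend_def c add.assoc)
qed

lemma suspend_fst: "fst (suspend x s) \<in> {0..<1}"
  using frac_ge_0 frac_lt_1 by (simp add: suspend_def)

lemma suspend_in: "suspend x s \<in> under_graph {0..<1} f"
  using level(1)[of x s] level(2)[of s x] suspend_fst[of x s]
  by (auto simp: suspend_def under_graph_def cocycle_step)

lemma coc_measurable [measurable]: "coc k \<in> borel_measurable borel"
proof -
  note [measurable] = f_meas
  have "(\<lambda>x. f (frac (x + c))) \<in> borel_measurable borel" for c
    using measurable_compose[OF _ f_meas, of "\<lambda>x. x + c" borel] by simp
  then show ?thesis unfolding cocycle_def[abs_def] by simp
qed

text \<open>\<open>level\<close> takes countably many values and each of its level sets is cut out
  by two measurable inequalities, so the map is pieced together from countably many measurable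
  ones.\<close>

lemma suspend_measurable [measurable]: "(\<lambda>(x, s). suspend x s) \<in> borel \<Otimes>\<^sub>M borel \<rightarrow>\<^sub>M borel \<Otimes>\<^sub>M borel"
proof -
  have "(\<lambda>z. (frac (fst z + of_int (level (fst z) (snd z)) * \<alpha>), snd z - coc (level (fst z) (snd z)) (fst z)))
      \<in> borel \<Otimes>\<^sub>M borel \<rightarrow>\<^sub>M borel \<Otimes>\<^sub>M borel"
  proof (rule measurable_compose_countable[where g = "\<lambda>z. level (fst z) (snd z)"
        and f = "\<lambda>n z. (frac (fst z + of_int n * \<alpha>), snd z - coc n (fst z))"])
    show "(\<lambda>z. level (fst z) (snd z)) \<in> borel \<Otimes>\<^sub>M borel \<rightarrow>\<^sub>M count_space UNIV"
    proof (rule measurable_count_space_eq2_countable[THEN iffD2], intro conjI ballI)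
      fix n :: int
      have "(\<lambda>z. level (fst z) (snd z)) -` {n} \<inter> space (borel \<Otimes>\<^sub>M borel) =
          {z \<in> space (borel \<Otimes>\<^sub>M borel). coc n (fst z) \<le> snd z \<and> snd z < coc (n + 1) (fst z)}"
        using level level_eq by fastforce
      also have "\<dots> \<in> sets (borel \<Otimes>\<^sub>M borel)" by measurable
      finally show "(\<lambda>z. level (fst z) (snd z)) -` {n} \<inter> space (borel \<Otimes>\<^sub>M borel) \<in> sets (borel \<Otimes>\<^sub>M borel)" .
    qed simp_all
  qed measurable
  then show ?thesis by (simp add: suspend_def split_beta)
qed

text \<open>On a bounded range of times two points of an orbit can be close only if they lie on the same
  vertical segment, because \<open>\<parallel>j \<alpha>\<parallel>\<close> is bounded away from zero for bounded \<open>j \<noteq> 0\<close>.\<close>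

lemma suspend_separation:
  "\<exists>\<kappa>>0. \<forall>x s s'. \<bar>s\<bar> \<le> B \<longrightarrow> \<bar>s'\<bar> \<le> B \<longrightarrow> \<bar>fst (suspend x s) - fst (suspend x s')\<bar> < \<kappa>
    \<longrightarrow> snd (suspend x s) - snd (suspend x s') = s - s'"
proof -
  obtain N :: nat where N: "\<And>x. B < coc (int N) x" "\<And>x. coc (- int N) x < - B" using coc_unbounded by blast
  have lev: "level x s \<in> {- int N..int N}" if "\<bar>s\<bar> \<le> B" for x s
  proof -
    have "level x s \<le> int N"
    proof (rule ccontr)
      assume "\<not> level x s \<le> int N"
      then have "coc (int N) x \<le> coc (level x s) x" by (intro coc_mono) simp
      then show False using N(1)[of x] level(1)[of x s] level(2)[of s x] that by linarith
    qed
    moreover have "- int N \<le> level x s"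
    proof (rule ccontr)
      assume "\<not> - int N \<le> level x s"
      then have "coc (level x s + 1) x \<le> coc (- int N) x" by (intro coc_mono) simp
      then show False using N(2)[of x] level(1)[of x s] level(2)[of s x] that by linarith
    qed
    ultimately show ?thesis by simp
  qed
  define J where "J = {- 2 * int N..2 * int N} - {0}"
  define d where "d j = min (frac (of_int j * \<alpha>)) (1 - frac (of_int j * \<alpha>))" for j :: int
  have dpos: "0 < d j" if "j \<noteq> 0" for j
  proof -
    have "of_int j * \<alpha> \<notin> \<int>"
    proof
      assume "of_int j * \<alpha> \<in> \<int>"
      then have "of_int j * \<alpha> / of_int j \<in> \<rat>" using Ints_subset_Rats by (intro Rats_divide) auto
      then show False using irr that by simp
    qed
    then show ?thesis using frac_lt_1[of "of_int j * \<alpha>"] by (simp add: d_def frac_gt_0_iff)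
  qed
  have dle: "d j \<le> \<bar>of_int j * \<alpha> - of_int m\<bar>" for j m
  proof (cases "m \<le> \<lfloor>of_int j * \<alpha>\<rfloor>")
    case True
    then have "of_int m \<le> (of_int \<lfloor>of_int j * \<alpha>\<rfloor> :: real)" by simp
    then show ?thesis unfolding d_def frac_def by linarith
  next
    case False
    then have "(of_int \<lfloor>of_int j * \<alpha>\<rfloor> + 1 :: real) \<le> of_int m" by linarith
    then show ?thesis unfolding d_def frac_def by linarith
  qed
  \<comment> \<open>The 1 keeps the set nonempty when \<open>J\<close> is empty.\<close>
  define \<kappa> where "\<kappa> = Min (insert 1 (d ` J))"
  have "0 < \<kappa>" unfolding \<kappa>_def using dpos by (subst Min_gr_iff) (auto simp: J_def)
  moreover have "snd (suspend x s) - snd (suspend x s') = s - s'"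
    if "\<bar>s\<bar> \<le> B" "\<bar>s'\<bar> \<le> B" "\<bar>fst (suspend x s) - fst (suspend x s')\<bar> < \<kappa>" for x s s'
  proof -
    let ?j = "level x s - level x s'"
    define m where "m = \<lfloor>x + of_int (level x s) * \<alpha>\<rfloor> - \<lfloor>x + of_int (level x s') * \<alpha>\<rfloor>"
    have "fst (suspend x s) - fst (suspend x s') = of_int ?j * \<alpha> - of_int m"
      by (simp add: suspend_def frac_def m_def algebra_simps)
    then have lt: "d ?j < \<kappa>" using that(3) dle[of ?j m] by simp
    have "?j = 0"
    proof (rule ccontr)
      assume "?j \<noteq> 0"
      then have "?j \<in> J" using lev[OF that(1), of x] lev[OF that(2), of x] by (auto simp: J_def)
      then have "\<kappa> \<le> d ?j" unfolding \<kappa>_def by (intro Min_le) (auto simp: J_def)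
      then show False using lt by simp
    qed
    then show ?thesis by (simp add: suspend_def)
  qed
  ultimately show ?thesis by blast
qed

end

section \<open>Measure-theoretic preliminaries\<close>

lemma lborel_pair_eq: "(lborel :: (real \<times> real) measure) = lborel \<Otimes>\<^sub>M lborel"
  by (rule lborel_prod[symmetric])

lemma sets_lborel_pair: "sets (lborel \<Otimes>\<^sub>M lborel) = sets (borel :: (real \<times> real) measure)"
  by (simp only: lborel_prod sets_lborel)

text \<open>By Fubini, since vertical fibres are merely translated and then permuted by a shift.
  Returns of the flow appear in planar coordinates as such shears, with horizontal shift
  \<open>s\<close> and height change \<open>e\<close>, so exceptional sets can be pulled back
  without loss.\<close>

lemma shear_emeasure:
  fixes e :: "real \<Rightarrow> real" and A :: "(real \<times> real) set"
  assumes [measurable]: "e \<in> borel_measurable borel" and A: "A \<in> sets borel"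
  shows "(\<lambda>(x, r). (x + s, r + e x)) -` A \<in> sets borel"
    and "emeasure lborel ((\<lambda>(x, r). (x + s, r + e x)) -` A) = emeasure lborel A"
proof -
  let ?V = "\<lambda>(x, r). (x + s, r + e x)"
  have V: "?V \<in> borel \<rightarrow>\<^sub>M (borel :: (real \<times> real) measure)"
    unfolding borel_prod[symmetric] by measurable
  from measurable_sets[OF V A] show m: "?V -` A \<in> sets borel" by simp
  have A': "A \<in> sets (lborel \<Otimes>\<^sub>M lborel)" "?V -` A \<in> sets (lborel \<Otimes>\<^sub>M lborel)"
    using A m by (simp_all only: sets_lborel_pair)
  have shift: "emeasure lborel ((\<lambda>r. r + c) -` B) = emeasure lborel B" if "B \<in> sets borel" for B and c :: real
  proof -
    have "emeasure (distr lborel borel ((+) c)) B = emeasure lborel ((+) c -` B \<inter> space lborel)"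
      by (rule emeasure_distr) (use that in auto)
    then show ?thesis by (simp add: lborel_distr_plus add.commute[of c] fun_eq_iff[symmetric] vimage_def)
  qed
  have "emeasure lborel (?V -` A) = (\<integral>\<^sup>+x. emeasure lborel (Pair x -` (?V -` A)) \<partial>lborel)"
    unfolding lborel_pair_eq by (rule lborel.emeasure_pair_measure_alt[OF A'(2)])
  also have "\<dots> = (\<integral>\<^sup>+x. emeasure lborel (Pair (s + 1 * x) -` A) \<partial>lborel)"
  proof (rule nn_integral_cong)
    fix x :: real
    have "Pair x -` (?V -` A) = (\<lambda>r. r + e x) -` (Pair (s + 1 * x) -` A)" by (auto simp: add.commute)
    moreover have "Pair (s + 1 * x) -` A \<in> sets borel"
      using sets_Pair1[OF A'(1), of "s + 1 * x"] by simp
    ultimately show "emeasure lborel (Pair x -` (?V -` A)) = emeasure lborel (Pair (s + 1 * x) -` A)"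
      by (simp only: shift)
  qed
  also have "\<dots> = (\<integral>\<^sup>+x. emeasure lborel (Pair x -` A) \<partial>lborel)"
  proof -
    have "(\<lambda>x. emeasure lborel (Pair x -` A)) \<in> borel_measurable borel"
      using lborel.measurable_emeasure_Pair[OF A'(1)] by simp
    from nn_integral_real_affine[OF this, of 1 s] show ?thesis by simp
  qed
  also have "\<dots> = emeasure lborel A"
    unfolding lborel_pair_eq by (rule lborel.emeasure_pair_measure_alt[OF A'(1), symmetric])
  finally show "emeasure lborel (?V -` A) = emeasure lborel A" .
qed

lemma borel_inner_compact:
  fixes A :: "(real \<times> real) set"
  assumes A: "A \<in> sets borel" "bounded A" and \<epsilon>: "0 < \<epsilon>"
  shows "\<exists>C. compact C \<and> C \<subseteq> A \<and> emeasure lborel (A - C) < ennreal \<epsilon>"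
proof -
  have "A \<in> sets lebesgue" using A by simp
  then obtain T where T: "closed T" "T \<subseteq> A" "emeasure lebesgue (A - T) < ennreal \<epsilon>"
    using sets_lebesgue_inner_closed[OF _ \<epsilon>] by metis
  have "compact T" using T A(2) by (auto simp: compact_eq_bounded_closed intro: bounded_subset)
  moreover have "emeasure lebesgue (A - T) = emeasure lborel (A - T)"
    using A T by simp
  ultimately show ?thesis using T by auto
qed

text \<open>A weak form of Lusin's theorem.\<close>

lemma almost_uniformly_continuous:
  fixes F :: "real \<times> real \<Rightarrow> real"
  assumes F: "F \<in> borel_measurable borel" "\<And>z. \<bar>F z\<bar> \<le> M" and Q: "Q \<in> sets borel" "bounded Q"
    and \<kappa>: "0 < \<kappa>" and \<epsilon>: "0 < \<epsilon>"
  shows "\<exists>C \<delta>. compact C \<and> C \<subseteq> Q \<and> emeasure lborel (Q - C) \<le> ennreal \<epsilon> \<and> 0 < \<delta> \<and>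
    (\<forall>z\<in>C. \<forall>z'\<in>C. dist z z' < \<delta> \<longrightarrow> \<bar>F z - F z'\<bar> < \<kappa>)"
proof -
  note [measurable] = F(1) Q(1)
  define I where "I = {\<lfloor>- M / \<kappa>\<rfloor>..\<lfloor>M / \<kappa>\<rfloor>}"
  \<comment> \<open>Slices of \<open>Q\<close> by the value of \<open>F\<close> up to
    \<open>\<kappa>\<close>. Compact sets inside distinct slices have positive distance, so close
    points of their union lie in one slice, where values differ by less than
    \<open>\<kappa>\<close>.\<close>
  define A where "A i = {z\<in>Q. \<lfloor>F z / \<kappa>\<rfloor> = i}" for i
  have I: "\<lfloor>F z / \<kappa>\<rfloor> \<in> I" for z
  proof -
    have "- M / \<kappa> \<le> F z / \<kappa>" "F z / \<kappa> \<le> M / \<kappa>"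
      using F(2)[of z] \<kappa> by (auto intro!: divide_right_mono simp del: minus_divide_left[symmetric])
    then show ?thesis unfolding I_def by (auto intro: floor_mono)
  qed
  have cardI: "0 < card I" using I[of 0] by (auto simp: card_gt_0_iff I_def)
  have A: "A i \<in> sets borel" "bounded (A i)" for i
  proof -
    have "{z. \<lfloor>F z / \<kappa>\<rfloor> = i} \<in> sets borel" by measurable
    moreover have "A i = Q \<inter> {z. \<lfloor>F z / \<kappa>\<rfloor> = i}" by (auto simp: A_def)
    ultimately show "A i \<in> sets borel" using Q(1) by simp
    show "bounded (A i)" by (rule bounded_subset[OF Q(2)]) (auto simp: A_def)
  qed
  have "\<forall>i. \<exists>C. compact C \<and> C \<subseteq> A i \<and> emeasure lborel (A i - C) < ennreal (\<epsilon> / card I)"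
    using borel_inner_compact[OF A] \<epsilon> cardI by simp
  then obtain C where C: "\<And>i. compact (C i)" "\<And>i. C i \<subseteq> A i" "\<And>i. emeasure lborel (A i - C i) < ennreal (\<epsilon> / card I)"
    by metis
  define D where "D = (\<Union>i\<in>I. C i)"
  have finI: "finite I" by (simp add: I_def)
  have "compact D" unfolding D_def using finI C by (intro compact_UN) auto
  moreover have "D \<subseteq> Q" using C(2) by (auto simp: D_def A_def)
  moreover have "emeasure lborel (Q - D) \<le> ennreal \<epsilon>"
  proof -
    have m: "A i - C i \<in> sets lborel" for i using A C(1)[of i] by (auto intro: borel_compact)
    have "Q - D \<subseteq> (\<Union>i\<in>I. A i - C i)" using I by (auto simp: D_def A_def)
    then have "emeasure lborel (Q - D) \<le> emeasure lborel (\<Union>i\<in>I. A i - C i)"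
      using m finI by (intro emeasure_mono sets.finite_UN) auto
    also have "\<dots> \<le> (\<Sum>i\<in>I. emeasure lborel (A i - C i))"
      using m finI by (intro emeasure_subadditive_finite) auto
    also have "\<dots> \<le> (\<Sum>i\<in>I. ennreal (\<epsilon> / card I))" using C(3) by (intro sum_mono) (simp add: less_imp_le)
    also have "\<dots> = ennreal (\<Sum>i\<in>I. \<epsilon> / card I)" using \<epsilon> by (subst sum_ennreal) auto
    also have "\<dots> = ennreal \<epsilon>" using cardI by simp
    finally show ?thesis .
  qed
  moreover have "\<exists>\<delta>>0. \<forall>z\<in>D. \<forall>z'\<in>D. dist z z' < \<delta> \<longrightarrow> \<bar>F z - F z'\<bar> < \<kappa>"
  proof -
    have sep: "\<exists>d>0. \<forall>z\<in>C i. \<forall>z'\<in>C j. d \<le> dist z z'" if "i \<noteq> j" for i j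
    proof (rule separate_compact_closed[OF C(1)])
      show "closed (C j)" using C(1) by (rule compact_imp_closed)
      have "A i \<inter> A j = {}" using that by (auto simp: A_def)
      then show "C i \<inter> C j = {}" using C(2)[of i] C(2)[of j] by blast
    qed
    define d where "d i j = (if i = j then 1 else SOME d. 0 < d \<and> (\<forall>z\<in>C i. \<forall>z'\<in>C j. d \<le> dist z z'))" for i j
    have d: "0 < d i j" "i \<noteq> j \<Longrightarrow> z \<in> C i \<Longrightarrow> z' \<in> C j \<Longrightarrow> d i j \<le> dist z z'" for i j z z'
    proof -
      have "0 < d i j \<and> (i \<noteq> j \<longrightarrow> (\<forall>z\<in>C i. \<forall>z'\<in>C j. d i j \<le> dist z z'))"
        using someI_ex[OF sep[of i j]] by (auto simp: d_def)
      then show "0 < d i j" "i \<noteq> j \<Longrightarrow> z \<in> C i \<Longrightarrow> z' \<in> C j \<Longrightarrow> d i j \<le> dist z z'" by blast+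
    qed
    define \<delta> where "\<delta> = Min (insert 1 ((\<lambda>(i, j). d i j) ` (I \<times> I)))"
    have "0 < \<delta>" unfolding \<delta>_def using finI d(1) by (subst Min_gr_iff) auto
    moreover have "\<bar>F z - F z'\<bar> < \<kappa>" if z: "z \<in> D" "z' \<in> D" "dist z z' < \<delta>" for z z'
    proof -
      obtain i j where ij: "i \<in> I" "j \<in> I" "z \<in> C i" "z' \<in> C j" using z by (auto simp: D_def)
      have "\<delta> \<le> d i j" unfolding \<delta>_def using finI ij by (intro Min_le) auto
      then have "i = j" using d(2)[of i j z z'] ij z by force
      then have "z \<in> A j" "z' \<in> A j" using ij C(2)[of j] by auto
      then have "\<lfloor>F z / \<kappa>\<rfloor> = \<lfloor>F z' / \<kappa>\<rfloor>" by (simp add: A_def)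
      then have "\<bar>F z / \<kappa> - F z' / \<kappa>\<bar> < 1" by linarith
      then show ?thesis using \<kappa> by (simp add: diff_divide_distrib[symmetric] abs_divide)
    qed
    ultimately show ?thesis by blast
  qed
  ultimately show ?thesis by blast
qed

lemma almost_uniformly_continuous_pair:
  fixes F :: "real \<times> real \<Rightarrow> real \<times> real"
  assumes F: "F \<in> borel \<rightarrow>\<^sub>M borel" "\<And>z. \<bar>fst (F z)\<bar> \<le> M" "\<And>z. \<bar>snd (F z)\<bar> \<le> M"
    and Q: "Q \<in> sets borel" "bounded Q" and \<kappa>: "0 < \<kappa>" and \<epsilon>: "0 < \<epsilon>"
  shows "\<exists>C \<delta>. C \<in> sets borel \<and> C \<subseteq> Q \<and> emeasure lborel (Q - C) \<le> ennreal \<epsilon> \<and> 0 < \<delta> \<and>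
    (\<forall>z\<in>C. \<forall>z'\<in>C. dist z z' < \<delta> \<longrightarrow> \<bar>fst (F z) - fst (F z')\<bar> < \<kappa> \<and> \<bar>snd (F z) - snd (F z')\<bar> < \<kappa>)"
proof -
  have m: "(\<lambda>z. fst (F z)) \<in> borel_measurable borel" "(\<lambda>z. snd (F z)) \<in> borel_measurable borel"
    using F(1) unfolding borel_prod[symmetric] by (auto intro: measurable_compose[OF _ measurable_fst] measurable_compose[OF _ measurable_snd])
  have e2: "0 < \<epsilon> / 2" using \<epsilon> by simp
  obtain C1 d1 where 1: "compact C1" "C1 \<subseteq> Q" "emeasure lborel (Q - C1) \<le> ennreal (\<epsilon>/2)" "0 < d1"
    "\<forall>z\<in>C1. \<forall>z'\<in>C1. dist z z' < d1 \<longrightarrow> \<bar>fst (F z) - fst (F z')\<bar> < \<kappa>"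
    using almost_uniformly_continuous[OF m(1) F(2) Q \<kappa> e2] by blast
  obtain C2 d2 where 2: "compact C2" "C2 \<subseteq> Q" "emeasure lborel (Q - C2) \<le> ennreal (\<epsilon>/2)" "0 < d2"
    "\<forall>z\<in>C2. \<forall>z'\<in>C2. dist z z' < d2 \<longrightarrow> \<bar>snd (F z) - snd (F z')\<bar> < \<kappa>"
    using almost_uniformly_continuous[OF m(2) F(3) Q \<kappa> e2] by blast
  have b: "C1 \<in> sets borel" "C2 \<in> sets borel" using 1 2 by (auto intro: borel_compact)
  have "emeasure lborel (Q - C1 \<inter> C2) \<le> emeasure lborel ((Q - C1) \<union> (Q - C2))"
    using Q b by (intro emeasure_mono) auto
  also have "\<dots> \<le> emeasure lborel (Q - C1) + emeasure lborel (Q - C2)"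
    using Q b by (intro emeasure_subadditive) auto
  also have "\<dots> \<le> ennreal (\<epsilon>/2) + ennreal (\<epsilon>/2)" using 1 2 by (intro add_mono) auto
  also have "\<dots> = ennreal \<epsilon>" using \<epsilon> by (simp add: ennreal_plus[symmetric] del: ennreal_plus)
  finally show ?thesis using 1 2 b
    by (intro exI[of _ "C1 \<inter> C2"] exI[of _ "min d1 d2"]) auto
qed

text \<open>All area estimates are made with Lebesgue measure on the plane. This identifies the
  restricted, multiplied, again restricted and normalised measure with it, up to the factor given by
  the area under the graph.\<close>

lemma special_flow_measure_eq:
  fixes f :: "real \<Rightarrow> real"
  assumes X: "under_graph {0..<1} f \<in> sets borel"
  shows "space (special_flow_measure circle_measure f) = under_graph {0..<1} f"
    and "A \<in> sets (special_flow_measure circle_measure f) \<longleftrightarrow> A \<in> sets borel \<and> A \<subseteq> under_graph {0..<1} f"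
    and "A \<in> sets borel \<Longrightarrow> A \<subseteq> under_graph {0..<1} f \<Longrightarrow>
      emeasure (special_flow_measure circle_measure f) A = emeasure lborel A / emeasure lborel (under_graph {0..<1} f)"
proof -
  let ?X = "under_graph {0..<1} f"
  let ?P = "circle_measure \<Otimes>\<^sub>M (lborel :: real measure)"
  have spc: "space circle_measure = {0..<1}" by (simp add: circle_measure_def space_restrict_space)
  have Xsub: "?X \<subseteq> {0..<1} \<times> UNIV" by (auto simp: under_graph_def)
  have circ_sets: "B \<in> sets circle_measure \<longleftrightarrow> B \<in> sets borel \<and> B \<subseteq> {0..<1}" for B
    by (auto simp: circle_measure_def sets_restrict_space_iff)
  have sfin: "sigma_finite_measure circle_measure"
    unfolding circle_measure_def by (rule sigma_finite_measure_restrict_space[OF sigma_finite_lborel]) simp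
  have PB: "B \<in> sets borel" if "B \<in> sets ?P" for B
  proof -
    have "B \<in> sigma_sets ({0..<1} \<times> UNIV) {a \<times> b |a b. a \<in> sets circle_measure \<and> b \<in> sets lborel}"
      using that unfolding sets_pair_measure spc by simp
    then have "B \<in> sets (lborel \<Otimes>\<^sub>M lborel :: (real \<times> real) measure)"
    proof (induction rule: sigma_sets.induct)
      case (Basic a)
      then show ?case by (auto simp: circ_sets)
    next
      case (Compl a)
      have "{0..<1} \<times> (UNIV :: real set) \<in> sets (lborel \<Otimes>\<^sub>M lborel :: (real \<times> real) measure)" by auto
      then show ?case using Compl(2) by (rule sets.Diff)
    qed auto
    then show ?thesis by (simp only: sets_lborel_pair)
  qed
  have BP: "B \<in> sets ?P" if "B \<in> sets borel" "B \<subseteq> {0..<1} \<times> UNIV" for B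
  proof -
    have "(\<lambda>x. x) \<in> circle_measure \<rightarrow>\<^sub>M borel"
      unfolding circle_measure_def by (rule measurable_restrict_space1) simp
    then have "(\<lambda>z. z) \<in> ?P \<rightarrow>\<^sub>M (borel \<Otimes>\<^sub>M borel)"
      by (subst measurable_pair_iff) (auto simp: comp_def intro: measurable_compose[OF measurable_fst])
    then have "(\<lambda>z. z) -` B \<inter> space ?P \<in> sets ?P"
      by (rule measurable_sets) (simp only: borel_prod that(1))
    moreover have "(\<lambda>z. z) -` B \<inter> space ?P = B" using that(2) by (auto simp: space_pair_measure spc)
    ultimately show ?thesis by simp
  qed
  have emP: "emeasure ?P B = emeasure lborel B" if B: "B \<in> sets borel" "B \<subseteq> {0..<1} \<times> UNIV" for B
  proof -
    have B2: "B \<in> sets (lborel \<Otimes>\<^sub>M lborel)" using B(1) by (simp only: sets_lborel_pair)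
    have "emeasure ?P B = (\<integral>\<^sup>+x. emeasure lborel (Pair x -` B) \<partial>circle_measure)"
      by (rule lborel.emeasure_pair_measure_alt[OF BP[OF B]])
    also have "\<dots> = (\<integral>\<^sup>+x. emeasure lborel (Pair x -` B) * indicator {0..<1} x \<partial>lborel)"
      unfolding circle_measure_def by (rule nn_integral_restrict_space) simp
    also have "\<dots> = (\<integral>\<^sup>+x. emeasure lborel (Pair x -` B) \<partial>lborel)"
    proof (rule nn_integral_cong)
      fix x :: real
      have "x \<notin> {0..<1} \<Longrightarrow> Pair x -` B = {}" using B(2) by auto
      then show "emeasure lborel (Pair x -` B) * indicator {0..<1} x = emeasure lborel (Pair x -` B)"
        by (cases "x \<in> {0..<1}") auto
    qed
    also have "\<dots> = emeasure lborel B"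
      unfolding lborel_pair_eq by (rule lborel.emeasure_pair_measure_alt[OF B2, symmetric])
    finally show ?thesis .
  qed
  let ?R = "restrict_space ?P ?X"
  have def: "special_flow_measure circle_measure f = uniform_measure ?R ?X"
    by (simp add: special_flow_measure_def spc Let_def)
  have XP: "?X \<in> sets ?P" by (rule BP[OF X Xsub])
  have Rsets: "A \<in> sets ?R \<longleftrightarrow> A \<in> sets borel \<and> A \<subseteq> ?X" for A
  proof -
    have "A \<in> sets ?R \<longleftrightarrow> A \<in> sets ?P \<and> A \<subseteq> ?X"
      using XP by (auto simp: sets_restrict_space_iff space_pair_measure)
    then show ?thesis using PB BP Xsub by blast
  qed
  show "space (special_flow_measure circle_measure f) = ?X"
    using sets.sets_into_space[OF XP] by (auto simp: def space_restrict_space)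
  show "A \<in> sets (special_flow_measure circle_measure f) \<longleftrightarrow> A \<in> sets borel \<and> A \<subseteq> ?X"
    unfolding def sets_uniform_measure by (rule Rsets)
  show "emeasure (special_flow_measure circle_measure f) A = emeasure lborel A / emeasure lborel ?X"
    if A: "A \<in> sets borel" "A \<subseteq> ?X"
  proof -
    have eR: "emeasure ?R B = emeasure lborel B" if "B \<in> sets borel" "B \<subseteq> ?X" for B
      using that XP Xsub by (subst emeasure_restrict_space) (auto simp: space_pair_measure emP)
    have "?X \<inter> A = A" using A by auto
    then show ?thesis unfolding def using A X Rsets
      by (subst emeasure_uniform_measure) (auto simp: eR)
  qed
qed


lemma under_graph_borel:
  fixes f :: "real \<Rightarrow> real"
  assumes "(\<lambda>x. f (frac x)) \<in> borel_measurable borel"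
  shows "under_graph {0..<1} f \<in> sets borel"
proof -
  have u: "(\<lambda>z. f (frac (fst z))) \<in> borel_measurable (borel \<Otimes>\<^sub>M (borel :: real measure))"
    by (rule measurable_compose[OF measurable_fst assms])
  have fs: "fst \<in> borel_measurable ((borel :: real measure) \<Otimes>\<^sub>M (borel :: real measure))"
    "snd \<in> borel_measurable ((borel :: real measure) \<Otimes>\<^sub>M (borel :: real measure))"
    by (rule measurable_fst measurable_snd)+
  have "under_graph {0..<1} f = {z \<in> space (borel \<Otimes>\<^sub>M borel). 0 \<le> fst z \<and> fst z < 1 \<and> 0 \<le> snd z \<and> snd z < f (frac (fst z))}"
    by (auto simp: under_graph_def frac_eq[THEN iffD2] space_pair_measure)
  also have "\<dots> \<in> sets (borel \<Otimes>\<^sub>M borel)"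
    by (intro sets.sets_Collect_conj borel_measurable_le borel_measurable_less borel_measurable_const fs u)
  finally show ?thesis by (simp only: borel_prod)
qed

lemma under_graph_emeasure:
  assumes m: "(\<lambda>x. f (frac x)) \<in> borel_measurable borel"
    and bd: "\<And>x. f (frac x) \<le> M" and pos: "\<And>x. 0 < f (frac x)"
  defines "c \<equiv> ivl_integral (\<lambda>x. f (frac x)) 0 1"
  shows "emeasure lborel (under_graph {0..<1} f) = ennreal c" and "0 < c" and "c \<le> M"
proof -
  let ?u = "\<lambda>x. f (frac x)"
  let ?X = "under_graph {0..<1} f"
  note [measurable] = m
  have li: "locally_integrable ?u"
    by (rule locally_integrable_bounded[OF m, of M]) (use bd pos in \<open>auto simp: less_imp_le\<close>)
  have nn: "(\<integral>\<^sup>+x. ennreal (indicator {0<..1} x *\<^sub>R ?u x) \<partial>lborel) = ennreal c"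
    unfolding c_def set_lebesgue_integral_def
    using locally_integrableD[OF li] pos by (intro nn_integral_eq_integral) (auto simp: set_integrable_def less_imp_le)
  have X2: "?X \<in> sets (lborel \<Otimes>\<^sub>M lborel)"
    using under_graph_borel[OF m] by (simp only: sets_lborel_pair)
  have "emeasure lborel ?X = (\<integral>\<^sup>+x. emeasure lborel (Pair x -` ?X) \<partial>lborel)"
    unfolding lborel_pair_eq by (rule lborel.emeasure_pair_measure_alt[OF X2])
  also have "\<dots> = (\<integral>\<^sup>+x. ennreal (indicator {0<..1} x *\<^sub>R ?u x) \<partial>lborel)"
  proof (rule nn_integral_cong_AE)
    \<comment> \<open>The graph lies over \<open>{0..<1}\<close> whereas \<open>ivl_integral\<close>
      uses \<open>{0<..1}\<close>; the two agree off the end points.\<close>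
    show "AE x in lborel. emeasure lborel (Pair x -` ?X) = ennreal (indicator {0<..1} x *\<^sub>R ?u x)"
      using AE_lborel_singleton[of 0] AE_lborel_singleton[of 1]
    proof eventually_elim
      case (elim x)
      show ?case
      proof (cases "x \<in> {0<..<1}")
        case True
        then have "Pair x -` ?X = {0..<?u x}" by (auto simp: under_graph_def frac_eq[THEN iffD2])
        then show ?thesis using True pos[of x] by simp
      next
        case False
        then have "Pair x -` ?X = {}" using elim by (auto simp: under_graph_def)
        moreover have "x \<notin> {0<..1}" using False elim by auto
        ultimately show ?thesis by simp
      qed
    qed
  qed
  finally show "emeasure lborel ?X = ennreal c" using nn by simp
  have "0 \<le> c" unfolding c_def by (rule ivl_integral_nonneg) (use pos in \<open>auto simp: less_imp_le\<close>)
  moreover have "c \<noteq> 0"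
  proof
    assume "c = 0"
    then have "(\<integral>\<^sup>+x. ennreal (indicator {0<..1} x *\<^sub>R ?u x) \<partial>lborel) = 0" using nn by simp
    then have "AE x in lborel. ennreal (indicator {0<..1} x *\<^sub>R ?u x) = 0"
      by (subst (asm) nn_integral_0_iff_AE) auto
    then have "AE x in lborel. x \<notin> {0<..1::real}"
    proof eventually_elim
      case (elim x)
      show ?case
      proof
        assume "x \<in> {0<..1}"
        then have "ennreal (f (frac x)) = 0" using elim by simp
        then show False using pos[of x] by (simp add: ennreal_eq_0_iff)
      qed
    qed
    then have "emeasure lborel {0<..1::real} = 0"
      by (subst (asm) AE_iff_measurable[of "{0<..1}"]) auto
    then show False by simp
  qed
  ultimately show "0 < c" by simp
  have "c \<le> ivl_integral (\<lambda>_. M) 0 1"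
    unfolding c_def by (rule ivl_integral_mono[OF li locally_integrable_const]) (rule bd)
  then show "c \<le> M" by (simp add: ivl_integral_const)
qed

text \<open>The strip lies in a box of height \<open>M\<close>, and the shift by \<open>s\<close>
  does not change the measure of a 1-periodic set within a period.\<close>

lemma strip_emeasure:
  assumes E: "E \<in> sets borel" "\<And>x. x + 1 \<in> E \<longleftrightarrow> x \<in> E"
    and bd: "\<And>x. f (frac x) \<le> M" and M: "0 \<le> M" and m: "(\<lambda>x. f (frac x)) \<in> borel_measurable borel"
  shows "{z. fst z + s \<in> E} \<in> sets (borel :: (real \<times> real) measure)"
    and "emeasure lborel (under_graph {0..<1} f \<inter> {z. fst z + s \<in> E}) \<le> ennreal (M * measure lborel (E \<inter> {0<..1}))"
proof -
  note [measurable] = E(1)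
  have "{z \<in> space (borel \<Otimes>\<^sub>M borel). fst z + s \<in> E} \<in> sets (borel \<Otimes>\<^sub>M (borel :: real measure))" by measurable
  then show Em: "{z. fst z + s \<in> E} \<in> sets (borel :: (real \<times> real) measure)"
    unfolding borel_prod by simp
  let ?v = "indicator E :: real \<Rightarrow> real"
  have per: "periodic ?v" by (simp add: periodic_def indicator_def E(2))
  have li: "locally_integrable ?v"
    by (rule locally_integrable_bounded[of _ 1]) (use E in \<open>auto simp: indicator_def\<close>)
  define A where "A = {x. x + s \<in> E}"
  have Am [measurable]: "A \<in> sets borel" unfolding A_def by measurable
  have ind: "measure lborel (B \<inter> {0<..1}) = ivl_integral (indicator B) 0 1" if "B \<in> sets borel" for B
  proof -
    have "ivl_integral (indicator B) 0 1 = (LINT x|lborel. indicator (B \<inter> {0<..1}) x)"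
      unfolding set_lebesgue_integral_def by (intro Bochner_Integration.integral_cong) (auto simp: indicator_def)
    then show ?thesis using that by simp
  qed
  have "measure lborel (A \<inter> {0<..1}) = ivl_integral (\<lambda>x. ?v (x + s)) 0 1"
  proof -
    have "(\<lambda>x. ?v (x + s)) = indicator A" by (auto simp: A_def indicator_def)
    then show ?thesis using ind[OF Am] by simp
  qed
  also have "\<dots> = ivl_integral ?v (0 + s) (1 + s)" by (rule ivl_integral_shift)
  also have "\<dots> = measure lborel (E \<inter> {0<..1})"
    using ivl_integral_period[OF per li, of s] ind[OF E(1)] by (simp add: add.commute)
  finally have mA: "measure lborel (A \<inter> {0<..1}) = measure lborel (E \<inter> {0<..1})" .
  have "emeasure lborel (A \<inter> {0..<1}) \<le> emeasure lborel ((A \<inter> {0<..1}) \<union> {0})"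
    by (intro emeasure_mono) auto
  also have "\<dots> = emeasure lborel (A \<inter> {0<..1})"
    by (intro emeasure_Un_null_set) auto
  also have "\<dots> = ennreal (measure lborel (E \<inter> {0<..1}))"
  proof -
    have "emeasure lborel (A \<inter> {0<..1}) \<le> emeasure lborel {0<..1::real}" by (intro emeasure_mono) auto
    then have "emeasure lborel (A \<inter> {0<..1}) \<noteq> \<infinity>" by (auto simp: top_unique)
    then show ?thesis using mA by (simp add: emeasure_eq_ennreal_measure)
  qed
  finally have eA: "emeasure lborel (A \<inter> {0..<1}) \<le> ennreal (measure lborel (E \<inter> {0<..1}))" .
  have "under_graph {0..<1} f \<inter> {z. fst z + s \<in> E} \<subseteq> (A \<inter> {0..<1}) \<times> {0..M}"
  proof (rule subsetI)
    fix z assume z: "z \<in> under_graph {0..<1} f \<inter> {z. fst z + s \<in> E}"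
    obtain x r where xr: "z = (x, r)" by (cases z)
    have "frac x = x" using z xr by (auto simp: under_graph_def frac_eq)
    then show "z \<in> (A \<inter> {0..<1}) \<times> {0..M}" using z xr bd[of x] by (auto simp: under_graph_def A_def)
  qed
  then have "emeasure lborel (under_graph {0..<1} f \<inter> {z. fst z + s \<in> E}) \<le> emeasure lborel ((A \<inter> {0..<1}) \<times> {0..M})"
  proof (rule emeasure_mono)
    have "(A \<inter> {0..<1}) \<times> {0..M} \<in> sets (lborel \<Otimes>\<^sub>M lborel)" by (rule pair_measureI) auto
    then show "(A \<inter> {0..<1}) \<times> {0..M} \<in> sets lborel" by (simp only: sets_lborel_pair sets_lborel)
  qed
  also have "\<dots> = emeasure lborel (A \<inter> {0..<1}) * emeasure lborel {0..M}"
    unfolding lborel_pair_eq by (rule lborel.emeasure_pair_measure_Times) auto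
  also have "\<dots> \<le> ennreal (measure lborel (E \<inter> {0<..1})) * ennreal M"
    using eA M by (intro mult_mono) auto
  also have "\<dots> = ennreal (M * measure lborel (E \<inter> {0<..1}))"
    using M by (simp add: ennreal_mult mult.commute)
  finally show "emeasure lborel (under_graph {0..<1} f \<inter> {z. fst z + s \<in> E}) \<le> ennreal (M * measure lborel (E \<inter> {0<..1}))" .
qed

section \<open>The main argument\<close>

lemma no_isomorphism_to_inverse:
  fixes \<alpha> :: real and f :: "real \<Rightarrow> real" and S :: "real \<times> real \<Rightarrow> real \<times> real"
  assumes Lam: "\<alpha> \<in> Lambda_set"
    and f_pos: "\<forall>x\<in>{0..<1}. 0 < f x"
    and pac: "piecewise_abs_continuous K \<beta> f"
    and jumps: "sum_of_jumps K \<beta> f \<noteq> 0"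
    and S: "measure_preserving_map (special_flow_measure circle_measure f) S"
    and inter: "intertwines_inverse (special_flow_measure circle_measure f) (special_flow {0..<1} (rotation \<alpha>) f) S"
  shows False
proof -

  \<comment> \<open>Periodic lift, density, and bounded centred Birkhoff sums\<close>
  define u where "u x = f (frac x)" for x
  have u_eq: "(\<lambda>x. f (frac x)) = u" by (simp add: u_def fun_eq_iff)
  obtain G Mu where um: "u \<in> borel_measurable borel" and ub: "\<forall>x. \<bar>u x\<bar> \<le> Mu"
    and Gm: "G \<in> borel_measurable borel" and Gper: "periodic G" and Gli: "locally_integrable G"
    and incr: "\<forall>a b. a \<le> b \<longrightarrow> (\<forall>z\<in>\<beta> ` {..<K}. \<forall>m::int. z + of_int m \<notin> {a..b}) \<longrightarrow> u b - u a = ivl_integral G a b"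
    and GI: "ivl_integral G 0 1 = sum_of_jumps K \<beta> f"
    using piecewise_abs_continuous_density[OF pac, folded u_def] by blast
  define Z where "Z = \<beta> ` {..<K}"
  have finZ: "finite Z" by (simp add: Z_def)
  define J where "J = ivl_integral G 0 1"
  have J0: "J \<noteq> 0" using GI jumps by (simp add: J_def)
  have u_pos: "0 < u x" for x
    unfolding u_def using f_pos frac_ge_0[of x] frac_lt_1[of x] by simp
  have u_per: "periodic u" unfolding u_eq[symmetric] by simp
  define c where "c = ivl_integral u 0 1"
  have cX: "emeasure lborel (under_graph {0..<1} f) = ennreal c" and c0: "0 < c" and cM: "c \<le> Mu"
    using under_graph_emeasure[of f Mu] um ub u_pos unfolding u_eq c_def
    by (auto simp: u_def[symmetric] abs_le_iff)
  have Mu0: "0 < Mu" using c0 cM by linarith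
  have irr: "\<alpha> \<notin> \<rat>" using Lam by (simp add: Lambda_set_def)
  define B0 where "B0 = ivl_integral (\<lambda>x. \<bar>G x\<bar>) 0 1 + 4 * Mu * card Z"
  have B00: "0 \<le> B0"
    unfolding B0_def using Mu0 ivl_integral_nonneg[of "\<lambda>x. \<bar>G x\<bar>" 0 1] by simp
  have dk: "\<bar>birkhoff_sum \<alpha> u n x - real n * c\<bar> \<le> B0" if "rational_approx \<alpha> n m" for n m x
    unfolding c_def B0_def
  proof (rule denjoy_koksma[OF that u_per um _ _ _ _ finZ])
    show "\<bar>u x\<bar> \<le> Mu" for x using ub by blast
    show "periodic (\<lambda>x. \<bar>G x\<bar>)" using Gper by (simp add: periodic_def)
    show "locally_integrable (\<lambda>x. \<bar>G x\<bar>)" by (rule locally_integrable_abs[OF Gli])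
    show "\<bar>u b - u a\<bar> \<le> ivl_integral (\<lambda>x. \<bar>G x\<bar>) a b"
      if "a \<le> b" "\<forall>z\<in>Z. \<forall>m::int. z + of_int m \<notin> {a..b}" for a b
      using incr that ivl_integral_abs[OF Gli, of a b] unfolding Z_def by metis
  qed simp
  \<comment> \<open>Denjoy--Koksma bounds the sums from below by \<open>q k * c - B0\<close>, which
    exceeds \<open>B\<close> for a large denominator.\<close>
  have unb: "\<exists>n. \<forall>x. B < birkhoff_sum \<alpha> (\<lambda>x. f (frac x)) n x" for B
  proof -
    obtain \<delta> q p where q: "\<forall>k. rational_approx \<alpha> (q k) (p k)" "filterlim q at_top sequentially"
      using Lambda_set_approx[OF Lam, of 1] by auto
    obtain N :: nat where N: "(\<bar>B\<bar> + B0) / c < real N" using reals_Archimedean2 by blast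
    have "\<forall>\<^sub>F k in sequentially. N \<le> q k" using q(2) by (simp add: filterlim_at_top)
    then obtain k where k: "N \<le> q k" by (auto simp: eventually_sequentially)
    have "B < birkhoff_sum \<alpha> u (q k) x" for x
    proof -
      have "\<bar>B\<bar> + B0 < real N * c" using N c0 by (simp add: field_simps)
      also have "\<dots> \<le> real (q k) * c" using k c0 by simp
      finally show ?thesis using dk[OF q(1)[rule_format, of k], of x] by linarith
    qed
    then show ?thesis unfolding u_eq by blast
  qed
  have um': "(\<lambda>x. f (frac x)) \<in> borel_measurable borel" unfolding u_eq by (rule um)
  note P8 = irr f_pos unb um'

  \<comment> \<open>The phase space and the flow in planar coordinates\<close>
  define X where "X = under_graph {0..<1} f"
  have Xb: "X \<in> sets borel" unfolding X_def by (rule under_graph_borel[OF um'])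
  define M where "M = special_flow_measure circle_measure f"
  note Mfacts = special_flow_measure_eq[of f, OF Xb[unfolded X_def], folded X_def M_def]
  have Mem: "emeasure M A = emeasure lborel A / ennreal c" if "A \<in> sets borel" "A \<subseteq> X" for A
    using Mfacts(3)[OF that] cX by (simp add: X_def)
  have Sm: "S \<in> M \<rightarrow>\<^sub>M M" and Sd: "distr M M S = M"
    using S unfolding measure_preserving_map_def M_def by blast+
  define \<phi> where "\<phi> = special_flow {0..<1} (rotation \<alpha>) f"
  have inter': "AE z in M. \<phi> t (S z) = S (\<phi> (- t) z)" for t
    using inter unfolding intertwines_inverse_def M_def \<phi>_def by blast
  define \<Phi> where "\<Phi> z = suspend \<alpha> f (fst z) (snd z)" for z
  \<comment> \<open>\<open>S\<close> read in planar coordinates. Lusin's theorem is applied to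
    \<open>\<Psi>\<close> and also to \<open>\<Phi>\<close>, since neither need be
    continuous.\<close>
  define \<Psi> where "\<Psi> z = S (\<Phi> z)" for z
  have \<Phi>X: "\<Phi> z \<in> X" for z unfolding \<Phi>_def X_def by (rule suspend_in[OF P8])
  have \<Phi>m: "\<Phi> \<in> borel \<rightarrow>\<^sub>M borel"
  proof -
    have "\<Phi> = (\<lambda>(x, s). suspend \<alpha> f x s)" by (simp add: \<Phi>_def fun_eq_iff)
    then show ?thesis using suspend_measurable[OF P8] by (simp only: borel_prod)
  qed
  have \<Phi>M: "\<Phi> \<in> borel \<rightarrow>\<^sub>M M"
  proof (rule measurableI)
    show "\<Phi> z \<in> space M" for z using \<Phi>X by (simp add: Mfacts(1))
    show "\<Phi> -` A \<inter> space borel \<in> sets borel" if "A \<in> sets M" for A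
      using measurable_sets[OF \<Phi>m, of A] that by (simp add: Mfacts(2))
  qed
  have idM: "(\<lambda>z. z) \<in> M \<rightarrow>\<^sub>M borel"
  proof (rule measurableI)
    show "(\<lambda>z. z) -` A \<inter> space M \<in> sets M" if "A \<in> sets borel" for A
      using that Xb by (simp add: Mfacts(1,2) sets.Int)
  qed simp
  have SX: "S z \<in> X" if "z \<in> X" for z
    using measurable_space[OF Sm, of z] that by (simp add: Mfacts(1))
  have \<Psi>X: "\<Psi> z \<in> X" for z unfolding \<Psi>_def by (rule SX[OF \<Phi>X])
  have \<Psi>m: "\<Psi> \<in> borel \<rightarrow>\<^sub>M borel"
    using measurable_compose[OF measurable_compose[OF \<Phi>M Sm] idM] by (simp add: \<Psi>_def[abs_def])
  have X01: "0 \<le> fst z" "fst z < 1" "0 \<le> snd z" "snd z \<le> Mu" if "z \<in> X" for z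
  proof -
    show z: "0 \<le> fst z" "fst z < 1" "0 \<le> snd z" using that by (auto simp: X_def under_graph_def)
    have "frac (fst z) = fst z" using z by (simp add: frac_eq)
    then have "snd z < u (fst z)" using that by (auto simp: X_def under_graph_def u_def)
    also have "\<dots> \<le> Mu" using ub by (simp add: abs_le_iff)
    finally show "snd z \<le> Mu" by simp
  qed
  have X_bd: "\<bar>fst z\<bar> \<le> max 1 Mu" "\<bar>snd z\<bar> \<le> max 1 Mu" if "z \<in> X" for z
    using X01[OF that] by auto
  have flow: "\<phi> t z = \<Phi> (fst z, snd z + t)" if "z \<in> X" for t z
    using flow_eq_suspend[OF P8, of "fst z" t "snd z"] X01[OF that] by (simp add: \<phi>_def \<Phi>_def)
  \<comment> \<open>The jump part of the exceptional set will have measure at most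
    \<open>card Z * \<epsilon>0 \<le> c / (10 * Mu)\<close>; a strip over it has height at most
    \<open>Mu\<close>, hence area at most \<open>c / 10\<close>.\<close>
  define \<epsilon>0 where "\<epsilon>0 = c / (10 * Mu) / (real (card Z) + 1)"
  have \<epsilon>0: "0 < \<epsilon>0" unfolding \<epsilon>0_def using c0 Mu0 by simp
  obtain \<delta> q p where \<delta>: "0 < \<delta>" "\<delta> < \<epsilon>0" and ra: "\<forall>k. rational_approx \<alpha> (q k) (p k)"
    and q_lim: "filterlim q at_top sequentially"
    and \<delta>_lim: "(\<lambda>k. real (q k) * \<bar>real (q k) * \<alpha> - p k\<bar>) \<longlonglongrightarrow> \<delta>"
    using Lambda_set_approx[OF Lam \<epsilon>0] by blast
  \<comment> \<open>The last estimate of the proof yields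
    \<open>2 * \<bar>a\<bar> < 8 * \<kappa>\<close>: an error \<open>\<kappa>\<close> for each of
    two increments and \<open>6 * \<kappa>\<close> from comparing displacements. But
    \<open>\<bar>a\<bar>\<close> exceeds half of \<open>\<delta> * \<bar>J\<bar>\<close>, which is
    \<open>4 * \<kappa>\<close>.\<close>
  define \<kappa> where "\<kappa> = \<delta> * \<bar>J\<bar> / 8"
  have \<kappa>: "0 < \<kappa>" using \<delta> J0 by (simp add: \<kappa>_def)
  \<comment> \<open>Heights are at most \<open>Mu\<close>, a height change is at most
    \<open>2 * B0\<close>, and rounding it adds at most 1.\<close>
  define B where "B = Mu + 2 * B0 + 1"
  obtain \<kappa>0 where \<kappa>0: "0 < \<kappa>0" and sep: "\<forall>x s s'. \<bar>s\<bar> \<le> B \<longrightarrow> \<bar>s'\<bar> \<le> B \<longrightarrow>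
      \<bar>fst (suspend \<alpha> f x s) - fst (suspend \<alpha> f x s')\<bar> < \<kappa>0 \<longrightarrow> snd (suspend \<alpha> f x s) - snd (suspend \<alpha> f x s') = s - s'"
    using suspend_separation[OF P8, of B] by blast
  \<comment> \<open>Halved, because two points near a third one are compared.\<close>
  define \<kappa>1 where "\<kappa>1 = min \<kappa> \<kappa>0 / 2"
  have \<kappa>1: "0 < \<kappa>1" using \<kappa> \<kappa>0 by (simp add: \<kappa>1_def)
  \<comment> \<open>Large enough for points of \<open>X\<close> moved horizontally by at most 1 and
    vertically by at most \<open>2 * B0 + 1\<close>.\<close>
  define Q where "Q = {-2..3::real} \<times> {-B..B}"
  have Q: "Q \<in> sets borel" "bounded Q"
    unfolding Q_def by (auto intro!: borel_closed closed_Times bounded_Times)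
  \<comment> \<open>Each exceptional set consists of four pieces of area at most
    \<open>c / 40\<close> and a strip of area at most \<open>c / 5\<close>, together at most 3/10 of
    the phase space. One such set is needed for \<open>w\<close> and one for \<open>S w\<close>, and
    3/5 < 1.\<close>
  have c40: "0 < c / 40" using c0 by simp
  define near where "near y z \<longleftrightarrow> \<bar>fst y - fst z\<bar> < \<kappa>1 \<and> \<bar>snd y - snd z\<bar> < \<kappa>1" for y z :: "real \<times> real"
  obtain C1 d1 where C1: "C1 \<in> sets borel" "emeasure lborel (Q - C1) \<le> ennreal (c/40)" "0 < d1"
    "\<forall>z\<in>C1. \<forall>z'\<in>C1. dist z z' < d1 \<longrightarrow> near (\<Phi> z) (\<Phi> z')"
    using almost_uniformly_continuous_pair[OF \<Phi>m X_bd[OF \<Phi>X] Q \<kappa>1 c40] unfolding near_def by blast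
  obtain C2 d2 where C2: "C2 \<in> sets borel" "emeasure lborel (Q - C2) \<le> ennreal (c/40)" "0 < d2"
    "\<forall>z\<in>C2. \<forall>z'\<in>C2. dist z z' < d2 \<longrightarrow> near (\<Psi> z) (\<Psi> z')"
    using almost_uniformly_continuous_pair[OF \<Psi>m X_bd[OF \<Psi>X] Q \<kappa>1 c40] unfolding near_def by blast
  define d where "d = min (min d1 d2) (min \<kappa> 1)"
  have d: "0 < d" "d \<le> d1" "d \<le> d2" "d \<le> \<kappa>" "d \<le> 1" using C1(3) C2(3) \<kappa> by (auto simp: d_def)
  define err where "err k = ivl_integral (\<lambda>x. \<bar>birkhoff_sum \<alpha> G (q k) x / real (q k) - J\<bar>) 0 1" for k
  have err_lim: "err \<longlonglongrightarrow> 0"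
  proof -
    have ra': "rational_approx \<alpha> (q k) (p k)" for k using ra by blast
    have "mean_ergodic \<alpha> q G" by (rule mean_ergodic_periodic[where q = q and p = p, OF ra' q_lim Gper Gli])
    then show ?thesis
      by (simp add: mean_ergodic_def[where q = q and p = p, OF ra' q_lim] mean_error_def[where q = q and p = p, OF ra' q_lim] err_def[abs_def] J_def)
  qed
  \<comment> \<open>With \<delta>, \<open>\<kappa>\<close> and the Lusin sets fixed, one large
    \<open>k\<close> meets all remaining requirements.\<close>
  have "\<exists>k. real (q k) * \<bar>real (q k) * \<alpha> - p k\<bar> < \<epsilon>0 \<and> \<delta> / 2 < real (q k) * \<bar>real (q k) * \<alpha> - p k\<bar> \<and>
      err k < \<kappa> * (c / (10 * Mu)) \<and> 4 / d < real (q k)"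
  proof -
    have 1: "\<forall>\<^sub>F k in sequentially. real (q k) * \<bar>real (q k) * \<alpha> - p k\<bar> < \<epsilon>0"
      by (rule order_tendstoD(2)[OF \<delta>_lim \<delta>(2)])
    have 2: "\<forall>\<^sub>F k in sequentially. \<delta> / 2 < real (q k) * \<bar>real (q k) * \<alpha> - p k\<bar>"
      by (rule order_tendstoD(1)[OF \<delta>_lim]) (use \<delta> in simp)
    have 3: "\<forall>\<^sub>F k in sequentially. err k < \<kappa> * (c / (10 * Mu))"
      by (rule order_tendstoD(2)[OF err_lim]) (use \<kappa> c0 Mu0 in simp)
    obtain N :: nat where N: "4 / d < real N" using reals_Archimedean2 by blast
    have "\<forall>\<^sub>F k in sequentially. N \<le> q k" using q_lim by (simp add: filterlim_at_top)
    then have 4: "\<forall>\<^sub>F k in sequentially. 4 / d < real (q k)"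
      by eventually_elim (use N in \<open>simp add: order_less_le_trans\<close>)
    have "\<forall>\<^sub>F k in sequentially. real (q k) * \<bar>real (q k) * \<alpha> - p k\<bar> < \<epsilon>0 \<and> \<delta> / 2 < real (q k) * \<bar>real (q k) * \<alpha> - p k\<bar> \<and>
      err k < \<kappa> * (c / (10 * Mu)) \<and> 4 / d < real (q k)"
      using 1 2 3 4 by eventually_elim blast
    then show ?thesis by (auto simp: eventually_sequentially)
  qed
  then obtain k where k: "real (q k) * \<bar>real (q k) * \<alpha> - p k\<bar> < \<epsilon>0" "\<delta> / 2 < real (q k) * \<bar>real (q k) * \<alpha> - p k\<bar>"
      "err k < \<kappa> * (c / (10 * Mu))" "4 / d < real (q k)" by blast

  \<comment> \<open>The chosen denominator and the increments of \<open>F\<close>\<close>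
  define n where "n = q k"
  define m where "m = p k"
  define h where "h = real n * \<alpha> - m"
  have ran: "rational_approx \<alpha> n m" using ra by (simp add: n_def m_def)
  \<comment> \<open>The factor 4 leaves room, within \<open>d\<close>, for a shift by
    \<open>2 * \<bar>h\<bar>\<close> and a rounding by \<open>d / 2\<close>.\<close>
  have h_small: "4 * \<bar>h\<bar> < d"
  proof -
    have "\<bar>h\<bar> < 1 / real n" "0 < n" using ran by (auto simp: rational_approx_def h_def)
    moreover have "4 / d < real n" using k(4) by (simp add: n_def)
    ultimately have "\<bar>h\<bar> * real n < 1" "4 < d * real n" using d(1) by (auto simp: field_simps)
    then have "4 * \<bar>h\<bar> * real n < d * real n" by linarith
    then show ?thesis using \<open>0 < n\<close> by simp
  qed
  define a where "a = real n * h * J"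
  have a_big: "4 * \<kappa> < \<bar>a\<bar>"
  proof -
    have "\<delta> / 2 * \<bar>J\<bar> < real n * \<bar>h\<bar> * \<bar>J\<bar>"
      using k(2) J0 by (intro mult_strict_right_mono) (auto simp: n_def m_def h_def)
    then show ?thesis by (simp add: a_def \<kappa>_def abs_mult)
  qed
  define F where "F x = birkhoff_sum \<alpha> u n x - real n * c" for x
  have Fb: "\<bar>F x\<bar> \<le> B0" for x unfolding F_def by (rule dk[OF ran])
  have Fper: "periodic F" using birkhoff_sum_periodic[OF u_per, of \<alpha> n] by (simp add: F_def periodic_def)
  have Fm: "F \<in> borel_measurable borel" unfolding F_def[abs_def] birkhoff_sum_def using um by measurable
  have Fh: "F (x + real n * \<alpha>) = F (x + h)" for x
    using periodic_add_int[OF Fper, of "x + h" m] by (simp add: h_def)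
  obtain E where E: "E \<in> sets borel" "\<forall>x. x + 1 \<in> E \<longleftrightarrow> x \<in> E"
    "measure lborel (E \<inter> {0<..1}) \<le> card Z * (real n * \<bar>h\<bar>) + err k / \<kappa>"
    "\<forall>x. x \<notin> E \<longrightarrow> \<bar>birkhoff_sum \<alpha> u n (x + real n * \<alpha>) - birkhoff_sum \<alpha> u n x - a\<bar> < \<kappa>"
  proof -
    have errk: "err k = ivl_integral (\<lambda>x. \<bar>birkhoff_sum \<alpha> G n x / real n - ivl_integral G 0 1\<bar>) 0 1"
      by (simp only: err_def n_def J_def)
    have "\<exists>E\<in>sets borel. (\<forall>x. x + 1 \<in> E \<longleftrightarrow> x \<in> E) \<and>
      measure lborel (E \<inter> {0<..1}) \<le> card Z * (real n * \<bar>h\<bar>) + err k / \<kappa> \<and>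
      (\<forall>x. x \<notin> E \<longrightarrow> \<bar>birkhoff_sum \<alpha> u n (x + real n * \<alpha>) - birkhoff_sum \<alpha> u n x - a\<bar> < \<kappa>)"
      unfolding a_def J_def h_def errk
    proof (rule birkhoff_increment[OF ran u_per Gm Gper Gli finZ _ \<kappa>])
      show "u b - u a = ivl_integral G a b" if "a \<le> b" "\<forall>z\<in>Z. \<forall>m::int. z + of_int m \<notin> {a..b}" for a b
        using incr that unfolding Z_def by blast
    qed
    then show ?thesis using that by blast
  qed
  have E_incr: "\<bar>F (x + h) - F x - a\<bar> < \<kappa>" if "x \<notin> E" for x
    using E(4)[rule_format, OF that] Fh[of x] by (simp add: F_def)
  have E_small: "Mu * measure lborel (E \<inter> {0<..1}) \<le> c / 5"
  proof -
    have "card Z * (real n * \<bar>h\<bar>) \<le> (real (card Z) + 1) * \<epsilon>0"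
      using k(1) \<epsilon>0 by (intro mult_mono) (auto simp: n_def m_def h_def)
    also have "\<dots> = c / (10 * Mu)"
    proof -
      have "z * (y / z) = y" if "z \<noteq> 0" for y z :: real using that by simp
      then show ?thesis unfolding \<epsilon>0_def by (metis add_pos_nonneg less_irrefl of_nat_0_le_iff zero_less_one add.commute)
    qed
    finally have "card Z * (real n * \<bar>h\<bar>) + err k / \<kappa> \<le> c / (10 * Mu) + c / (10 * Mu)"
      using k(3) \<kappa> by (intro add_mono) (auto simp: field_simps)
    then have "Mu * measure lborel (E \<inter> {0<..1}) \<le> Mu * (c / (10 * Mu) + c / (10 * Mu))"
      using E(3) Mu0 by (intro mult_left_mono) auto
    also have "\<dots> = c / 5" using Mu0 by (simp add: field_simps)
    finally show ?thesis .
  qed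

  \<comment> \<open>Displacement by the flow at the times \<open>n * c\<close>,
    \<open>2 * n * c\<close> and their negatives\<close>
  have rot: "\<Phi> (x, r + real n * c) = \<Phi> (x + h, r - F x)" for x r
  proof -
    have "suspend \<alpha> f x (r + real n * c) =
        suspend \<alpha> f (x + of_int (int n) * \<alpha>) (r + real n * c - cocycle \<alpha> (\<lambda>x. f (frac x)) (int n) x)"
      by (rule suspend_rotate[OF P8, symmetric])
    \<comment> \<open>As \<open>n * \<alpha> = h + m\<close>, \<open>n\<close> returns move the base
      point by \<open>h\<close> only, and they use up the time \<open>n * c + F x\<close>.\<close>
    also have "x + of_int (int n) * \<alpha> = x + h + of_int m" by (simp add: h_def)
    also have "r + real n * c - cocycle \<alpha> (\<lambda>x. f (frac x)) (int n) x = r - F x"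
      unfolding cocycle_of_nat u_eq F_def by simp
    finally show ?thesis unfolding \<Phi>_def suspend_add_int[OF P8] fst_conv snd_conv .
  qed
  have rot2: "\<Phi> (x, r + 2 * (real n * c)) = \<Phi> (x + 2 * h, r - (F x + F (x + h)))" for x r
    using rot[of x "r + real n * c"] rot[of "x + h" "r - F x"] by (simp add: algebra_simps)
  have rot': "\<Phi> (x, r - real n * c) = \<Phi> (x - h, r + F (x - h))" for x r
    using rot[of "x - h" "r + F (x - h) - real n * c"] by (simp add: algebra_simps)
  have rot2': "\<Phi> (x, r - 2 * (real n * c)) = \<Phi> (x - 2 * h, r + (F (x - h) + F (x - 2 * h)))" for x r
    using rot'[of x "r - real n * c"] rot'[of "x - h" "r + F (x - h)"] by (simp add: algebra_simps)

  define g where "g = d / 2"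
  have g: "0 < g" "2 * \<bar>h\<bar> + g < d" using d h_small by (auto simp: g_def)
  \<comment> \<open>Times are rounded to the grid \<open>g \<int>\<close>, since the intertwining relation holds simultaneously only for
    countably many times.\<close>
  define \<rho> where "\<rho> y = g * of_int \<lfloor>y / g\<rfloor>" for y
  have \<rho>: "\<bar>\<rho> y - y\<bar> \<le> g" for y
  proof -
    have y: "g * (y / g) = y" using g(1) by simp
    have "g * of_int \<lfloor>y / g\<rfloor> \<le> g * (y / g)" using g(1) by (intro mult_left_mono) auto
    moreover have "g * (y / g) \<le> g * (of_int \<lfloor>y / g\<rfloor> + 1)"
      using g(1) by (intro mult_left_mono real_of_int_floor_add_one_ge) auto
    ultimately have "g * of_int \<lfloor>y / g\<rfloor> \<le> y" "y \<le> g * of_int \<lfloor>y / g\<rfloor> + g"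
      unfolding y by (simp_all only: distrib_left mult_1_right)
    then show ?thesis unfolding \<rho>_def by linarith
  qed
  have \<rho>m [measurable]: "\<rho> \<in> borel_measurable borel" unfolding \<rho>_def[abs_def] by measurable
  \<comment> \<open>\<open>- F\<close> and \<open>- e2\<close> are the height changes at the times
    \<open>n * c\<close> and \<open>2 * n * c\<close>, while \<open>e1'\<close> and
    \<open>e2'\<close> are those at the opposite times.\<close>
  define e2 where "e2 x = F x + F (x + h)" for x
  define e1' where "e1' x = F (x - h)" for x
  define e2' where "e2' x = F (x - h) + F (x - 2 * h)" for x
  note [measurable] = Fm
  have em: "(\<lambda>x. - F x) \<in> borel_measurable borel" "(\<lambda>x. - e2 x) \<in> borel_measurable borel"
    "e1' \<in> borel_measurable borel" "e2' \<in> borel_measurable borel"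
    "(\<lambda>x. \<rho> (e1' x)) \<in> borel_measurable borel" "(\<lambda>x. \<rho> (e2' x)) \<in> borel_measurable borel"
    unfolding e2_def e1'_def[abs_def] e2'_def[abs_def] by measurable
  have eb: "\<bar>- F x\<bar> \<le> 2 * B0 + 1" "\<bar>- e2 x\<bar> \<le> 2 * B0 + 1" "\<bar>e1' x\<bar> \<le> 2 * B0 + 1" "\<bar>e2' x\<bar> \<le> 2 * B0 + 1"
    "\<bar>\<rho> (e1' x)\<bar> \<le> 2 * B0 + 1" "\<bar>\<rho> (e2' x)\<bar> \<le> 2 * B0 + 1" for x
    using Fb[of x] Fb[of "x + h"] Fb[of "x - h"] Fb[of "x - 2 * h"] \<rho>[of "e1' x"] \<rho>[of "e2' x"] B00 d(5)
    unfolding e2_def e1'_def e2'_def g_def by linarith+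

  \<comment> \<open>Exceptional sets\<close>
  define bad where "bad C s e = (\<lambda>(x, r). (x + s, r + e x)) -` (Q - C)" for C :: "(real \<times> real) set" and s :: real and e :: "real \<Rightarrow> real"
  have bad: "bad C s e \<in> sets borel" "emeasure lborel (bad C s e) \<le> ennreal (c/40)"
    if "C \<in> sets borel" "emeasure lborel (Q - C) \<le> ennreal (c/40)" "e \<in> borel_measurable borel" for C s e
    using shear_emeasure[OF that(3), of "Q - C" s] that Q(1) by (auto simp: bad_def)
  have not_bad: "(fst z + s, snd z + e (fst z)) \<in> C"
    if "z \<in> X" "z \<notin> bad C s e" "\<bar>s\<bar> \<le> 1" "\<bar>e (fst z)\<bar> \<le> 2 * B0 + 1" for z C s e
    using that X01[OF that(1)] B00 Mu0 by (auto simp: bad_def Q_def B_def split_beta)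
  \<comment> \<open>Uniform continuity compares a shifted point with the unshifted one, so both must
    lie in the Lusin set. \<open>BY\<close> serves for \<open>S w\<close> and the forward
    displacements, \<open>BW\<close> for \<open>w\<close> and the backward ones; in
    \<open>BW\<close> the increment starts at \<open>x - 2 * h\<close>, in \<open>BY\<close> at the
    base point itself.\<close>
  define BY where "BY = X \<inter> (bad C1 h (\<lambda>x. - F x) \<union> bad C1 0 (\<lambda>x. - F x) \<union> (bad C1 (2 * h) (\<lambda>x. - e2 x) \<union> bad C1 0 (\<lambda>x. - e2 x))
      \<union> {z. fst z + 0 \<in> E})"
  define BW where "BW = X \<inter> (bad C2 (- h) e1' \<union> bad C2 0 (\<lambda>x. \<rho> (e1' x)) \<union> (bad C2 (- (2 * h)) e2' \<union> bad C2 0 (\<lambda>x. \<rho> (e2' x)))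
      \<union> {z. fst z + - (2 * h) \<in> E})"
  have strip: "{z. fst z + s \<in> E} \<in> sets (borel :: (real \<times> real) measure)" "emeasure lborel (X \<inter> {z. fst z + s \<in> E}) \<le> ennreal (c/5)" for s
  proof -
    have fb: "f (frac x) \<le> Mu" for x using ub by (simp add: u_def[symmetric] abs_le_iff)
    have E2: "x + 1 \<in> E \<longleftrightarrow> x \<in> E" for x using E(2) by blast
    show "{z. fst z + s \<in> E} \<in> sets (borel :: (real \<times> real) measure)"
    proof (rule strip_emeasure(1)[where f = f and M = Mu and E = E and s = s])
    qed (use E(1) E2 fb Mu0 um' in simp_all)
    have "emeasure lborel (X \<inter> {z. fst z + s \<in> E}) \<le> ennreal (Mu * measure lborel (E \<inter> {0<..1}))"
      unfolding X_def
    proof (rule strip_emeasure(2)[where f = f and M = Mu and E = E and s = s])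
    qed (use E(1) E2 fb Mu0 um' in simp_all)
    also have "\<dots> \<le> ennreal (c/5)" using E_small by (rule ennreal_leI)
    finally show "emeasure lborel (X \<inter> {z. fst z + s \<in> E}) \<le> ennreal (c/5)" .
  qed
  have small: "X \<inter> (A1 \<union> A2 \<union> (A3 \<union> A4) \<union> {z. fst z + s \<in> E}) \<in> sets M \<and>
      emeasure M (X \<inter> (A1 \<union> A2 \<union> (A3 \<union> A4) \<union> {z. fst z + s \<in> E})) \<le> ennreal (3/10)"
    if A: "A1 \<in> sets borel" "A2 \<in> sets borel" "A3 \<in> sets borel" "A4 \<in> sets borel"
      "emeasure lborel A1 \<le> ennreal (c/40)" "emeasure lborel A2 \<le> ennreal (c/40)"
      "emeasure lborel A3 \<le> ennreal (c/40)" "emeasure lborel A4 \<le> ennreal (c/40)" for A1 A2 A3 A4 s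
  proof
    let ?T = "A1 \<union> A2 \<union> (A3 \<union> A4)"
    let ?A = "X \<inter> (?T \<union> {z. fst z + s \<in> E})"
    have Ab: "?A \<in> sets borel" using A strip(1)[of s] Xb by auto
    then show "?A \<in> sets M" by (simp add: Mfacts(2))
    have T: "emeasure lborel ?T \<le> ennreal (c/40) + ennreal (c/40) + (ennreal (c/40) + ennreal (c/40))"
      using A by (intro order.trans[OF emeasure_subadditive] add_mono order.trans[OF emeasure_subadditive]) auto
    have "?A \<subseteq> ?T \<union> (X \<inter> {z. fst z + s \<in> E})" by blast
    then have "emeasure lborel ?A \<le> emeasure lborel (?T \<union> (X \<inter> {z. fst z + s \<in> E}))"
      using A strip(1)[of s] Xb by (intro emeasure_mono) auto
    also have "\<dots> \<le> emeasure lborel ?T + emeasure lborel (X \<inter> {z. fst z + s \<in> E})"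
      using A strip(1)[of s] Xb by (intro emeasure_subadditive) auto
    also have "\<dots> \<le> (ennreal (c/40) + ennreal (c/40) + (ennreal (c/40) + ennreal (c/40))) + ennreal (c/5)"
      using T strip(2) by (intro add_mono) auto
    also have "\<dots> = ennreal (3/10 * c)" using c0 by (simp flip: ennreal_plus)
    finally have "emeasure lborel ?A / ennreal c \<le> ennreal (3/10 * c) / ennreal c"
      by (rule divide_right_mono_ennreal)
    also have "\<dots> = ennreal (3/10)" using c0 by (subst divide_ennreal) auto
    finally show "emeasure M ?A \<le> ennreal (3/10)" using Mem[OF Ab] by auto
  qed
  have BY: "BY \<in> sets M" "emeasure M BY \<le> ennreal (3/10)"
    unfolding BY_def using small[OF bad(1)[OF C1(1,2) em(1)] bad(1)[OF C1(1,2) em(1)] bad(1)[OF C1(1,2) em(2)] bad(1)[OF C1(1,2) em(2)]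
        bad(2)[OF C1(1,2) em(1)] bad(2)[OF C1(1,2) em(1)] bad(2)[OF C1(1,2) em(2)] bad(2)[OF C1(1,2) em(2)]] by blast+
  have BW: "BW \<in> sets M" "emeasure M BW \<le> ennreal (3/10)"
    unfolding BW_def using small[OF bad(1)[OF C2(1,2) em(3)] bad(1)[OF C2(1,2) em(5)] bad(1)[OF C2(1,2) em(4)] bad(1)[OF C2(1,2) em(6)]
        bad(2)[OF C2(1,2) em(3)] bad(2)[OF C2(1,2) em(5)] bad(2)[OF C2(1,2) em(4)] bad(2)[OF C2(1,2) em(6)]] by blast+
  \<comment> \<open>As \<open>S\<close> preserves the measure, a condition on \<open>S w\<close>
    costs no more than the same condition on \<open>w\<close>.\<close>
  have SBY: "S -` BY \<inter> X \<in> sets M" "emeasure M (S -` BY \<inter> X) \<le> ennreal (3/10)"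
  proof -
    show "S -` BY \<inter> X \<in> sets M" using measurable_sets[OF Sm BY(1)] by (simp add: Mfacts(1))
    have "emeasure M BY = emeasure (distr M M S) BY" by (simp only: Sd)
    also have "\<dots> = emeasure M (S -` BY \<inter> X)" using emeasure_distr[OF Sm BY(1)] by (simp add: Mfacts(1))
    finally show "emeasure M (S -` BY \<inter> X) \<le> ennreal (3/10)" using BY(2) by simp
  qed

  \<comment> \<open>Choice of a good point\<close>
  have "AE z in M. \<forall>j::int. \<phi> (- (g * of_int j)) (S z) = S (\<phi> (g * of_int j) z)"
    unfolding AE_all_countable using inter'[of "- (g * of_int j)" for j] by simp
  then have "AE z in M. (\<phi> (real n * c) (S z) = S (\<phi> (- (real n * c)) z) \<and>
      \<phi> (2 * (real n * c)) (S z) = S (\<phi> (- (2 * (real n * c))) z)) \<and>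
      (\<forall>j::int. \<phi> (- (g * of_int j)) (S z) = S (\<phi> (g * of_int j) z))"
    using inter'[of "real n * c"] inter'[of "2 * (real n * c)"] by eventually_elim blast
  then obtain N where N: "{z\<in>space M. \<not> ((\<phi> (real n * c) (S z) = S (\<phi> (- (real n * c)) z) \<and>
      \<phi> (2 * (real n * c)) (S z) = S (\<phi> (- (2 * (real n * c))) z)) \<and>
      (\<forall>j::int. \<phi> (- (g * of_int j)) (S z) = S (\<phi> (g * of_int j) z)))} \<subseteq> N"
      "emeasure M N = 0" "N \<in> sets M" by (rule AE_E)
  have "\<exists>w\<in>X. w \<notin> N \<and> w \<notin> BW \<and> S w \<notin> BY"
  proof (rule ccontr)
    assume "\<not> ?thesis"
    then have "X \<subseteq> N \<union> (BW \<union> (S -` BY \<inter> X))" by blast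
    then have "emeasure M X \<le> emeasure M (N \<union> (BW \<union> (S -` BY \<inter> X)))"
      using N(3) BW(1) SBY(1) by (intro emeasure_mono) auto
    also have "\<dots> \<le> emeasure M N + (emeasure M BW + emeasure M (S -` BY \<inter> X))"
      using N(3) BW(1) SBY(1)
      by (intro order.trans[OF emeasure_subadditive] add_mono order.refl emeasure_subadditive sets.Un) auto
    also have "\<dots> \<le> 0 + (ennreal (3/10) + ennreal (3/10))"
      using N(2) BW(2) SBY(2) by (intro add_mono) auto
    also have "\<dots> = ennreal (3/5)" by (simp flip: ennreal_plus)
    finally have "emeasure M X \<le> ennreal (3/5)" .
    moreover have "emeasure M X = ennreal 1"
      using Mem[OF Xb order.refl] cX c0 by (simp add: X_def divide_ennreal)
    ultimately have "ennreal 1 \<le> ennreal (3/5)" by simp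
    then show False by (subst (asm) ennreal_le_iff) auto
  qed
  then obtain w where w: "w \<in> X" "w \<notin> N" "w \<notin> BW" "S w \<notin> BY" by blast

  \<comment> \<open>Contradiction at the good point\<close>
  define x where "x = fst w"
  define r where "r = snd w"
  define x' where "x' = fst (S w)"
  define r' where "r' = snd (S w)"
  have Sw: "S w \<in> X" by (rule SX[OF w(1)])
  have I: "\<phi> (real n * c) (S w) = S (\<phi> (- (real n * c)) w)" "\<phi> (2 * (real n * c)) (S w) = S (\<phi> (- (2 * (real n * c))) w)"
    "\<And>j::int. \<phi> (- (g * of_int j)) (S w) = S (\<phi> (g * of_int j) w)"
    using N(1) w(1,2) unfolding Mfacts(1) by blast+
  have h1: "\<bar>h\<bar> \<le> 1" "\<bar>2 * h\<bar> \<le> 1" "\<bar>- h\<bar> \<le> 1" "\<bar>- (2 * h)\<bar> \<le> 1" "\<bar>0::real\<bar> \<le> 1" using h_small d(5) by auto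
  have close: "dist (y + s, t) (y, t') < d" if "\<bar>s\<bar> \<le> 2 * \<bar>h\<bar>" "\<bar>t - t'\<bar> \<le> g" for y s t t' :: real
  proof -
    have "dist (y + s, t) (y, t') \<le> \<bar>s\<bar> + \<bar>t - t'\<bar>"
      using sqrt_sum_squares_le_sum_abs[of s "t - t'"] by (simp add: dist_Pair_Pair dist_real_def)
    then show ?thesis using that g(2) by linarith
  qed
  \<comment> \<open>\<open>A\<close> evaluates the flow at \<open>S w\<close> directly, \<open>Bw\<close> through \<open>S\<close>; \<open>AB\<close> compares the two times.\<close>
  have A: "near (\<phi> t (S w)) (\<Phi> (x', r' + e x'))"
    if eq: "\<Phi> (x', r' + t) = \<Phi> (x' + s, r' + e x')" and s: "\<bar>s\<bar> \<le> 2 * \<bar>h\<bar>"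
      and nb: "S w \<notin> bad C1 s e" "S w \<notin> bad C1 0 e" and eb': "\<bar>e x'\<bar> \<le> 2 * B0 + 1" for t s e
  proof -
    have "(x' + s, r' + e x') \<in> C1" "(x', r' + e x') \<in> C1"
      using not_bad[OF Sw nb(1)] not_bad[OF Sw nb(2)] s h1 eb' by (auto simp: x'_def r'_def)
    moreover have "dist (x' + s, r' + e x') (x', r' + e x') < d1"
      using close[OF s, of "r' + e x'" "r' + e x'" x'] g(1) d(2) by simp
    ultimately show ?thesis
      using C1(4) flow[OF Sw, of t] eq by (simp add: x'_def[symmetric] r'_def[symmetric])
  qed
  have Bw: "near (\<phi> t (S w)) (\<Phi> (x', r' - \<rho> (e x)))"
    if It: "\<phi> t (S w) = S (\<phi> (- t) w)" and eq: "\<Phi> (x, r - t) = \<Phi> (x + s, r + e x)" and s: "\<bar>s\<bar> \<le> 2 * \<bar>h\<bar>"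
      and nb: "w \<notin> bad C2 s e" "w \<notin> bad C2 0 (\<lambda>x. \<rho> (e x))" and eb': "\<bar>e x\<bar> \<le> 2 * B0 + 1" "\<bar>\<rho> (e x)\<bar> \<le> 2 * B0 + 1" for t s e
  proof -
    have "(x + s, r + e x) \<in> C2" "(x, r + \<rho> (e x)) \<in> C2"
      using not_bad[OF w(1) nb(1)] not_bad[OF w(1) nb(2)] s h1 eb' by (auto simp: x_def r_def)
    moreover have "dist (x + s, r + e x) (x, r + \<rho> (e x)) < d2"
      using close[OF s, of "r + e x" "r + \<rho> (e x)" x] \<rho>[of "e x"] d(3) by (simp add: abs_minus_commute)
    ultimately have "near (\<Psi> (x + s, r + e x)) (\<Psi> (x, r + \<rho> (e x)))" using C2(4) by blast
    moreover have "\<Psi> (x + s, r + e x) = \<phi> t (S w)"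
      using It flow[OF w(1), of "- t"] eq by (simp add: \<Psi>_def x_def r_def)
    \<comment> \<open>A height change by \<open>\<rho> (e x)\<close> at \<open>w\<close> is the flow
      for that time, and \<open>S\<close> turns it into the flow for the opposite time at
      \<open>S w\<close>; this is where the sign changes.\<close>
    moreover have "\<Psi> (x, r + \<rho> (e x)) = \<Phi> (x', r' - \<rho> (e x))"
    proof -
      have "\<Psi> (x, r + \<rho> (e x)) = S (\<phi> (\<rho> (e x)) w)" using flow[OF w(1)] by (simp add: \<Psi>_def x_def r_def)
      also have "\<dots> = \<phi> (- \<rho> (e x)) (S w)" using I(3)[of "\<lfloor>e x / g\<rfloor>"] by (simp add: \<rho>_def)
      also have "\<dots> = \<Phi> (x', r' - \<rho> (e x))" using flow[OF Sw] by (simp add: x'_def r'_def)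
      finally show ?thesis .
    qed
    ultimately show ?thesis by simp
  qed
  have AB: "\<bar>v + e\<bar> < 2 * \<kappa>"
    if "near y (\<Phi> (x', r' + v))"
      "near y (\<Phi> (x', r' - \<rho> e))"
      "\<bar>v\<bar> \<le> 2 * B0 + 1" "\<bar>\<rho> e\<bar> \<le> 2 * B0 + 1" for y v e
  proof -
    have r'B: "0 \<le> r'" "r' \<le> Mu" using X01[OF Sw] by (auto simp: r'_def)
    have "\<bar>fst (\<Phi> (x', r' + v)) - fst (\<Phi> (x', r' - \<rho> e))\<bar> < 2 * \<kappa>1"
      and sn: "\<bar>snd (\<Phi> (x', r' + v)) - snd (\<Phi> (x', r' - \<rho> e))\<bar> < 2 * \<kappa>1" using that(1,2) unfolding near_def by linarith+
    moreover have "2 * \<kappa>1 \<le> \<kappa>0" "2 * \<kappa>1 \<le> \<kappa>" by (auto simp: \<kappa>1_def)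
    moreover have "\<bar>r' + v\<bar> \<le> B" "\<bar>r' - \<rho> e\<bar> \<le> B" using r'B that(3,4) by (auto simp: B_def)
    ultimately have "snd (\<Phi> (x', r' + v)) - snd (\<Phi> (x', r' - \<rho> e)) = (r' + v) - (r' - \<rho> e)"
      unfolding \<Phi>_def fst_conv snd_conv by (intro sep[rule_format]) auto
    then have "\<bar>v + \<rho> e\<bar> < \<kappa>" using sn \<open>2 * \<kappa>1 \<le> \<kappa>\<close> by simp
    \<comment> \<open>Less than \<open>\<kappa>\<close> comes from the separation of heights and at
      most \<open>g = d / 2 < \<kappa>\<close> from the rounding.\<close>
    then show ?thesis using \<rho>[of e] d(4) g by linarith
  qed
  have nbY: "S w \<notin> bad C1 h (\<lambda>x. - F x)" "S w \<notin> bad C1 0 (\<lambda>x. - F x)" "S w \<notin> bad C1 (2 * h) (\<lambda>x. - e2 x)"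
     "S w \<notin> bad C1 0 (\<lambda>x. - e2 x)" "x' \<notin> E"
    using w(4) Sw by (auto simp: BY_def x'_def)
  have nbW: "w \<notin> bad C2 (- h) e1'" "w \<notin> bad C2 0 (\<lambda>x. \<rho> (e1' x))" "w \<notin> bad C2 (- (2 * h)) e2'"
     "w \<notin> bad C2 0 (\<lambda>x. \<rho> (e2' x))" "x - 2 * h \<notin> E"
    using w(1,3) by (auto simp: BW_def x_def)
  have t1: "\<bar>- F x' + e1' x\<bar> < 2 * \<kappa>"
  proof (rule AB[where y = "\<phi> (real n * c) (S w)"])
    show "near (\<phi> (real n * c) (S w)) (\<Phi> (x', r' + - F x'))"
      by (rule A[where s = h and e = "\<lambda>x. - F x", OF _ _ nbY(1,2) eb(1)]) (simp_all add: rot)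
    show "near (\<phi> (real n * c) (S w)) (\<Phi> (x', r' - \<rho> (e1' x)))"
      by (rule Bw[where s = "- h" and e = e1', OF I(1) _ _ nbW(1,2) eb(3,5)]) (simp_all add: rot' e1'_def)
  qed (use eb in auto)
  have t2: "\<bar>- e2 x' + e2' x\<bar> < 2 * \<kappa>"
  proof (rule AB[where y = "\<phi> (2 * (real n * c)) (S w)"])
    show "near (\<phi> (2 * (real n * c)) (S w)) (\<Phi> (x', r' + - e2 x'))"
      by (rule A[where s = "2 * h" and e = "\<lambda>x. - e2 x", OF _ _ nbY(3,4) eb(2)]) (simp_all add: rot2[folded e2_def])
    show "near (\<phi> (2 * (real n * c)) (S w)) (\<Phi> (x', r' - \<rho> (e2' x)))"
      by (rule Bw[where s = "- (2 * h)" and e = e2', OF I(2) _ _ nbW(3,4) eb(4,6)]) (simp_all add: rot2' e2'_def)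
  qed (use eb in auto)
  \<comment> \<open>The increments at \<open>x'\<close> and at \<open>x - 2 * h\<close> add up to
    \<open>2 * a\<close> within \<open>2 * \<kappa>\<close>, but by \<open>t1\<close> and
    \<open>t2\<close> they add up to 0 within \<open>6 * \<kappa>\<close>.\<close>
  have "\<bar>F (x' + h) - F x' - a\<bar> < \<kappa>" by (rule E_incr[OF nbY(5)])
  moreover have "\<bar>F (x - h) - F (x - 2 * h) - a\<bar> < \<kappa>"
    using E_incr[OF nbW(5)] by (simp add: algebra_simps)
  ultimately show False using t1 t2 a_big unfolding e2_def e1'_def e2'_def by linarith
qed

theorem theorem4p6:
  fixes \<alpha> :: real and f :: "real \<Rightarrow> real" and K :: nat and \<beta> :: "nat \<Rightarrow> real"
  assumes "\<alpha> \<in> Lambda_set"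
    and "\<forall>x\<in>{0..<1}. 0 < f x"
    and "piecewise_abs_continuous K \<beta> f"
    and "sum_of_jumps K \<beta> f \<noteq> 0"
  shows "\<not> reversible_flow (special_flow_measure circle_measure f)
             (special_flow {0..<1} (rotation \<alpha>) f)
       \<and> \<not> isomorphic_to_inverse (special_flow_measure circle_measure f)
             (special_flow {0..<1} (rotation \<alpha>) f)"
proof -
  have "\<not> isomorphic_to_inverse (special_flow_measure circle_measure f)
      (special_flow {0..<1} (rotation \<alpha>) f)"
    using no_isomorphism_to_inverse[OF assms]
    unfolding isomorphic_to_inverse_def invertible_measure_preserving_def by blast
  then show ?thesis
    unfolding reversible_flow_def isomorphic_to_inverse_def by blast
qed

end
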